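(* Let $A$ be a discrete valuation ring with uniformizing parameter $\tau$, let $B=A[x_1,\dots,x_n]/I$ be equidimensional, where $I$ is an ideal of $A[x_1,\dots,x_n]$, and let $Y=\operatorname{Spec}(B)\to T=\operatorname{Spec}(A)$ be the morphism corresponding to the ring homomorphism $A\to B$. Let $J\subset I$ be an ideal generated by a regular sequence whose length is $\operatorname{height}(I)$. Then: (1) $Y$ has no embedded components if and only if $J:(J:I)\subset I$; (2) $Y\to T$ is flat if and only if $I:\tau\subset I$; (3) $Y\to T$ is internally flat if and only if $(I:\tau)\cap (J:(J:I))\subset I$.
   Context: All schemes are over a field of characteristic zero. A morphism $\operatorname{Spec}(B)\to T=\operatorname{Spec}(A)$, with $A$ a discrete valuation ring, is internally flat if each embedded prime of $B$ contracts to zero in $A$ (equivalently, each embedded component of $\operatorname{Spec}(B)$ dominates $T$). For ideals $K,L$ of a ring $R$, $K:L=\{r\in R: rL\subset K\}$ denotes the ideal quotient, and $I:\tau=I:(\tau)$; the ideal quotients here are taken in $A[x_1,\dots,x_n]$.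
   Formalization: "Equidimensional" is taken to mean that all minimal primes of I have the same height in A[x_1,…,x_n]; with equal Krull dimension of the components instead, (1) fails for n=1, I=(τx−1)(τ,x). *)

theory Defs
  imports "HOL-Algebra.Algebra" "HOL-Algebra.Indexed_Polynomials" "HOL-Library.Extended_Nat"
begin

section \<open>Polynomial rings in finitely many variables\<close>

text \<open>As in \<^theory>\<open>HOL-Algebra.Indexed_Polynomials\<close>, monomials are multisets of variables and a
  polynomial is its coefficient function; the variables are \<open>0, \<dots>, n - 1\<close>. That theory provides
  constants and multiplication by a variable, but no ring structure.\<close>

definition mpoly_ring :: "('a, 'm) ring_scheme \<Rightarrow> nat \<Rightarrow> (nat multiset \<Rightarrow> 'a) ring" where
  "mpoly_ring A n =
    \<lparr>carrier = {p. (\<forall>m. p m \<in> carrier A) \<and> finite {m. p m \<noteq> \<zero>\<^bsub>A\<^esub>} \<and>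
                   (\<forall>m. p m \<noteq> \<zero>\<^bsub>A\<^esub> \<longrightarrow> set_mset m \<subseteq> {..<n})},
     monoid.mult = (\<lambda>p q m. \<Oplus>\<^bsub>A\<^esub>k\<in>{k. k \<subseteq># m}. p k \<otimes>\<^bsub>A\<^esub> q (m - k)),
     one = ring.indexed_const A \<one>\<^bsub>A\<^esub>,
     ring.zero = ring.indexed_const A \<zero>\<^bsub>A\<^esub>,
     add = (\<lambda>p q m. p m \<oplus>\<^bsub>A\<^esub> q m)\<rparr>"

definition quot_map :: "('a, 'm) ring_scheme \<Rightarrow> nat \<Rightarrow> (nat multiset \<Rightarrow> 'a) set \<Rightarrow>
    'a \<Rightarrow> (nat multiset \<Rightarrow> 'a) set" where
  "quot_map A n I a = I +>\<^bsub>mpoly_ring A n\<^esub> ring.indexed_const A a"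


section \<open>Discrete valuation rings\<close>

definition discrete_valuation_ring :: "('a, 'm) ring_scheme \<Rightarrow> bool" where
  "discrete_valuation_ring A \<longleftrightarrow>
     principal_domain A \<and> (\<exists>!M. maximalideal M A \<and> M \<noteq> {\<zero>\<^bsub>A\<^esub>})"

definition uniformizer :: "('a, 'm) ring_scheme \<Rightarrow> 'a \<Rightarrow> bool" where
  "uniformizer A t \<longleftrightarrow> t \<in> carrier A \<and> maximalideal (PIdl\<^bsub>A\<^esub> t) A"

definition char_zero :: "('a, 'm) ring_scheme \<Rightarrow> bool" where
  "char_zero K \<longleftrightarrow> (\<forall>m::nat. m > 0 \<longrightarrow> [m] \<cdot>\<^bsub>K\<^esub> \<one>\<^bsub>K\<^esub> \<noteq> \<zero>\<^bsub>K\<^esub>)"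


section \<open>Ideals\<close>

definition ideal_quotient :: "('a, 'm) ring_scheme \<Rightarrow> 'a set \<Rightarrow> 'a set \<Rightarrow> 'a set" where
  "ideal_quotient R K L = {r \<in> carrier R. \<forall>l\<in>L. r \<otimes>\<^bsub>R\<^esub> l \<in> K}"

definition minimal_primes :: "('a, 'm) ring_scheme \<Rightarrow> 'a set \<Rightarrow> 'a set set" where
  "minimal_primes R I = {P. primeideal P R \<and> I \<subseteq> P \<and>
     (\<forall>Q. primeideal Q R \<and> I \<subseteq> Q \<and> Q \<subseteq> P \<longrightarrow> Q = P)}"

definition associated_prime :: "('a, 'm) ring_scheme \<Rightarrow> 'a set \<Rightarrow> bool" where
  "associated_prime R P \<longleftrightarrow> primeideal P R \<and>
     (\<exists>b\<in>carrier R. P = {r \<in> carrier R. r \<otimes>\<^bsub>R\<^esub> b = \<zero>\<^bsub>R\<^esub>})"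

definition embedded_prime :: "('a, 'm) ring_scheme \<Rightarrow> 'a set \<Rightarrow> bool" where
  "embedded_prime R P \<longleftrightarrow> associated_prime R P \<and> P \<notin> minimal_primes R {\<zero>\<^bsub>R\<^esub>}"

definition prime_height :: "('a, 'm) ring_scheme \<Rightarrow> 'a set \<Rightarrow> enat" where
  "prime_height R P = Sup {enat l | l. \<exists>c :: nat \<Rightarrow> 'a set.
     (\<forall>i\<le>l. primeideal (c i) R) \<and> (\<forall>i<l. c i \<subset> c (Suc i)) \<and> c l = P}"

text \<open>The height of the unit ideal is \<open>\<infinity>\<close>.\<close>

definition ideal_height :: "('a, 'm) ring_scheme \<Rightarrow> 'a set \<Rightarrow> enat" where
  "ideal_height R I = (INF P\<in>{P. primeideal P R \<and> I \<subseteq> P}. prime_height R P)"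

text \<open>Equidimensionality of \<open>R Quot I\<close>, measured by codimension: all irreducible components of
  \<open>Spec (R/I)\<close> have the same codimension in \<open>Spec R\<close>. For \<open>R = A[x\<^sub>1,\<dots>,x\<^sub>n]\<close> over a discrete
  valuation ring \<open>A\<close> this amounts to equality of the dimensions \<open>n + 1 - height P\<close> of the
  components relative to \<open>Spec A\<close>. The Krull dimension of \<open>R/P\<close> can be one less than that when
  \<open>P\<close> contracts to zero in \<open>A\<close>: the prime ideal \<open>(\<tau> x - 1)\<close> of \<open>A[x]\<close> is maximal of height 1.\<close>

definition equidimensional_quotient :: "('a, 'm) ring_scheme \<Rightarrow> 'a set \<Rightarrow> bool" where
  "equidimensional_quotient R I \<longleftrightarrow>
     (\<forall>P\<in>minimal_primes R I. \<forall>Q\<in>minimal_primes R I. prime_height R P = prime_height R Q)"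

definition regular_sequence :: "('a, 'm) ring_scheme \<Rightarrow> 'a list \<Rightarrow> bool" where
  "regular_sequence R xs \<longleftrightarrow> set xs \<subseteq> carrier R \<and>
     (\<forall>i<length xs. \<forall>r\<in>carrier R.
        r \<otimes>\<^bsub>R\<^esub> xs ! i \<in> Idl\<^bsub>R\<^esub> (set (take i xs)) \<longrightarrow> r \<in> Idl\<^bsub>R\<^esub> (set (take i xs))) \<and>
     Idl\<^bsub>R\<^esub> (set xs) \<noteq> carrier R"


section \<open>Flatness\<close>

definition module_hom :: "('a, 'm) ring_scheme \<Rightarrow> ('a, 'u, 'p) module_scheme \<Rightarrow>
    ('a, 'v, 'q) module_scheme \<Rightarrow> ('u \<Rightarrow> 'v) set" where
  "module_hom A M M' = {f \<in> carrier M \<rightarrow> carrier M'.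
     (\<forall>x\<in>carrier M. \<forall>y\<in>carrier M. f (x \<oplus>\<^bsub>M\<^esub> y) = f x \<oplus>\<^bsub>M'\<^esub> f y) \<and>
     (\<forall>a\<in>carrier A. \<forall>x\<in>carrier M. f (a \<odot>\<^bsub>M\<^esub> x) = a \<odot>\<^bsub>M'\<^esub> f x)}"

definition tensor_relations :: "('a, 'm) ring_scheme \<Rightarrow> ('a, 'u, 'p) module_scheme \<Rightarrow>
    ('a, 'v, 'q) module_scheme \<Rightarrow> ('u \<times> 'v \<Rightarrow>\<^sub>0 int) set" where
  "tensor_relations A M N =
     {frag_of (x \<oplus>\<^bsub>M\<^esub> x', y) - frag_of (x, y) - frag_of (x', y) | x x' y.
        x \<in> carrier M \<and> x' \<in> carrier M \<and> y \<in> carrier N} \<union>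
     {frag_of (x, y \<oplus>\<^bsub>N\<^esub> y') - frag_of (x, y) - frag_of (x, y') | x y y'.
        x \<in> carrier M \<and> y \<in> carrier N \<and> y' \<in> carrier N} \<union>
     {frag_of (a \<odot>\<^bsub>M\<^esub> x, y) - frag_of (x, a \<odot>\<^bsub>N\<^esub> y) | a x y.
        a \<in> carrier A \<and> x \<in> carrier M \<and> y \<in> carrier N}"

definition tensor_kernel :: "('a, 'm) ring_scheme \<Rightarrow> ('a, 'u, 'p) module_scheme \<Rightarrow>
    ('a, 'v, 'q) module_scheme \<Rightarrow> ('u \<times> 'v \<Rightarrow>\<^sub>0 int) set" where
  "tensor_kernel A M N =
     generate (free_Abelian_group (carrier M \<times> carrier N)) (tensor_relations A M N)"

text \<open>The underlying abelian group of the tensor product, as a multiplicative monoid record.\<close>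

definition tensor_product :: "('a, 'm) ring_scheme \<Rightarrow> ('a, 'u, 'p) module_scheme \<Rightarrow>
    ('a, 'v, 'q) module_scheme \<Rightarrow> ('u \<times> 'v \<Rightarrow>\<^sub>0 int) set monoid" where
  "tensor_product A M N =
     free_Abelian_group (carrier M \<times> carrier N) Mod tensor_kernel A M N"

text \<open>The map \<open>f \<otimes> id\<close> from \<open>M \<otimes> N\<close> to \<open>M' \<otimes> N\<close>. For linear \<open>f\<close> the union is over one and the
  same coset.\<close>

definition tensor_map :: "('a, 'm) ring_scheme \<Rightarrow> ('a, 'u, 'p) module_scheme \<Rightarrow>
    ('a, 'v, 'q) module_scheme \<Rightarrow> ('u \<Rightarrow> 'w) \<Rightarrow> ('a, 'w, 's) module_scheme \<Rightarrow>
    ('u \<times> 'v \<Rightarrow>\<^sub>0 int) set \<Rightarrow> ('w \<times> 'v \<Rightarrow>\<^sub>0 int) set" where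
  "tensor_map A M N f M' C =
     (\<Union>z\<in>C. tensor_kernel A M' N #>\<^bsub>free_Abelian_group (carrier M' \<times> carrier N)\<^esub>
        frag_extend (\<lambda>(x, y). frag_of (f x, y)) z)"

text \<open>A module is flat if tensoring with it preserves injectivity. A definition cannot quantify
  over types, so the modules tested have carriers in the type \<^typ>\<open>'a + 'u\<close>, where \<^typ>\<open>'u\<close> is a
  parameter. Every \<^typ>\<open>'u\<close> gives the same notion: by the ideal criterion inclusions of ideals
  of \<open>A\<close> suffice, and their carriers embed in \<^typ>\<open>'a + 'u\<close>.\<close>

definition flat_module :: "'u itself \<Rightarrow> ('a, 'm) ring_scheme \<Rightarrow> ('a, 'v, 'q) module_scheme \<Rightarrow> bool"
  where
  "flat_module _ A N \<longleftrightarrow> module A N \<and>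
     (\<forall>(M :: ('a, 'a + 'u) module) (M' :: ('a, 'a + 'u) module) f.
        module A M \<and> module A M' \<and> f \<in> module_hom A M M' \<and> inj_on f (carrier M) \<longrightarrow>
        inj_on (tensor_map A M N f M') (carrier (tensor_product A M N)))"

definition restrict_scalars :: "('b, 'm) ring_scheme \<Rightarrow> ('a \<Rightarrow> 'b) \<Rightarrow> ('a, 'b) module" where
  "restrict_scalars B h =
     \<lparr>carrier = carrier B, monoid.mult = monoid.mult B, one = one B, ring.zero = ring.zero B, add = add B,
      smult = (\<lambda>a b. h a \<otimes>\<^bsub>B\<^esub> b)\<rparr>"

text \<open>Properties of the morphism \<open>Spec B \<rightarrow> Spec A\<close> given by a ring homomorphism \<open>h\<close>.\<close>

definition flat_hom :: "'u itself \<Rightarrow> ('a, 'm) ring_scheme \<Rightarrow> ('b, 'k) ring_scheme \<Rightarrow>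
    ('a \<Rightarrow> 'b) \<Rightarrow> bool" where
  "flat_hom U A B h \<longleftrightarrow> h \<in> ring_hom A B \<and> flat_module U A (restrict_scalars B h)"

definition internally_flat :: "('a, 'm) ring_scheme \<Rightarrow> ('b, 'k) ring_scheme \<Rightarrow>
    ('a \<Rightarrow> 'b) \<Rightarrow> bool" where
  "internally_flat A B h \<longleftrightarrow> h \<in> ring_hom A B \<and>
     (\<forall>P. embedded_prime B P \<longrightarrow> {a \<in> carrier A. h a \<in> P} = {\<zero>\<^bsub>A\<^esub>})"

end

theory Submission
  imports Defs
begin

text \<open>Let \<open>U\<close> be the set of all \<open>b\<close> that lie in \<open>I\<close> locally at every minimal prime of \<open>I\<close>. An embedded
  prime of \<open>R/I\<close> containing \<open>t\<close> exists if and only if \<open>(I : t) \<inter> U\<close> is not contained in \<open>I\<close>; the cases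
  \<open>t = 0\<close> and \<open>t = \<tau>\<close> give (1) and (3) once \<open>U = J : (J : I)\<close> is known.

  This equality is local at the primes \<open>P\<close> associated to \<open>J\<close>. Since \<open>R\<close> is an iterated polynomial
  extension of a principal domain, \<open>P\<close> is locally generated by a regular sequence. Exchanging one element
  of a regular sequence at a time, from \<open>J\<close> to an ideal \<open>G\<close> generated by a regular sequence of the same
  length, does not change \<open>(J : C)/J\<close> up to isomorphism if \<open>C\<close> contains both sequences. With \<open>C = P\<close> this
  shows that the socle of \<open>R/J\<close> at \<open>P\<close> is simple, and counting lengths then gives \<open>J : (J : I) = I\<close>
  locally if \<open>P\<close> is minimal over \<open>J\<close>; the same duality for the powers of the generators of \<open>P\<close> shows that
  \<open>J\<close> has no embedded primes. Localizations are replaced by ideals saturated with respect to \<open>P\<close>.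

  For (2), flatness amounts to torsion-freeness: a finitely generated submodule of a torsion-free
  module over a discrete valuation ring has a basis, and an element of a tensor product that vanishes
  does so because of relations in finitely many elements.\<close>

section \<open>Ideals in Noetherian rings\<close>

text \<open>Equidimensionality and the height of \<open>I\<close> enter through a single fact: a
  prime containing a regular sequence of length \<open>r\<close> has height at least
  \<open>r\<close>, so a minimal prime of \<open>I\<close>, which has height exactly
  \<open>r\<close>, is also minimal over \<open>J\<close>. There \<open>J\<close> has finite
  colength locally, and the double annihilator can be computed by lengths. The inclusion of
  \<open>U\<close> in \<open>J : (J : I)\<close> needs that \<open>J\<close> is unmixed, and at a
  possible embedded prime \<open>P\<close> of \<open>J\<close> no lengths are available. This
  obstacle is bypassed by an ideal \<open>G\<close> generated by powers of a regular sequence that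
  generates \<open>P\<close> locally: \<open>P\<close> is minimal over \<open>G\<close>, so duality
  holds modulo \<open>G\<close>, and the exchange of sequences carries information on colon ideals
  from \<open>J\<close> to \<open>G\<close>. A single exchange of \<open>f\<close> for
  \<open>g\<close> is multiplication by the fraction \<open>g/f\<close>. For whole sequences an
  intermediate element is required that is a nonzerodivisor modulo initial parts of both; prime
  avoidance produces it, and this is why associated primes are shown to be finite in number.\<close>

lemma (in cring) idealI_add_mult:
  assumes "H \<subseteq> carrier R" "\<zero> \<in> H"
    and add: "\<And>x y. x \<in> H \<Longrightarrow> y \<in> H \<Longrightarrow> x \<oplus> y \<in> H"
    and mul: "\<And>r x. r \<in> carrier R \<Longrightarrow> x \<in> H \<Longrightarrow> r \<otimes> x \<in> H"
  shows "ideal H R"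
proof (rule idealI)
  show "ring R" by (rule ring_axioms)
  show "subgroup H (add_monoid R)"
  proof (rule add.subgroupI)
    fix a assume a: "a \<in> H"
    then have "(\<ominus> \<one>) \<otimes> a \<in> H" by (intro mul) auto
    moreover have "(\<ominus> \<one>) \<otimes> a = \<ominus> a" using a assms(1) by (auto simp: l_minus)
    ultimately show "\<ominus> a \<in> H" by simp
  qed (use assms in auto)
  fix a x assume "a \<in> H" "x \<in> carrier R"
  then show "x \<otimes> a \<in> H" "a \<otimes> x \<in> H"
    using mul m_comm[of a x] assms(1) by auto
qed

lemma (in ring) ideal_diff:
  assumes "ideal H R" "x \<in> H" "y \<in> H" shows "x \<ominus> y \<in> H"
proof -
  interpret ideal H R by fact
  show ?thesis unfolding a_minus_def using assms by (intro a_closed a_inv_closed) auto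
qed

lemma (in ring) ideal_add:
  assumes "ideal H R" "x \<in> H" "y \<in> H" shows "x \<oplus> y \<in> H"
  using additive_subgroup.a_closed[OF ideal.axioms(1)] assms by metis

lemma (in ring) ideal_zero:
  assumes "ideal H R" shows "\<zero> \<in> H"
  by (rule additive_subgroup.zero_closed[OF ideal.axioms(1)[OF assms]])

lemma (in ring) ideal_carr:
  assumes "ideal H R" "x \<in> H" shows "x \<in> carrier R"
  using assms by (rule ideal.Icarr)

lemma (in cring) ideal_lin:
  assumes "ideal H R" "x \<in> H" "y \<in> H" "r \<in> carrier R" "t \<in> carrier R"
  shows "r \<otimes> x \<ominus> t \<otimes> y \<in> H"
  using assms ideal_diff ideal.I_l_closed by metis

lemma (in cring) ideal_lin2:
  assumes "ideal H R" "x \<in> H" "y \<in> H" "r \<in> carrier R" "t \<in> carrier R"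
  shows "r \<otimes> x \<oplus> t \<otimes> y \<in> H"
  using assms ideal_add ideal.I_l_closed by metis

lemma (in cring) ideal_swap_diff:
  assumes "ideal H R" "x \<ominus> y \<in> H" "x \<in> carrier R" "y \<in> carrier R"
  shows "x \<in> H \<longleftrightarrow> y \<in> H"
proof
  have a: "x = (x \<ominus> y) \<oplus> y" "y = x \<ominus> (x \<ominus> y)" using assms by algebra+
  show "x \<in> H \<Longrightarrow> y \<in> H" using a(2) assms ideal_diff by metis
  show "y \<in> H \<Longrightarrow> x \<in> H" using a(1) assms ideal_add by metis
qed

lemma (in cring) ideal_ideal_quotient:
  assumes "ideal K R" "L \<subseteq> carrier R"
  shows "ideal (ideal_quotient R K L) R"
proof (rule idealI_add_mult)
  show "\<zero> \<in> ideal_quotient R K L"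
    using assms ideal_zero[OF assms(1)] by (auto simp: ideal_quotient_def subset_iff)
  fix x y assume "x \<in> ideal_quotient R K L" "y \<in> ideal_quotient R K L"
  then show "x \<oplus> y \<in> ideal_quotient R K L"
    using assms ideal_add[OF assms(1)] by (auto simp: ideal_quotient_def l_distr subset_iff)
next
  fix r x assume "r \<in> carrier R" "x \<in> ideal_quotient R K L"
  then show "r \<otimes> x \<in> ideal_quotient R K L"
    using assms ideal.I_l_closed[OF assms(1)]
    by (auto simp: ideal_quotient_def m_assoc subset_iff)
qed (auto simp: ideal_quotient_def)

text \<open>The colon ideal \<open>H : x\<close>, that is, the annihilator of the class of
  \<open>x\<close> in \<open>R/H\<close>. Prime ideals of this form are the associated primes of
  \<open>R/H\<close>; they are handled inside \<open>R\<close>, so that quotient rings appear only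
  at the very end.\<close>

definition annih :: "('a, 'm) ring_scheme \<Rightarrow> 'a set \<Rightarrow> 'a \<Rightarrow> 'a set" where
  "annih R H x = {y \<in> carrier R. y \<otimes>\<^bsub>R\<^esub> x \<in> H}"

definition nzd :: "('a, 'm) ring_scheme \<Rightarrow> 'a set \<Rightarrow> 'a \<Rightarrow> bool" where
  "nzd R H f \<longleftrightarrow> (\<forall>a\<in>carrier R. a \<otimes>\<^bsub>R\<^esub> f \<in> H \<longrightarrow> a \<in> H)"

lemma nzdD: "nzd R H f \<Longrightarrow> a \<otimes>\<^bsub>R\<^esub> f \<in> H \<Longrightarrow> a \<in> carrier R \<Longrightarrow> a \<in> H"
  by (auto simp: nzd_def)

lemma (in cring) ideal_annih:
  assumes "ideal H R" "x \<in> carrier R" shows "ideal (annih R H x) R"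
  using ideal_ideal_quotient[OF assms(1), of "{x}"] assms(2)
  by (simp add: ideal_quotient_def annih_def)

lemma (in noetherian_ring) ideal_maximal:
  assumes "S \<noteq> {}" "\<And>I. I \<in> S \<Longrightarrow> ideal I R"
  shows "\<exists>M\<in>S. \<forall>I\<in>S. M \<subseteq> I \<longrightarrow> I = M"
proof (rule subset_Zorn_nonempty[OF assms(1)])
  fix C assume C: "C \<noteq> {}" "subset.chain S C"
  then have "subset.chain {I. ideal I R} C" using assms(2) by (auto simp: subset.chain_def)
  then have "\<Union>C \<in> C" by (rule ideal_chain_is_trivial[OF C(1)])
  then show "\<Union>C \<in> S" using C(2) by (auto simp: subset.chain_def)
qed

text \<open>Noetherian induction: a counterexample that is maximal among the counterexamples
  contradicts \<open>step\<close>, since all strictly larger ideals satisfy the claim.\<close>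

lemma (in noetherian_ring) ideal_induct [consumes 1, case_names less]:
  assumes "ideal I R"
    and step: "\<And>I. ideal I R \<Longrightarrow> (\<And>I'. ideal I' R \<Longrightarrow> I \<subset> I' \<Longrightarrow> Z I') \<Longrightarrow> Z I"
  shows "Z I"
proof (rule ccontr)
  assume "\<not> Z I"
  then have "\<exists>M\<in>{I. ideal I R \<and> \<not> Z I}. \<forall>I\<in>{I. ideal I R \<and> \<not> Z I}. M \<subseteq> I \<longrightarrow> I = M"
    using assms by (intro ideal_maximal) auto
  then show False using step by blast
qed

lemma (in noetherian_ring) ideal_seq_stable:
  fixes I :: "nat \<Rightarrow> 'a set"
  assumes "\<And>k. ideal (I k) R" "\<And>k. I k \<subseteq> I (Suc k)"
  shows "\<exists>k. \<forall>j\<ge>k. I j = I k"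
proof -
  have mono: "i \<le> j \<Longrightarrow> I i \<subseteq> I j" for i j using assms(2) lift_Suc_mono_le[of I] by blast
  have "\<exists>M\<in>range I. \<forall>J\<in>range I. M \<subseteq> J \<longrightarrow> J = M"
    using assms(1) by (intro ideal_maximal) auto
  then obtain k where k: "\<forall>j. I k \<subseteq> I j \<longrightarrow> I j = I k" by auto
  then show ?thesis using mono by blast
qed

locale noetherian_cring = noetherian_ring R + cring R for R (structure)

lemma primeideal_mult:
  assumes "primeideal Q R" "a \<in> carrier R" "b \<in> carrier R" "a \<otimes>\<^bsub>R\<^esub> b \<in> Q"
  shows "a \<in> Q \<or> b \<in> Q"
  using assms primeideal.I_prime by metis

lemma primeideal_one:
  assumes "primeideal Q R" shows "\<one>\<^bsub>R\<^esub> \<notin> Q"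
  using assms ideal.one_imp_carrier[of Q R] primeideal.I_notcarr[of Q R] primeideal.axioms(1) by metis

section \<open>Associated primes, prime avoidance and common nonzerodivisors\<close>

context noetherian_cring begin

text \<open>An annihilator that is maximal among those of the multiples of \<open>b\<close> outside
  \<open>H\<close> is prime: if \<open>y \<otimes> z\<close> kills \<open>r \<otimes> b\<close> and
  \<open>y\<close> does not, then the annihilator of \<open>y \<otimes> r \<otimes> b\<close>
  contains the maximal one, hence equals it, and it contains \<open>z\<close>. Keeping
  \<open>b\<close> fixed matters, as later arguments need an associated prime of the submodule
  generated by a given element.\<close>

lemma exists_prime_annih:
  assumes H: "ideal H R" and b: "b \<in> carrier R" "b \<notin> H"
  shows "\<exists>r\<in>carrier R. r \<otimes> b \<notin> H \<and> primeideal (annih R H (r \<otimes> b)) R"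
proof -
  let ?S = "{annih R H (r \<otimes> b) | r. r \<in> carrier R \<and> r \<otimes> b \<notin> H}"
  have "annih R H (\<one> \<otimes> b) \<in> ?S" using b by fastforce
  then have "\<exists>M\<in>?S. \<forall>I\<in>?S. M \<subseteq> I \<longrightarrow> I = M"
    using b ideal_annih[OF H] by (intro ideal_maximal) auto
  then obtain r where r: "r \<in> carrier R" "r \<otimes> b \<notin> H"
    and max: "\<And>t. t \<in> carrier R \<Longrightarrow> t \<otimes> b \<notin> H \<Longrightarrow> annih R H (r \<otimes> b) \<subseteq> annih R H (t \<otimes> b)
                \<Longrightarrow> annih R H (t \<otimes> b) = annih R H (r \<otimes> b)"
    by auto
  have "primeideal (annih R H (r \<otimes> b)) R"
  proof (rule primeidealI)
    show "ideal (annih R H (r \<otimes> b)) R" using r b H ideal_annih by simp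
    show "cring R" by (rule is_cring)
    show "carrier R \<noteq> annih R H (r \<otimes> b)" using r b
      by (metis (mono_tags, lifting) annih_def l_one m_closed mem_Collect_eq one_closed)
    fix y z assume yz: "y \<in> carrier R" "z \<in> carrier R" "y \<otimes> z \<in> annih R H (r \<otimes> b)"
    show "y \<in> annih R H (r \<otimes> b) \<or> z \<in> annih R H (r \<otimes> b)"
    proof (cases "y \<in> annih R H (r \<otimes> b)")
      case False
      then have n: "(y \<otimes> r) \<otimes> b \<notin> H" using yz r b by (auto simp: annih_def m_assoc)
      have "annih R H (r \<otimes> b) \<subseteq> annih R H ((y \<otimes> r) \<otimes> b)"
      proof
        fix w assume w: "w \<in> annih R H (r \<otimes> b)"
        then have "y \<otimes> (w \<otimes> (r \<otimes> b)) \<in> H"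
          using yz H by (auto simp: annih_def intro: ideal.I_l_closed)
        moreover have "y \<otimes> (w \<otimes> (r \<otimes> b)) = w \<otimes> ((y \<otimes> r) \<otimes> b)"
          using yz w r b unfolding annih_def by (simp add: m_ac)
        ultimately show "w \<in> annih R H ((y \<otimes> r) \<otimes> b)" using w by (simp add: annih_def)
      qed
      then have e: "annih R H ((y \<otimes> r) \<otimes> b) = annih R H (r \<otimes> b)"
        using max[of "y \<otimes> r"] n yz r by auto
      have "z \<otimes> ((y \<otimes> r) \<otimes> b) = y \<otimes> z \<otimes> (r \<otimes> b)" using yz r b by (simp add: m_ac)
      then have "z \<in> annih R H ((y \<otimes> r) \<otimes> b)" using yz by (simp add: annih_def)
      then show ?thesis using e by simp
    qed simp
  qed
  then show ?thesis using r by auto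
qed

text \<open>The submodule of \<open>R/H\<close> generated by \<open>b\<close> is isomorphic to the
  domain \<open>R/Q\<close>, in which every nonzero element has annihilator
  \<open>Q\<close>.\<close>

lemma annih_mult_prime:
  assumes H: "ideal H R" and Q: "primeideal Q R" "Q = annih R H b" and r: "r \<in> carrier R" "b \<in> carrier R"
    and n: "r \<otimes> b \<notin> H"
  shows "annih R H (r \<otimes> b) = Q"
proof -
  have rQ: "r \<notin> Q" using n r Q by (auto simp: annih_def)
  show ?thesis
  proof (intro equalityI subsetI)
    fix y assume y: "y \<in> annih R H (r \<otimes> b)"
    then have "y \<otimes> r \<in> Q" using Q r by (auto simp: annih_def m_assoc)
    then show "y \<in> Q" using primeideal_mult[OF Q(1), of y r] rQ y r by (auto simp: annih_def)
  next
    fix y assume y: "y \<in> Q"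
    then have "y \<in> carrier R" "y \<otimes> b \<in> H" using Q by (auto simp: annih_def)
    moreover from this have "r \<otimes> (y \<otimes> b) = y \<otimes> (r \<otimes> b)" using r by (simp add: m_ac)
    ultimately show "y \<in> annih R H (r \<otimes> b)"
      using ideal.I_l_closed[OF H, of "y \<otimes> b" r] r by (auto simp: annih_def)
  qed
qed

text \<open>An element \<open>x\<close> with prime annihilator spans a copy of \<open>R/Q\<close> in
  \<open>R/H\<close>, which has \<open>Q\<close> as its only associated prime. All others are
  associated to the quotient by the larger ideal \<open>H + R x\<close>, to which Noetherian
  induction applies.\<close>

lemma finite_annih_primes:
  assumes "ideal H R"
  shows "finite {Q. primeideal Q R \<and> (\<exists>a\<in>carrier R. Q = annih R H a)}"
  using assms
proof (induction H rule: ideal_induct)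
  case (less H)
  note H = less(1)
  let ?A = "\<lambda>H. {Q. primeideal Q R \<and> (\<exists>a\<in>carrier R. Q = annih R H a)}"
  show ?case
  proof (cases "\<one> \<in> H")
    case True
    then have "annih R H a = carrier R" if "a \<in> carrier R" for a
      using that ideal.one_imp_carrier[OF H] by (auto simp: annih_def)
    then have "?A H = {}" using primeideal.I_notcarr by fastforce
    then show ?thesis by (simp only: finite.emptyI)
  next
    case False
    then obtain x where x: "x \<in> carrier R" "x \<notin> H" "primeideal (annih R H x) R"
      using exists_prime_annih[OF H, of \<one>] by auto
    \<comment> \<open>This is \<open>H + R x\<close>, written so that membership exhibits the
      coefficient of \<open>x\<close>.\<close>
    let ?H = "{z \<in> carrier R. \<exists>r\<in>carrier R. z \<ominus> r \<otimes> x \<in> H}"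
    have HH: "ideal ?H R"
    proof (rule idealI_add_mult)
      show "\<zero> \<in> ?H"
      proof -
        have "\<zero> \<ominus> \<zero> \<otimes> x = \<zero>" using x by algebra
        then show ?thesis using ideal_zero[OF H] by (auto intro!: bexI[of _ \<zero>])
      qed
      fix z w assume zw: "z \<in> ?H" "w \<in> ?H"
      then obtain r t where rt: "r \<in> carrier R" "z \<ominus> r \<otimes> x \<in> H" "t \<in> carrier R" "w \<ominus> t \<otimes> x \<in> H"
        "z \<in> carrier R" "w \<in> carrier R"
        by auto
      then have "(z \<ominus> r \<otimes> x) \<oplus> (w \<ominus> t \<otimes> x) \<in> H" using ideal_add[OF H] by auto
      moreover have "(z \<ominus> r \<otimes> x) \<oplus> (w \<ominus> t \<otimes> x) = (z \<oplus> w) \<ominus> (r \<oplus> t) \<otimes> x"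
        using rt x by algebra
      ultimately show "z \<oplus> w \<in> ?H" using rt by auto
    next
      fix q z assume qz: "q \<in> carrier R" "z \<in> ?H"
      then obtain r where rt: "r \<in> carrier R" "z \<ominus> r \<otimes> x \<in> H" "z \<in> carrier R" by auto
      then have "q \<otimes> (z \<ominus> r \<otimes> x) \<in> H" using ideal.I_l_closed[OF H] qz by auto
      moreover have "q \<otimes> (z \<ominus> r \<otimes> x) = (q \<otimes> z) \<ominus> (q \<otimes> r) \<otimes> x"
        using rt x qz by algebra
      ultimately show "q \<otimes> z \<in> ?H" using rt qz by auto
    qed auto
    have sub: "H \<subseteq> ?H"
    proof
      fix z assume z: "z \<in> H"
      then have zc: "z \<in> carrier R" using ideal_carr[OF H] by auto
      have "z \<ominus> \<zero> \<otimes> x = z" using x zc by algebra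
      then show "z \<in> ?H" using z zc by (auto intro!: bexI[of _ \<zero>])
    qed
    have "x \<ominus> \<one> \<otimes> x = \<zero>" using x by algebra
    then have "x \<ominus> \<one> \<otimes> x \<in> H" using ideal_zero[OF H] by simp
    then have "x \<in> ?H" using x by (intro CollectI conjI bexI[of _ \<one>]) auto
    then have "H \<subset> ?H" using sub x by blast
    then have fin: "finite (?A ?H)" using HH by (intro less(2))
    have "?A H \<subseteq> insert (annih R H x) (?A ?H)"
    proof
      fix Q assume "Q \<in> ?A H"
      then obtain b where b: "b \<in> carrier R" "Q = annih R H b" "primeideal Q R" by auto
      show "Q \<in> insert (annih R H x) (?A ?H)"
      \<comment> \<open>If a multiple of \<open>b\<close> falls into \<open>H + R x\<close> without
        lying in \<open>H\<close>, it agrees modulo \<open>H\<close> with a multiple of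
        \<open>x\<close>, and both \<open>b\<close> and \<open>x\<close> have the annihilator of
        that multiple. Otherwise \<open>R b\<close> and \<open>R x\<close> meet trivially modulo
        \<open>H\<close>, and \<open>b\<close> keeps its annihilator modulo the larger
        ideal.\<close>
      proof (cases "\<exists>r\<in>carrier R. r \<otimes> b \<in> ?H \<and> r \<otimes> b \<notin> H")
        case True
        then obtain r q where r: "r \<in> carrier R" "q \<in> carrier R" "r \<otimes> b \<ominus> q \<otimes> x \<in> H" "r \<otimes> b \<notin> H" by auto
        then have q: "q \<otimes> x \<notin> H" using ideal_swap_diff[OF H r(3)] b x by auto
        have "annih R H (r \<otimes> b) = annih R H (q \<otimes> x)"
        proof -
          have "y \<otimes> (r \<otimes> b) \<in> H \<longleftrightarrow> y \<otimes> (q \<otimes> x) \<in> H" if y: "y \<in> carrier R" for y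
          proof -
            have "y \<otimes> (r \<otimes> b) \<ominus> y \<otimes> (q \<otimes> x) = y \<otimes> (r \<otimes> b \<ominus> q \<otimes> x)" using y r b x by algebra
            also have "\<dots> \<in> H" using r y ideal.I_l_closed[OF H] by auto
            finally show ?thesis using y r b x by (intro ideal_swap_diff[OF H]) auto
          qed
          then show ?thesis by (auto simp: annih_def)
        qed
        then have "Q = annih R H x"
          using annih_mult_prime[OF H b(3,2) r(1) b(1) r(4)] annih_mult_prime[OF H x(3) refl r(2) x(1) q] by simp
        then show ?thesis by simp
      next
        case False
        then have "annih R ?H b = annih R H b" using sub by (auto simp: annih_def)
        then show ?thesis using b by auto
      qed
    qed
    then show ?thesis using fin finite_subset by blast
  qed
qed

lemma exists_avoid_one:
  assumes "finite S" "primeideal Q R" "ideal C R" "\<not> C \<subseteq> Q" "\<And>D. D \<in> S \<Longrightarrow> ideal D R \<and> \<not> D \<subseteq> Q"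
  shows "\<exists>y\<in>C. y \<notin> Q \<and> (\<forall>D\<in>S. y \<in> D)"
  using assms(1,5)
proof (induction S)
  case empty
  then show ?case using assms by auto
next
  case (insert D S)
  then obtain y where y: "y \<in> C" "y \<notin> Q" "\<forall>D\<in>S. y \<in> D" by auto
  obtain z where z: "z \<in> D" "z \<notin> Q" using insert by blast
  have c: "y \<in> carrier R" "z \<in> carrier R" using y z assms insert ideal_carr by blast+
  have "y \<otimes> z \<in> C" "y \<otimes> z \<in> D" "\<forall>D\<in>S. y \<otimes> z \<in> D"
    using y z c assms(3) insert(4) by (auto intro: ideal.I_l_closed ideal.I_r_closed)
  moreover have "y \<otimes> z \<notin> Q" using primeideal_mult[OF assms(2) c] y z by auto
  ultimately show ?case by auto
qed

lemma prime_avoidance: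
  assumes "finite S" "ideal C R" "\<And>Q. Q \<in> S \<Longrightarrow> primeideal Q R \<and> \<not> C \<subseteq> Q"
  shows "\<exists>h\<in>C. \<forall>Q\<in>S. h \<notin> Q"
  using assms(1,3)
proof (induction "card S" arbitrary: S)
  case 0
  then show ?case using ideal_zero[OF assms(2)] by auto
next
  case (Suc n)
  \<comment> \<open>\<open>Q\<close> is minimal under inclusion, so none of the other primes lies in
    \<open>Q\<close>, and some element of \<open>C\<close> lies in all of them but not in
    \<open>Q\<close>. Adding it to \<open>h\<close> repairs \<open>h\<close> at \<open>Q\<close>
    without spoiling it elsewhere.\<close>
  then obtain Q where Q: "Q \<in> S" "\<And>D. D \<in> S \<Longrightarrow> D \<subseteq> Q \<Longrightarrow> D = Q"
    using finite_has_minimal[of S] by (metis card.empty nat.distinct(1))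
  have "\<exists>h\<in>C. \<forall>D\<in>S - {Q}. h \<notin> D"
    using Suc Q by (intro Suc(1)) auto
  then obtain h where h: "h \<in> C" "\<And>D. D \<in> S - {Q} \<Longrightarrow> h \<notin> D" by auto
  show ?case
  proof (cases "h \<in> Q")
    case False
    then show ?thesis using h by auto
  next
    case True
    have "\<exists>y\<in>C. y \<notin> Q \<and> (\<forall>D\<in>S - {Q}. y \<in> D)"
      using Suc Q assms(2) by (intro exists_avoid_one) (auto simp: primeideal.axioms(1))
    then obtain y where y: "y \<in> C" "y \<notin> Q" "\<And>D. D \<in> S - {Q} \<Longrightarrow> y \<in> D" by auto
    have c: "h \<in> carrier R" "y \<in> carrier R" using h y ideal_carr[OF assms(2)] by auto
    have e: "(h \<oplus> y) \<ominus> h = y" "(h \<oplus> y) \<ominus> y = h" using c by algebra+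
    have "h \<oplus> y \<notin> D" if "D \<in> S" for D
    proof
      assume a: "h \<oplus> y \<in> D"
      have D: "ideal D R" using Suc.prems(2)[OF that] primeideal.axioms(1) by auto
      show False
      proof (cases "D = Q")
        case True
        then show False using ideal_diff[OF D a, of h] \<open>h \<in> Q\<close> e y by simp
      next
        case False
        then have "h \<notin> D" "y \<in> D" using h y that by auto
        then show False using ideal_diff[OF D a, of y] e by simp
      qed
    qed
    moreover have "h \<oplus> y \<in> C" using h y ideal_add[OF assms(2)] by simp
    ultimately show ?thesis by auto
  qed
qed

text \<open>The zero divisors modulo \<open>H\<close> form the union of the finitely many associated
  primes, and \<open>C\<close> is contained in none of these because it contains a nonzerodivisor.
  Prime avoidance, applied to the associated primes of all members of \<open>S\<close> at once,
  gives one element for the whole family.\<close>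

lemma exists_common_nzd:
  assumes "finite S" "ideal C R" "\<And>H. H \<in> S \<Longrightarrow> ideal H R \<and> (\<exists>f\<in>C. nzd R H f)"
  shows "\<exists>h\<in>C. \<forall>H\<in>S. nzd R H h"
proof -
  let ?A = "\<lambda>H. {Q. primeideal Q R \<and> (\<exists>a\<in>carrier R. Q = annih R H a)}"
  have "\<exists>h\<in>C. \<forall>Q\<in>\<Union>(?A ` S). h \<notin> Q"
  proof (rule prime_avoidance)
    show "finite (\<Union>(?A ` S))"
    proof (rule finite_Union)
      fix M assume "M \<in> ?A ` S"
      then obtain H where "H \<in> S" "M = ?A H" by auto
      then show "finite M" using assms(3) finite_annih_primes[of H] by simp
    qed (use assms in simp)
    fix Q assume "Q \<in> \<Union>(?A ` S)"
    then obtain H a where H: "H \<in> S" "primeideal Q R" "a \<in> carrier R" "Q = annih R H a" by auto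
    obtain f where f: "f \<in> C" "nzd R H f" using assms H by blast
    have fc: "f \<in> carrier R" using f ideal_carr[OF assms(2)] by auto
    have "f \<notin> Q"
    proof
      assume "f \<in> Q"
      then have "a \<otimes> f \<in> H" using H fc by (auto simp: annih_def m_comm)
      then have "a \<in> H" using f nzdD[of R H f a] H by simp
      then have "\<one> \<in> Q" using H by (simp add: annih_def)
      then show False using H primeideal_one by metis
    qed
    then show "primeideal Q R \<and> \<not> C \<subseteq> Q" using H f by auto
  qed fact
  then obtain h where h: "h \<in> C" "\<forall>Q\<in>\<Union>(?A ` S). h \<notin> Q" by (elim bexE)
  have hc: "h \<in> carrier R" using h ideal_carr[OF assms(2)] by auto
  have "nzd R H h" if H: "H \<in> S" for H
    unfolding nzd_def
  proof (intro ballI impI, rule ccontr)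
    fix a assume a: "a \<in> carrier R" "a \<otimes> h \<in> H" "a \<notin> H"
    have iH: "ideal H R" using assms H by auto
    obtain r where r: "r \<in> carrier R" "primeideal (annih R H (r \<otimes> a)) R"
      using exists_prime_annih[OF iH a(1,3)] by auto
    have "r \<otimes> (a \<otimes> h) \<in> H" using a r iH by (auto intro: ideal.I_l_closed)
    moreover have "r \<otimes> (a \<otimes> h) = h \<otimes> (r \<otimes> a)" using a r hc by (simp add: m_ac)
    ultimately have "h \<in> annih R H (r \<otimes> a)" using hc by (simp add: annih_def)
    moreover have "annih R H (r \<otimes> a) \<in> \<Union>(?A ` S)" using H r a by (intro UN_I[OF H]) auto
    ultimately show False using h(2) by (auto simp only:)
  qed
  then show ?thesis using h by auto
qed

end

section \<open>Ideals saturated with respect to a prime\<close>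

locale noetherian_cring_prime = noetherian_cring +
  fixes P assumes P: "primeideal P R"
begin

definition saturated :: "'a set \<Rightarrow> bool" where
  "saturated H \<longleftrightarrow> ideal H R \<and> (\<forall>s\<in>carrier R - P. \<forall>a\<in>carrier R. s \<otimes> a \<in> H \<longrightarrow> a \<in> H)"

text \<open>The contraction to \<open>R\<close> of the ideal generated by \<open>H\<close> and
  \<open>f\<close> in the localization at \<open>P\<close>, with the denominator \<open>s\<close>
  carried along. For saturated \<open>H\<close> it is the least saturated ideal containing
  \<open>H\<close> and \<open>f\<close>.\<close>

definition ext :: "'a set \<Rightarrow> 'a \<Rightarrow> 'a set" where
  "ext H f = {a \<in> carrier R. \<exists>s\<in>carrier R - P. \<exists>r\<in>carrier R. s \<otimes> a \<ominus> r \<otimes> f \<in> H}"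

definition span :: "'a set \<Rightarrow> 'a list \<Rightarrow> 'a set" where
  "span H fs = foldl ext H fs"

text \<open>Regularity on the localization of \<open>R/H\<close> at \<open>P\<close> in the weak
  sense, where the sequence may generate everything.\<close>

definition regular_on :: "'a set \<Rightarrow> 'a list \<Rightarrow> bool" where
  "regular_on H fs \<longleftrightarrow> (\<forall>i<length fs. nzd R (span H (take i fs)) (fs ! i))"

lemma P_ideal: "ideal P R" using P primeideal.axioms(1) by auto

lemma P_carr: "p \<in> P \<Longrightarrow> p \<in> carrier R" using ideal_carr[OF P_ideal] by auto

lemma one_notin_P: "\<one> \<in> carrier R - P" using P primeideal_one by auto

lemma notin_P_mult: "s \<in> carrier R - P \<Longrightarrow> t \<in> carrier R - P \<Longrightarrow> s \<otimes> t \<in> carrier R - P"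
  using primeideal_mult[OF P] by auto

lemma saturatedD: "saturated H \<Longrightarrow> s \<otimes> a \<in> H \<Longrightarrow> s \<in> carrier R - P \<Longrightarrow> a \<in> carrier R \<Longrightarrow> a \<in> H"
  by (auto simp: saturated_def)

lemma saturated_ideal: "saturated H \<Longrightarrow> ideal H R"
  by (auto simp: saturated_def)

lemma saturated_carr: "saturated H \<Longrightarrow> x \<in> H \<Longrightarrow> x \<in> carrier R"
  using ideal_carr[OF saturated_ideal] by simp

lemma saturated_zero: "saturated H \<Longrightarrow> \<zero> \<in> H"
  using ideal_zero[OF saturated_ideal] by simp

lemma saturated_mult: "saturated H \<Longrightarrow> x \<in> H \<Longrightarrow> r \<in> carrier R \<Longrightarrow> r \<otimes> x \<in> H"
  using ideal.I_l_closed[OF saturated_ideal] by simp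

lemma saturated_lin:
  "saturated H \<Longrightarrow> x \<in> H \<Longrightarrow> y \<in> H \<Longrightarrow> r \<in> carrier R \<Longrightarrow> t \<in> carrier R \<Longrightarrow> r \<otimes> x \<ominus> t \<otimes> y \<in> H"
  using ideal_lin[OF saturated_ideal] by simp

lemma saturated_lin2:
  "saturated H \<Longrightarrow> x \<in> H \<Longrightarrow> y \<in> H \<Longrightarrow> r \<in> carrier R \<Longrightarrow> t \<in> carrier R \<Longrightarrow> r \<otimes> x \<oplus> t \<otimes> y \<in> H"
  using ideal_lin2[OF saturated_ideal] by simp

lemma saturated_carrier: "saturated (carrier R)"
  unfolding saturated_def using oneideal by auto

lemma saturated_prime: "primeideal Q R \<Longrightarrow> Q \<subseteq> P \<Longrightarrow> saturated Q"
  unfolding saturated_def using primeideal_mult[of Q R] primeideal.axioms(1) by blast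

lemma saturated_P: "saturated P" using saturated_prime P by auto

lemma saturated_ideal_quotient:
  assumes "saturated K" "L \<subseteq> carrier R" shows "saturated (ideal_quotient R K L)"
  unfolding saturated_def
proof (intro conjI ballI impI)
  show "ideal (ideal_quotient R K L) R" using assms ideal_ideal_quotient[OF saturated_ideal] by simp
  fix s a assume s: "s \<in> carrier R - P" "a \<in> carrier R" "s \<otimes> a \<in> ideal_quotient R K L"
  have "a \<otimes> l \<in> K" if l: "l \<in> L" for l
  proof (rule saturatedD[OF assms(1)])
    show "s \<otimes> (a \<otimes> l) \<in> K" using s l assms by (auto simp: ideal_quotient_def m_assoc subset_iff)
  qed (use s l assms in auto)
  then show "a \<in> ideal_quotient R K L" using s by (auto simp: ideal_quotient_def)
qed

lemma extI: "a \<in> carrier R \<Longrightarrow> s \<in> carrier R - P \<Longrightarrow> r \<in> carrier R \<Longrightarrow> s \<otimes> a \<ominus> r \<otimes> f \<in> H \<Longrightarrow> a \<in> ext H f"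
  unfolding ext_def by auto

lemma extE:
  assumes "a \<in> ext H f"
  obtains s r where "a \<in> carrier R" "s \<in> carrier R" "s \<notin> P" "r \<in> carrier R" "s \<otimes> a \<ominus> r \<otimes> f \<in> H"
  using assms unfolding ext_def by auto

lemma ext_least:
  assumes "saturated K" "H \<subseteq> K" "f \<in> K" shows "ext H f \<subseteq> K"
proof
  fix a assume "a \<in> ext H f"
  then obtain s r where sr: "a \<in> carrier R" "s \<in> carrier R" "s \<notin> P" "r \<in> carrier R" "s \<otimes> a \<ominus> r \<otimes> f \<in> H"
    by (elim extE)
  have "\<one> \<otimes> (s \<otimes> a \<ominus> r \<otimes> f) \<oplus> r \<otimes> f \<in> K"
    using assms sr by - (rule saturated_lin2, auto)
  moreover have "\<one> \<otimes> (s \<otimes> a \<ominus> r \<otimes> f) \<oplus> r \<otimes> f = s \<otimes> a"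
    using sr saturated_carr[OF assms(1,3)] by algebra
  ultimately show "a \<in> K" using saturatedD[OF assms(1)] sr by auto
qed

lemma ext_mem:
  assumes "saturated H" "f \<in> carrier R" shows "f \<in> ext H f"
proof (rule extI[of f \<one> \<one>])
  have "\<one> \<otimes> f \<ominus> \<one> \<otimes> f = \<zero>" using assms by algebra
  then show "\<one> \<otimes> f \<ominus> \<one> \<otimes> f \<in> H" using saturated_zero[OF assms(1)] by (simp only:)
qed (use assms one_notin_P in auto)

lemma ext_subset:
  assumes "saturated H" "f \<in> carrier R" shows "H \<subseteq> ext H f"
proof
  fix a assume a: "a \<in> H"
  then have c: "a \<in> carrier R" using saturated_carr[OF assms(1)] by simp
  have "\<one> \<otimes> a \<ominus> \<zero> \<otimes> f = a" using c assms by algebra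
  then show "a \<in> ext H f" using a c one_notin_P by (intro extI[of a \<one> \<zero>]) auto
qed

lemma saturated_ext:
  assumes H: "saturated H" and f: "f \<in> carrier R" shows "saturated (ext H f)"
  unfolding saturated_def
proof (intro conjI ballI impI)
  show "ideal (ext H f) R"
  proof (rule idealI_add_mult)
    show "ext H f \<subseteq> carrier R" by (auto simp: ext_def)
    show "\<zero> \<in> ext H f" using ext_subset[OF assms] saturated_zero[OF H] by auto
  next
    fix x y assume "x \<in> ext H f" "y \<in> ext H f"
    then obtain s r t q where c: "x \<in> carrier R" "s \<in> carrier R" "r \<in> carrier R"
        "y \<in> carrier R" "t \<in> carrier R" "q \<in> carrier R"
      and n: "s \<notin> P" "t \<notin> P" and m: "s \<otimes> x \<ominus> r \<otimes> f \<in> H" "t \<otimes> y \<ominus> q \<otimes> f \<in> H"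
      by (elim extE)
    show "x \<oplus> y \<in> ext H f"
    proof (rule extI[of _ "s \<otimes> t" "t \<otimes> r \<oplus> s \<otimes> q"])
      have "t \<otimes> (s \<otimes> x \<ominus> r \<otimes> f) \<oplus> s \<otimes> (t \<otimes> y \<ominus> q \<otimes> f) \<in> H"
        using H m c by - (rule saturated_lin2, auto)
      also have "t \<otimes> (s \<otimes> x \<ominus> r \<otimes> f) \<oplus> s \<otimes> (t \<otimes> y \<ominus> q \<otimes> f) =
          (s \<otimes> t) \<otimes> (x \<oplus> y) \<ominus> (t \<otimes> r \<oplus> s \<otimes> q) \<otimes> f"
        using c f by algebra
      finally show "(s \<otimes> t) \<otimes> (x \<oplus> y) \<ominus> (t \<otimes> r \<oplus> s \<otimes> q) \<otimes> f \<in> H" .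
    qed (use c n notin_P_mult in auto)
  next
    fix z x assume z: "z \<in> carrier R" "x \<in> ext H f"
    then obtain s r where c: "x \<in> carrier R" "s \<in> carrier R" "r \<in> carrier R"
      and n: "s \<notin> P" and m: "s \<otimes> x \<ominus> r \<otimes> f \<in> H"
      by (elim extE)
    show "z \<otimes> x \<in> ext H f"
    proof (rule extI[of _ s "z \<otimes> r"])
      have "z \<otimes> (s \<otimes> x \<ominus> r \<otimes> f) \<in> H" using saturated_mult H m z by auto
      also have "z \<otimes> (s \<otimes> x \<ominus> r \<otimes> f) = s \<otimes> (z \<otimes> x) \<ominus> z \<otimes> r \<otimes> f"
        using c f z by algebra
      finally show "s \<otimes> (z \<otimes> x) \<ominus> z \<otimes> r \<otimes> f \<in> H" .
    qed (use c n z in auto)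
  qed
  fix t a assume t: "t \<in> carrier R - P" "a \<in> carrier R" "t \<otimes> a \<in> ext H f"
  from t(3) obtain s r where c: "s \<in> carrier R" "r \<in> carrier R"
    and n: "s \<notin> P" and m: "s \<otimes> (t \<otimes> a) \<ominus> r \<otimes> f \<in> H"
    by (elim extE)
  show "a \<in> ext H f"
  proof (rule extI[of _ "s \<otimes> t" r])
    show "s \<otimes> t \<otimes> a \<ominus> r \<otimes> f \<in> H" using m c t by (simp add: m_assoc)
  qed (use c n t notin_P_mult in auto)
qed

lemma span_simps [simp]: "span H [] = H" "span H (f # fs) = span (ext H f) fs"
  "span H (fs @ [f]) = ext (span H fs) f"
  by (auto simp: span_def)

lemma saturated_span: "saturated H \<Longrightarrow> set fs \<subseteq> carrier R \<Longrightarrow> saturated (span H fs)"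
  by (induction fs arbitrary: H) (auto simp: saturated_ext)

lemma span_subset: "saturated H \<Longrightarrow> set fs \<subseteq> carrier R \<Longrightarrow> H \<subseteq> span H fs"
proof (induction fs arbitrary: H)
  case (Cons f fs)
  then have "ext H f \<subseteq> span (ext H f) fs" by (intro Cons.IH) (auto simp: saturated_ext)
  then show ?case using ext_subset[of H f] Cons by auto
qed auto

lemma span_mem: "saturated H \<Longrightarrow> set fs \<subseteq> carrier R \<Longrightarrow> set fs \<subseteq> span H fs"
proof (induction fs arbitrary: H)
  case (Cons f fs)
  then have s: "saturated (ext H f)" by (auto intro: saturated_ext)
  then have "set fs \<subseteq> span (ext H f) fs" "ext H f \<subseteq> span (ext H f) fs" using Cons span_subset by auto
  then show ?case using Cons ext_mem[of H f] by auto
qed auto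

lemma span_least: "saturated K \<Longrightarrow> H \<subseteq> K \<Longrightarrow> set fs \<subseteq> K \<Longrightarrow> span H fs \<subseteq> K"
  by (induction fs arbitrary: H) (auto simp: ext_least)

lemma span_mono:
  assumes "saturated H" "saturated K" "H \<subseteq> K" "set fs \<subseteq> carrier R"
  shows "span H fs \<subseteq> span K fs"
  using assms span_subset[of K fs] span_mem[of K fs] saturated_span[of K fs]
  by (intro span_least) auto

lemma span_ext_commute:
  assumes H: "saturated H" and c: "set fs \<subseteq> carrier R" "h \<in> carrier R"
  shows "span (ext H h) fs = ext (span H fs) h"
proof
  note s = saturated_span[OF H c(1)] saturated_ext[OF H c(2)]
  note ss = saturated_ext[OF s(1) c(2)] saturated_span[OF s(2) c(1)]
  show "span (ext H h) fs \<subseteq> ext (span H fs) h"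
    using ss s span_subset[OF H c(1)] span_mem[OF H c(1)] ext_mem[OF s(1) c(2)] ext_subset[OF s(1) c(2)]
    by (intro span_least ext_least) auto
  show "ext (span H fs) h \<subseteq> span (ext H h) fs"
    using ss s span_subset[OF s(2) c(1)] span_mem[OF s(2) c(1)] ext_mem[OF H c(2)] ext_subset[OF H c(2)]
    by (intro span_least ext_least) auto
qed

lemma regular_on_Nil [simp]: "regular_on H []" by (simp add: regular_on_def)

lemma regular_on_snoc: "regular_on H (fs @ [f]) \<longleftrightarrow> regular_on H fs \<and> nzd R (span H fs) f"
  unfolding regular_on_def by (auto simp: nth_append less_Suc_eq)

lemma regular_on_Cons: "regular_on H (f # fs) \<longleftrightarrow> nzd R H f \<and> regular_on (ext H f) fs"
  by (induction fs rule: rev_induct)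
    (auto simp: regular_on_snoc regular_on_snoc[of H "[]" f, simplified] regular_on_snoc[of _ "f # _", simplified])

text \<open>Up to denominators, \<open>a f = r h\<close> modulo \<open>H\<close> gives
  \<open>r = q f\<close> by regularity of \<open>h\<close> modulo \<open>f\<close>, and cancelling
  \<open>f\<close> gives \<open>a = q h\<close>. This is the half of the permutability of regular
  sequences that holds in every ring.\<close>

lemma nzd_ext:
  assumes H: "saturated H" and c: "f \<in> carrier R" "h \<in> carrier R"
    and n: "nzd R H f" "nzd R (ext H f) h"
  shows "nzd R (ext H h) f"
  unfolding nzd_def
proof (intro ballI impI)
  fix a assume a: "a \<in> carrier R" "a \<otimes> f \<in> ext H h"
  then obtain s r where sr: "s \<in> carrier R" "s \<notin> P" "r \<in> carrier R" "s \<otimes> (a \<otimes> f) \<ominus> r \<otimes> h \<in> H"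
    by (elim extE)
  have "r \<otimes> h \<in> ext H f"
  proof (rule extI[of _ "\<one>" "s \<otimes> a"])
    have "\<zero> \<otimes> \<zero> \<ominus> \<one> \<otimes> (s \<otimes> (a \<otimes> f) \<ominus> r \<otimes> h) \<in> H"
      using sr saturated_zero[OF H] by - (rule saturated_lin[OF H], auto)
    also have "\<zero> \<otimes> \<zero> \<ominus> \<one> \<otimes> (s \<otimes> (a \<otimes> f) \<ominus> r \<otimes> h) = \<one> \<otimes> (r \<otimes> h) \<ominus> s \<otimes> a \<otimes> f"
      using sr a c by algebra
    finally show "\<one> \<otimes> (r \<otimes> h) \<ominus> s \<otimes> a \<otimes> f \<in> H" .
  qed (use sr a c one_notin_P in auto)
  then have "r \<in> ext H f" using n nzdD sr by metis
  then obtain t q where tq: "t \<in> carrier R" "t \<notin> P" "q \<in> carrier R" "t \<otimes> r \<ominus> q \<otimes> f \<in> H"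
    by (elim extE)
  have "t \<otimes> (s \<otimes> (a \<otimes> f) \<ominus> r \<otimes> h) \<oplus> h \<otimes> (t \<otimes> r \<ominus> q \<otimes> f) \<in> H"
    using sr tq c by - (rule saturated_lin2[OF H], auto)
  also have "t \<otimes> (s \<otimes> (a \<otimes> f) \<ominus> r \<otimes> h) \<oplus> h \<otimes> (t \<otimes> r \<ominus> q \<otimes> f) = (t \<otimes> s \<otimes> a \<ominus> q \<otimes> h) \<otimes> f"
    using sr tq c a by algebra
  finally have "t \<otimes> s \<otimes> a \<ominus> q \<otimes> h \<in> H" using n(1) nzdD sr tq c a by (metis m_closed minus_closed)
  then show "a \<in> ext H h" using sr tq a notin_P_mult[of t s] by (intro extI[of a "t \<otimes> s" q]) auto
qed

text \<open>Brings \<open>h\<close> from behind the sequence to its front, by one application of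
  \<open>nzd_ext\<close> per element of \<open>fs\<close>.\<close>

lemma regular_on_ext:
  assumes "saturated H" "set fs \<subseteq> carrier R" "h \<in> carrier R" "regular_on H fs"
    and "\<And>i. i \<le> length fs \<Longrightarrow> nzd R (span H (take i fs)) h"
  shows "regular_on (ext H h) fs"
  using assms
proof (induction fs arbitrary: H)
  case (Cons f fs)
  have n: "nzd R H f" "regular_on (ext H f) fs" using Cons.prems(4) by (auto simp: regular_on_Cons)
  have c: "f \<in> carrier R" "set fs \<subseteq> carrier R" using Cons.prems(2) by auto
  have "nzd R (ext H f) h" using Cons.prems(5)[of 1] by simp
  then have "nzd R (ext H h) f" by (rule nzd_ext[OF Cons.prems(1) c(1) Cons.prems(3) n(1)])
  moreover have "regular_on (ext (ext H f) h) fs"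
  proof (rule Cons.IH)
    show "nzd R (span (ext H f) (take i fs)) h" if "i \<le> length fs" for i
      using Cons.prems(5)[of "Suc i"] that by simp
  qed (use n c Cons.prems(1,3) saturated_ext in simp_all)
  moreover have "ext (ext H f) h = ext (ext H h) f"
    using span_ext_commute[of H "[f]" h] c Cons.prems(1,3) by simp
  ultimately show ?case by (auto simp: regular_on_Cons)
qed simp

subsection \<open>Exchanging regular sequences\<close>

text \<open>Up to units of the localization at \<open>P\<close>, the relation \<open>T\<close> is the graph of an
  isomorphism from \<open>(J : C) / J\<close> to \<open>(G : C) / G\<close>; for regular sequences of the same
  length both are \<open>Ext(R / C, R)\<close> in that degree.\<close>

definition corresponds :: "'a set \<Rightarrow> 'a set \<Rightarrow> 'a set \<Rightarrow> bool" where
  "corresponds C J G \<longleftrightarrow> (\<exists>T.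
     (\<forall>a b. (a, b) \<in> T \<longrightarrow> a \<in> carrier R \<and> b \<in> carrier R \<and> (a \<in> J \<longleftrightarrow> b \<in> G)) \<and>
     (\<forall>a b a' b' x y. (a, b) \<in> T \<longrightarrow> (a', b') \<in> T \<longrightarrow> x \<in> carrier R \<longrightarrow> y \<in> carrier R \<longrightarrow>
        (x \<otimes> a \<ominus> y \<otimes> a', x \<otimes> b \<ominus> y \<otimes> b') \<in> T) \<and>
     (\<forall>a\<in>ideal_quotient R J C. \<exists>u\<in>carrier R - P. \<exists>b\<in>ideal_quotient R G C. (u \<otimes> a, b) \<in> T) \<and>
     (\<forall>b\<in>ideal_quotient R G C. \<exists>u\<in>carrier R - P. \<exists>a\<in>ideal_quotient R J C. (a, u \<otimes> b) \<in> T))"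

lemma correspondsI:
  assumes "\<And>a b. (a, b) \<in> T \<Longrightarrow> a \<in> carrier R \<and> b \<in> carrier R \<and> (a \<in> J \<longleftrightarrow> b \<in> G)"
    "\<And>a b a' b' x y. (a, b) \<in> T \<Longrightarrow> (a', b') \<in> T \<Longrightarrow> x \<in> carrier R \<Longrightarrow> y \<in> carrier R \<Longrightarrow>
        (x \<otimes> a \<ominus> y \<otimes> a', x \<otimes> b \<ominus> y \<otimes> b') \<in> T"
    "\<And>a. a \<in> ideal_quotient R J C \<Longrightarrow> \<exists>u\<in>carrier R - P. \<exists>b\<in>ideal_quotient R G C. (u \<otimes> a, b) \<in> T"
    "\<And>b. b \<in> ideal_quotient R G C \<Longrightarrow> \<exists>u\<in>carrier R - P. \<exists>a\<in>ideal_quotient R J C. (a, u \<otimes> b) \<in> T"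
  shows "corresponds C J G"
  unfolding corresponds_def using assms by (intro exI[of _ T]) blast

lemma correspondsE:
  assumes "corresponds C J G"
  obtains T where
    "\<And>a b. (a, b) \<in> T \<Longrightarrow> a \<in> carrier R \<and> b \<in> carrier R \<and> (a \<in> J \<longleftrightarrow> b \<in> G)"
    "\<And>a b a' b' x y. (a, b) \<in> T \<Longrightarrow> (a', b') \<in> T \<Longrightarrow> x \<in> carrier R \<Longrightarrow> y \<in> carrier R \<Longrightarrow>
        (x \<otimes> a \<ominus> y \<otimes> a', x \<otimes> b \<ominus> y \<otimes> b') \<in> T"
    "\<And>a b x. (a, b) \<in> T \<Longrightarrow> x \<in> carrier R \<Longrightarrow> (x \<otimes> a, x \<otimes> b) \<in> T"
    "\<And>a. a \<in> ideal_quotient R J C \<Longrightarrow> \<exists>u\<in>carrier R - P. \<exists>b\<in>ideal_quotient R G C. (u \<otimes> a, b) \<in> T"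
    "\<And>b. b \<in> ideal_quotient R G C \<Longrightarrow> \<exists>u\<in>carrier R - P. \<exists>a\<in>ideal_quotient R J C. (a, u \<otimes> b) \<in> T"
proof -
  from assms obtain T where T:
     "\<forall>a b. (a, b) \<in> T \<longrightarrow> a \<in> carrier R \<and> b \<in> carrier R \<and> (a \<in> J \<longleftrightarrow> b \<in> G)"
     "\<forall>a b a' b' x y. (a, b) \<in> T \<longrightarrow> (a', b') \<in> T \<longrightarrow> x \<in> carrier R \<longrightarrow> y \<in> carrier R \<longrightarrow>
        (x \<otimes> a \<ominus> y \<otimes> a', x \<otimes> b \<ominus> y \<otimes> b') \<in> T"
     "\<forall>a\<in>ideal_quotient R J C. \<exists>u\<in>carrier R - P. \<exists>b\<in>ideal_quotient R G C. (u \<otimes> a, b) \<in> T"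
     "\<forall>b\<in>ideal_quotient R G C. \<exists>u\<in>carrier R - P. \<exists>a\<in>ideal_quotient R J C. (a, u \<otimes> b) \<in> T"
    unfolding corresponds_def by blast
  have "(x \<otimes> a, x \<otimes> b) \<in> T" if x: "(a, b) \<in> T" "x \<in> carrier R" for a b x
  proof -
    have c: "a \<in> carrier R" "b \<in> carrier R" using x T(1) by auto
    have "x \<otimes> a = x \<otimes> a \<ominus> \<zero> \<otimes> a" "x \<otimes> b = x \<otimes> b \<ominus> \<zero> \<otimes> b" using c x by algebra+
    then show ?thesis using T(2)[rule_format, OF x(1) x(1) x(2), of \<zero>] by simp
  qed
  then show ?thesis using that[of T] T by blast
qed

lemma corresponds_refl:
  assumes "saturated J" shows "corresponds C J J"
proof -
  have e: "a \<in> carrier R" "\<one> \<otimes> a = a" if "a \<in> ideal_quotient R J C" for a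
    using that by (auto simp: ideal_quotient_def)
  have "\<exists>u\<in>carrier R - P. \<exists>b\<in>ideal_quotient R J C. (u \<otimes> a, b) \<in> {(a, b). a = b \<and> a \<in> carrier R}"
    "\<exists>u\<in>carrier R - P. \<exists>b\<in>ideal_quotient R J C. (b, u \<otimes> a) \<in> {(a, b). a = b \<and> a \<in> carrier R}"
    if "a \<in> ideal_quotient R J C" for a
    using that e[OF that] by (intro bexI[OF _ one_notin_P] bexI[OF _ that]; simp)+
  then show ?thesis unfolding corresponds_def
    by (intro exI[of _ "{(a, b). a = b \<and> a \<in> carrier R}"]) auto
qed

lemma corresponds_trans:
  assumes "corresponds C J G" "corresponds C G L" shows "corresponds C J L"
proof -
  from assms(1) obtain T where T:
    "\<And>a b. (a, b) \<in> T \<Longrightarrow> a \<in> carrier R \<and> b \<in> carrier R \<and> (a \<in> J \<longleftrightarrow> b \<in> G)"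
    "\<And>a b a' b' x y. (a, b) \<in> T \<Longrightarrow> (a', b') \<in> T \<Longrightarrow> x \<in> carrier R \<Longrightarrow> y \<in> carrier R \<Longrightarrow>
        (x \<otimes> a \<ominus> y \<otimes> a', x \<otimes> b \<ominus> y \<otimes> b') \<in> T"
    "\<And>a b x. (a, b) \<in> T \<Longrightarrow> x \<in> carrier R \<Longrightarrow> (x \<otimes> a, x \<otimes> b) \<in> T"
    "\<And>a. a \<in> ideal_quotient R J C \<Longrightarrow> \<exists>u\<in>carrier R - P. \<exists>b\<in>ideal_quotient R G C. (u \<otimes> a, b) \<in> T"
    "\<And>b. b \<in> ideal_quotient R G C \<Longrightarrow> \<exists>u\<in>carrier R - P. \<exists>a\<in>ideal_quotient R J C. (a, u \<otimes> b) \<in> T"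
    by (elim correspondsE) blast
  from assms(2) obtain U where U:
    "\<And>a b. (a, b) \<in> U \<Longrightarrow> a \<in> carrier R \<and> b \<in> carrier R \<and> (a \<in> G \<longleftrightarrow> b \<in> L)"
    "\<And>a b a' b' x y. (a, b) \<in> U \<Longrightarrow> (a', b') \<in> U \<Longrightarrow> x \<in> carrier R \<Longrightarrow> y \<in> carrier R \<Longrightarrow>
        (x \<otimes> a \<ominus> y \<otimes> a', x \<otimes> b \<ominus> y \<otimes> b') \<in> U"
    "\<And>a b x. (a, b) \<in> U \<Longrightarrow> x \<in> carrier R \<Longrightarrow> (x \<otimes> a, x \<otimes> b) \<in> U"
    "\<And>a. a \<in> ideal_quotient R G C \<Longrightarrow> \<exists>u\<in>carrier R - P. \<exists>b\<in>ideal_quotient R L C. (u \<otimes> a, b) \<in> U"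
    "\<And>b. b \<in> ideal_quotient R L C \<Longrightarrow> \<exists>u\<in>carrier R - P. \<exists>a\<in>ideal_quotient R G C. (a, u \<otimes> b) \<in> U"
    by (elim correspondsE) blast
  have l: "\<exists>w\<in>carrier R - P. \<exists>c\<in>ideal_quotient R L C. (w \<otimes> a, c) \<in> T O U"
    if a: "a \<in> ideal_quotient R J C" for a
  proof -
    obtain u b where b: "u \<in> carrier R - P" "b \<in> ideal_quotient R G C" "(u \<otimes> a, b) \<in> T" using T(4) a by blast
    obtain v c where c: "v \<in> carrier R - P" "c \<in> ideal_quotient R L C" "(v \<otimes> b, c) \<in> U" using U(4) b by blast
    have "(v \<otimes> (u \<otimes> a), v \<otimes> b) \<in> T" using T(3) b c by auto
    moreover have "v \<otimes> (u \<otimes> a) = (v \<otimes> u) \<otimes> a" using a b c by (auto simp: m_assoc ideal_quotient_def)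
    ultimately show ?thesis using notin_P_mult[OF c(1) b(1)] c by auto
  qed
  have r: "\<exists>w\<in>carrier R - P. \<exists>a\<in>ideal_quotient R J C. (a, w \<otimes> c) \<in> T O U"
    if c: "c \<in> ideal_quotient R L C" for c
  proof -
    obtain u b where b: "u \<in> carrier R - P" "b \<in> ideal_quotient R G C" "(b, u \<otimes> c) \<in> U" using U(5) c by blast
    obtain v a where a: "v \<in> carrier R - P" "a \<in> ideal_quotient R J C" "(a, v \<otimes> b) \<in> T" using T(5) b by blast
    have "(v \<otimes> b, v \<otimes> (u \<otimes> c)) \<in> U" using U(3) a b by auto
    moreover have "v \<otimes> (u \<otimes> c) = (v \<otimes> u) \<otimes> c" using a b c by (auto simp: m_assoc ideal_quotient_def)
    ultimately show ?thesis using notin_P_mult[OF a(1) b(1)] a by auto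
  qed
  have m: "(x \<otimes> a \<ominus> y \<otimes> a', x \<otimes> b \<ominus> y \<otimes> b') \<in> T O U"
    if "(a, b) \<in> T O U" "(a', b') \<in> T O U" "x \<in> carrier R" "y \<in> carrier R" for a b a' b' x y
    using that T(2) U(2) by fast
  have k: "a \<in> carrier R \<and> b \<in> carrier R \<and> (a \<in> J \<longleftrightarrow> b \<in> L)" if "(a, b) \<in> T O U" for a b
    using that T(1) U(1) by blast
  show ?thesis by (rule correspondsI[of "T O U"]) (fact k m l r)+
qed

text \<open>The relation \<open>a g = b f\<close> modulo \<open>H\<close> stands for
  \<open>b = a g / f\<close>. It sends \<open>(H, f)\<close> into \<open>(H, g)\<close>: from
  \<open>s a = t f\<close> one gets \<open>(s b - t g) f \<in> H\<close>, and \<open>f\<close>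
  cancels.\<close>

lemma cross_mem_ext:
  assumes H: "saturated H" and c: "f \<in> carrier R" "g \<in> carrier R" "a \<in> carrier R" "b \<in> carrier R"
    and n: "nzd R H f" and m: "a \<otimes> g \<ominus> b \<otimes> f \<in> H" and a: "a \<in> ext H f"
  shows "b \<in> ext H g"
proof -
  obtain s t where st: "s \<in> carrier R" "s \<notin> P" "t \<in> carrier R" "s \<otimes> a \<ominus> t \<otimes> f \<in> H"
    using a by (elim extE)
  have "(g \<otimes> (s \<otimes> a \<ominus> t \<otimes> f)) \<ominus> s \<otimes> (a \<otimes> g \<ominus> b \<otimes> f) \<in> H"
    using st c m by - (rule saturated_lin[OF H], auto)
  also have "(g \<otimes> (s \<otimes> a \<ominus> t \<otimes> f)) \<ominus> s \<otimes> (a \<otimes> g \<ominus> b \<otimes> f) = (s \<otimes> b \<ominus> t \<otimes> g) \<otimes> f"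
    using st c by algebra
  finally have "s \<otimes> b \<ominus> t \<otimes> g \<in> H" using nzdD[OF n] st c by auto
  then show ?thesis using st c by (intro extI[of b s t]) auto
qed

text \<open>The fraction \<open>a g / f\<close> makes sense because \<open>g \<in> C\<close> forces
  \<open>a g \<in> (H, f)\<close>, say \<open>s a g = r f\<close> modulo \<open>H\<close>. Its
  numerator \<open>r\<close> multiplies \<open>C\<close> into \<open>(H, g)\<close>: for
  \<open>x \<in> C\<close> the element \<open>r x\<close> is related to \<open>s a x\<close>, which
  lies in \<open>(H, f)\<close>.\<close>

lemma cross_exists:
  assumes H: "saturated H" and c: "f \<in> C" "g \<in> C" "C \<subseteq> carrier R"
    and n: "nzd R H f" and a: "a \<in> ideal_quotient R (ext H f) C"
  shows "\<exists>u\<in>carrier R - P. \<exists>b\<in>ideal_quotient R (ext H g) C. u \<otimes> a \<otimes> g \<ominus> b \<otimes> f \<in> H"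
proof -
  have c': "f \<in> carrier R" "g \<in> carrier R" "a \<in> carrier R" using a c by (auto simp: ideal_quotient_def)
  have "a \<otimes> g \<in> ext H f" using a c by (auto simp: ideal_quotient_def)
  then obtain s r where st: "s \<in> carrier R" "s \<notin> P" "r \<in> carrier R" "s \<otimes> (a \<otimes> g) \<ominus> r \<otimes> f \<in> H"
    by (elim extE)
  have "r \<otimes> x \<in> ext H g" if x: "x \<in> C" for x
  proof (rule cross_mem_ext[OF H c'(1,2) _ _ n])
    have xc: "x \<in> carrier R" using x c by auto
    have ax: "a \<otimes> x \<in> ext H f" using a x by (auto simp: ideal_quotient_def)
    then show "s \<otimes> (a \<otimes> x) \<in> ext H f" using saturated_mult[OF saturated_ext[OF H c'(1)]] st by simp
    show "s \<otimes> (a \<otimes> x) \<in> carrier R" "r \<otimes> x \<in> carrier R" using xc st c' by auto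
    have "x \<otimes> (s \<otimes> (a \<otimes> g) \<ominus> r \<otimes> f) \<in> H" using H st xc saturated_mult by auto
    also have "x \<otimes> (s \<otimes> (a \<otimes> g) \<ominus> r \<otimes> f) = s \<otimes> (a \<otimes> x) \<otimes> g \<ominus> r \<otimes> x \<otimes> f" using xc st c' by algebra
    finally show "s \<otimes> (a \<otimes> x) \<otimes> g \<ominus> r \<otimes> x \<otimes> f \<in> H" .
  qed
  then have "r \<in> ideal_quotient R (ext H g) C" using st by (auto simp: ideal_quotient_def)
  moreover have "s \<otimes> a \<otimes> g \<ominus> r \<otimes> f \<in> H" using st c' by (simp add: m_assoc)
  ultimately show ?thesis using st by auto
qed

text \<open>Multiplication by \<open>g/f\<close> is the isomorphism, and exchanging the roles of
  \<open>f\<close> and \<open>g\<close> inverts it. Locally at \<open>P\<close> both sides are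
  Ext^1(R/C, R/H), computed with one nonzerodivisor of \<open>C\<close> or the other.\<close>

lemma corresponds_ext:
  assumes H: "saturated H" and c: "f \<in> C" "g \<in> C" "C \<subseteq> carrier R"
    and n: "nzd R H f" "nzd R H g"
  shows "corresponds C (ext H f) (ext H g)"
proof -
  let ?T = "{(a, b). a \<in> carrier R \<and> b \<in> carrier R \<and> a \<otimes> g \<ominus> b \<otimes> f \<in> H}"
  have c': "f \<in> carrier R" "g \<in> carrier R" using c by auto
  have neg: "b \<otimes> f \<ominus> a \<otimes> g \<in> H" if "a \<otimes> g \<ominus> b \<otimes> f \<in> H" "a \<in> carrier R" "b \<in> carrier R"
      "f \<in> carrier R" "g \<in> carrier R" for a b f g
  proof -
    have "\<zero> \<otimes> \<zero> \<ominus> \<one> \<otimes> (a \<otimes> g \<ominus> b \<otimes> f) \<in> H"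
      using that saturated_zero[OF H] by - (rule saturated_lin[OF H], auto)
    also have "\<zero> \<otimes> \<zero> \<ominus> \<one> \<otimes> (a \<otimes> g \<ominus> b \<otimes> f) = b \<otimes> f \<ominus> a \<otimes> g" using that by algebra
    finally show ?thesis .
  qed
  have 1: "a \<in> ext H f \<longleftrightarrow> b \<in> ext H g" if "(a, b) \<in> ?T" for a b
    using that c' n neg[of a g b f] cross_mem_ext[OF H c'(1,2)] cross_mem_ext[OF H c'(2,1)] by auto
  have 2: "(x \<otimes> a \<ominus> y \<otimes> a', x \<otimes> b \<ominus> y \<otimes> b') \<in> ?T"
    if "(a, b) \<in> ?T" "(a', b') \<in> ?T" "x \<in> carrier R" "y \<in> carrier R" for a b a' b' x y
  proof -
    have "x \<otimes> (a \<otimes> g \<ominus> b \<otimes> f) \<ominus> y \<otimes> (a' \<otimes> g \<ominus> b' \<otimes> f) \<in> H"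
      using that by - (rule saturated_lin[OF H], auto)
    also have "x \<otimes> (a \<otimes> g \<ominus> b \<otimes> f) \<ominus> y \<otimes> (a' \<otimes> g \<ominus> b' \<otimes> f) =
       (x \<otimes> a \<ominus> y \<otimes> a') \<otimes> g \<ominus> (x \<otimes> b \<ominus> y \<otimes> b') \<otimes> f"
      using that c' by simp algebra
    finally show ?thesis using that by auto
  qed
  have 3: "\<exists>u\<in>carrier R - P. \<exists>b\<in>ideal_quotient R (ext H g) C. (u \<otimes> a, b) \<in> ?T"
    if "a \<in> ideal_quotient R (ext H f) C" for a
    using cross_exists[OF H c n(1) that] that by (fastforce simp: ideal_quotient_def)
  have 4: "\<exists>u\<in>carrier R - P. \<exists>a\<in>ideal_quotient R (ext H f) C. (a, u \<otimes> b) \<in> ?T"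
    if b: "b \<in> ideal_quotient R (ext H g) C" for b
  proof -
    obtain u a where u: "u \<in> carrier R - P" "a \<in> ideal_quotient R (ext H f) C" "u \<otimes> b \<otimes> f \<ominus> a \<otimes> g \<in> H"
      using cross_exists[OF H c(2,1,3) n(2) b] by blast
    have "a \<otimes> g \<ominus> u \<otimes> b \<otimes> f \<in> H" using neg[of "u \<otimes> b" f a g] u b c' by (auto simp: ideal_quotient_def)
    then show ?thesis using u b by (fastforce simp: ideal_quotient_def)
  qed
  have 1: "a \<in> carrier R \<and> b \<in> carrier R \<and> (a \<in> ext H f \<longleftrightarrow> b \<in> ext H g)" if "(a, b) \<in> ?T" for a b
    using 1[OF that] that by simp
  show ?thesis by (rule correspondsI[of ?T]) (fact 1 2 3 4)+
qed

lemma corresponds_span: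
  assumes "saturated H" "ideal C R" "length fs = length gs" "set fs \<subseteq> C" "set gs \<subseteq> C"
    "regular_on H fs" "regular_on H gs"
  shows "corresponds C (span H fs) (span H gs)"
  using assms
proof (induction "length fs" arbitrary: H fs gs)
  case 0
  then show ?case using corresponds_refl by auto
next
  case (Suc n)
  obtain fs' f where f: "fs = fs' @ [f]" using Suc(2) by (cases fs rule: rev_cases) auto
  obtain gs' g where g: "gs = gs' @ [g]" using Suc(2,5) by (cases gs rule: rev_cases) auto
  have C: "C \<subseteq> carrier R" using ideal_carr[OF Suc(4)] by auto
  have len: "length fs' = n" "length gs' = n" using Suc f g by auto
  have cf: "set fs' \<subseteq> carrier R" "set gs' \<subseteq> carrier R" using f g Suc C by auto
  \<comment> \<open>These initial parts stop before the last elements \<open>f\<close> and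
    \<open>g\<close>. Modulo each of them the next element of its own sequence is a nonzerodivisor
    in \<open>C\<close>, so a common one \<open>h\<close> exists. Then \<open>f\<close> is exchanged
    for \<open>h\<close>, \<open>h\<close> is moved to the front, the induction hypothesis exchanges
    \<open>fs'\<close> for \<open>gs'\<close> modulo \<open>h\<close>, and finally \<open>h\<close>
    gives way to \<open>g\<close>.\<close>
  let ?S = "(\<lambda>i. span H (take i fs)) ` {..n} \<union> (\<lambda>i. span H (take i gs)) ` {..n}"
  have "\<exists>h\<in>C. \<forall>K\<in>?S. nzd R K h"
  proof (rule exists_common_nzd)
    have w: "ideal (span H (take i xs)) R \<and> (\<exists>f\<in>C. nzd R (span H (take i xs)) f)"
      if x: "set xs \<subseteq> C" "regular_on H xs" "i < length xs" for xs i
    proof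
      have "set (take i xs) \<subseteq> carrier R" using x C set_take_subset by fastforce
      then show "ideal (span H (take i xs)) R" using Suc(3) saturated_ideal saturated_span by simp
      have "xs ! i \<in> C" using x by auto
      moreover have "nzd R (span H (take i xs)) (xs ! i)" using x by (simp add: regular_on_def)
      ultimately show "\<exists>f\<in>C. nzd R (span H (take i xs)) f" by blast
    qed
    have l: "length fs = Suc n" "length gs = Suc n" using Suc(2,5) by simp_all
    fix K assume "K \<in> ?S"
    then obtain i where "i < Suc n" "K = span H (take i fs) \<or> K = span H (take i gs)"
      by (auto simp: less_Suc_eq_le)
    then show "ideal K R \<and> (\<exists>f\<in>C. nzd R K f)"
      using w[OF Suc(6,8), of i] w[OF Suc(7,9), of i] l by metis
  qed (use Suc(4) in auto)
  then obtain h where h0: "h \<in> C" "\<forall>K\<in>?S. nzd R K h" by (elim bexE)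
  then have h: "h \<in> C" "\<And>i. i \<le> n \<Longrightarrow> nzd R (span H (take i fs)) h"
    "\<And>i. i \<le> n \<Longrightarrow> nzd R (span H (take i gs)) h" by auto
  have hc: "h \<in> carrier R" using h C by auto
  have rf: "regular_on H fs'" "nzd R (span H fs') f" and rg: "regular_on H gs'" "nzd R (span H gs') g"
    using Suc f g by (auto simp: regular_on_snoc)
  have hf: "\<And>i. i \<le> n \<Longrightarrow> nzd R (span H (take i fs')) h" and hg: "\<And>i. i \<le> n \<Longrightarrow> nzd R (span H (take i gs')) h"
    using h f g len by auto
  have fg: "f \<in> C" "g \<in> C" "set fs' \<subseteq> C" "set gs' \<subseteq> C" using Suc.prems(4,5) f g by auto
  have sat: "saturated (span H fs')" "saturated (span H gs')"
    using Suc.prems(1) cf saturated_span by auto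
  have 1: "corresponds C (ext (span H fs') f) (ext (span H fs') h)"
    using hf[of n] len by (intro corresponds_ext sat fg h C rf) simp
  have 2: "corresponds C (span (ext H h) fs') (span (ext H h) gs')"
  proof (rule Suc(1))
    show "regular_on (ext H h) fs'" using hf len by (intro regular_on_ext Suc.prems(1) cf hc rf) simp
    show "regular_on (ext H h) gs'" using hg len by (intro regular_on_ext Suc.prems(1) cf hc rg) simp
  qed (use len fg Suc.prems(1,2) hc saturated_ext in simp_all)
  have 3: "corresponds C (ext (span H gs') h) (ext (span H gs') g)"
    using hg[of n] len by (intro corresponds_ext sat fg h C rg) simp
  have e: "span (ext H h) fs' = ext (span H fs') h" "span (ext H h) gs' = ext (span H gs') h"
    using span_ext_commute[OF Suc.prems(1)] cf hc by auto
  show ?case using corresponds_trans[OF corresponds_trans[OF 1 2[unfolded e]] 3] f g by simp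
qed

end

subsection \<open>Duality for ideals with simple socle\<close>

context noetherian_cring_prime begin

lemma idqI: "a \<in> carrier R \<Longrightarrow> (\<And>x. x \<in> L \<Longrightarrow> a \<otimes> x \<in> K) \<Longrightarrow> a \<in> ideal_quotient R K L"
  by (simp add: ideal_quotient_def)

lemma idqD: "a \<in> ideal_quotient R K L \<Longrightarrow> x \<in> L \<Longrightarrow> a \<otimes> x \<in> K"
  by (simp add: ideal_quotient_def)

lemma idq_carr: "a \<in> ideal_quotient R K L \<Longrightarrow> a \<in> carrier R"
  by (simp add: ideal_quotient_def)

lemma corresponds_not_subset:
  assumes c: "corresponds C J G" and J: "saturated J" and a: "a \<in> ideal_quotient R J C" "a \<notin> J"
  shows "\<exists>b\<in>ideal_quotient R G C. b \<notin> G"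
proof -
  obtain T where T: "\<And>a b. (a, b) \<in> T \<Longrightarrow> a \<in> carrier R \<and> b \<in> carrier R \<and> (a \<in> J \<longleftrightarrow> b \<in> G)"
    "\<And>a. a \<in> ideal_quotient R J C \<Longrightarrow> \<exists>u\<in>carrier R - P. \<exists>b\<in>ideal_quotient R G C. (u \<otimes> a, b) \<in> T"
    by (rule correspondsE[OF c]) blast
  obtain u b where u: "u \<in> carrier R - P" "b \<in> ideal_quotient R G C" "(u \<otimes> a, b) \<in> T"
    using T(2)[OF a(1)] by blast
  have "u \<otimes> a \<notin> J" using saturatedD[OF J _ u(1)] a idq_carr[OF a(1)] by auto
  then show ?thesis using T(1)[OF u(3)] u by auto
qed

text \<open>Since \<open>T\<close> is linear, the same \<open>x\<close> multiply two corresponding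
  elements into \<open>J\<close> and into \<open>G\<close>. As \<open>C \<subseteq> Z\<close>, every
  element of \<open>G : Z\<close> has a partner up to a denominator; the partner lies in
  \<open>J : Z\<close>, hence in \<open>J : Y\<close>. In this way a coincidence of colon ideals of
  \<open>J\<close> passes to \<open>G\<close>.\<close>

lemma corresponds_idq_mono:
  assumes c: "corresponds C J G" and G: "saturated G"
    and Z: "C \<subseteq> Z" "Z \<subseteq> carrier R" "Y \<subseteq> carrier R"
    and le: "ideal_quotient R J Z \<subseteq> ideal_quotient R J Y"
  shows "ideal_quotient R G Z \<subseteq> ideal_quotient R G Y"
proof
  obtain T where T: "\<And>a b. (a, b) \<in> T \<Longrightarrow> a \<in> carrier R \<and> b \<in> carrier R \<and> (a \<in> J \<longleftrightarrow> b \<in> G)"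
    "\<And>a b x. (a, b) \<in> T \<Longrightarrow> x \<in> carrier R \<Longrightarrow> (x \<otimes> a, x \<otimes> b) \<in> T"
    "\<And>b. b \<in> ideal_quotient R G C \<Longrightarrow> \<exists>u\<in>carrier R - P. \<exists>a\<in>ideal_quotient R J C. (a, u \<otimes> b) \<in> T"
    by (rule correspondsE[OF c]) blast
  fix b assume b: "b \<in> ideal_quotient R G Z"
  then have bc: "b \<in> carrier R" and "b \<in> ideal_quotient R G C" using Z by (auto simp: ideal_quotient_def)
  then obtain u a where u: "u \<in> carrier R - P" "a \<in> ideal_quotient R J C" "(a, u \<otimes> b) \<in> T" using T(3) by blast
  have ac: "a \<in> carrier R" using u(2) idq_carr by simp
  have iff: "a \<otimes> x \<in> J \<longleftrightarrow> u \<otimes> (b \<otimes> x) \<in> G" if "x \<in> carrier R" for x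
  proof -
    have "x \<otimes> a = a \<otimes> x" "x \<otimes> (u \<otimes> b) = u \<otimes> (b \<otimes> x)" using that ac bc u(1) by (simp_all add: m_ac)
    then show ?thesis using T(1)[OF T(2)[OF u(3) that]] by simp
  qed
  have "a \<in> ideal_quotient R J Z"
  proof (rule idqI[OF ac])
    fix x assume x: "x \<in> Z"
    then have "b \<otimes> x \<in> G" using idqD[OF b] by simp
    then have "u \<otimes> (b \<otimes> x) \<in> G" using saturated_mult[OF G] u(1) by simp
    then show "a \<otimes> x \<in> J" using iff[of x] x Z by auto
  qed
  then have aY: "a \<in> ideal_quotient R J Y" using le by auto
  show "b \<in> ideal_quotient R G Y"
  proof (rule idqI[OF bc])
    fix y assume y: "y \<in> Y"
    then have yc: "y \<in> carrier R" using Z by auto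
    have "u \<otimes> (b \<otimes> y) \<in> G" using iff[OF yc] idqD[OF aY y] by simp
    then show "b \<otimes> y \<in> G" using saturatedD[OF G _ u(1)] bc yc by simp
  qed
qed

text \<open>\<open>L : P\<close> modulo \<open>L\<close> is the socle of \<open>R/L\<close> at
  \<open>P\<close>. If each of its elements outside \<open>L\<close> generates it locally, its
  dimension over the residue field is at most one; dimension zero is included.\<close>

definition simple_socle :: "'a set \<Rightarrow> bool" where
  "simple_socle L \<longleftrightarrow> (\<forall>a\<in>ideal_quotient R L P. \<forall>a'\<in>ideal_quotient R L P. a \<notin> L \<longrightarrow>
     (\<exists>s\<in>carrier R - P. \<exists>r\<in>carrier R. s \<otimes> a' \<ominus> r \<otimes> a \<in> L))"

text \<open>The socle is the residue field. As \<open>a\<close> is outside \<open>P\<close>, it may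
  be the denominator of \<open>a'\<close>, and
  \<open>a \<otimes> a' \<ominus> a' \<otimes> a\<close> vanishes.\<close>

lemma simple_socle_P: "simple_socle P"
  unfolding simple_socle_def
proof (intro ballI impI)
  fix a a' assume a: "a \<in> ideal_quotient R P P" "a' \<in> ideal_quotient R P P" "a \<notin> P"
  have c: "a \<in> carrier R" "a' \<in> carrier R" using a idq_carr by auto
  have "a \<otimes> a' \<ominus> a' \<otimes> a = \<zero>" using c by algebra
  then have "a \<otimes> a' \<ominus> a' \<otimes> a \<in> P" using ideal_zero[OF P_ideal] by (simp only:)
  then show "\<exists>s\<in>carrier R - P. \<exists>r\<in>carrier R. s \<otimes> a' \<ominus> r \<otimes> a \<in> P" using a(3) c by blast
qed

lemma corresponds_simple_socle:
  assumes c: "corresponds P J G" and J: "saturated J" and s: "simple_socle G"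
  shows "simple_socle J"
  unfolding simple_socle_def
proof (intro ballI impI)
  obtain T where T: "\<And>a b. (a, b) \<in> T \<Longrightarrow> a \<in> carrier R \<and> b \<in> carrier R \<and> (a \<in> J \<longleftrightarrow> b \<in> G)"
    "\<And>a b a' b' x y. (a, b) \<in> T \<Longrightarrow> (a', b') \<in> T \<Longrightarrow> x \<in> carrier R \<Longrightarrow> y \<in> carrier R \<Longrightarrow>
        (x \<otimes> a \<ominus> y \<otimes> a', x \<otimes> b \<ominus> y \<otimes> b') \<in> T"
    "\<And>a. a \<in> ideal_quotient R J P \<Longrightarrow> \<exists>u\<in>carrier R - P. \<exists>b\<in>ideal_quotient R G P. (u \<otimes> a, b) \<in> T"
    by (rule correspondsE[OF c]) blast
  fix a a' assume a: "a \<in> ideal_quotient R J P" "a' \<in> ideal_quotient R J P" "a \<notin> J"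
  obtain u b where u: "u \<in> carrier R - P" "b \<in> ideal_quotient R G P" "(u \<otimes> a, b) \<in> T"
    using T(3)[OF a(1)] by blast
  obtain u' b' where u': "u' \<in> carrier R - P" "b' \<in> ideal_quotient R G P" "(u' \<otimes> a', b') \<in> T"
    using T(3)[OF a(2)] by blast
  have ac: "a \<in> carrier R" "a' \<in> carrier R" using a idq_carr by auto
  have "u \<otimes> a \<notin> J" using saturatedD[OF J _ u(1)] a(3) ac by auto
  then have "b \<notin> G" using T(1)[OF u(3)] by auto
  then obtain s r where sr: "s \<in> carrier R - P" "r \<in> carrier R" "s \<otimes> b' \<ominus> r \<otimes> b \<in> G"
    using s u(2) u'(2) unfolding simple_socle_def by blast
  have "s \<otimes> (u' \<otimes> a') \<ominus> r \<otimes> (u \<otimes> a) \<in> J"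
    using T(1)[OF T(2)[OF u'(3) u(3), of s r]] sr by auto
  also have "s \<otimes> (u' \<otimes> a') \<ominus> r \<otimes> (u \<otimes> a) = (s \<otimes> u') \<otimes> a' \<ominus> (r \<otimes> u) \<otimes> a"
    using sr u u' ac by (simp add: m_assoc)
  finally show "\<exists>s\<in>carrier R - P. \<exists>r\<in>carrier R. s \<otimes> a' \<ominus> r \<otimes> a \<in> J"
    using notin_P_mult[OF sr(1) u'(1)] sr(2) u(1) by blast
qed

text \<open>\<open>I'/I\<close> is locally a vector space of dimension at most one over the residue
  field at \<open>P\<close>. The trivial step \<open>I = I'\<close> is included, because it is not
  known beforehand that an annihilator shrinks when the ideal grows.\<close>

definition simple_step :: "'a set \<Rightarrow> 'a set \<Rightarrow> bool" where
  "simple_step I I' \<longleftrightarrow> saturated I \<and> saturated I' \<and> I \<subseteq> I' \<and> (\<forall>p\<in>P. \<forall>x\<in>I'. p \<otimes> x \<in> I) \<and>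
     (\<forall>x\<in>I'. \<forall>y\<in>I' - I. \<exists>s\<in>carrier R - P. \<exists>r\<in>carrier R. s \<otimes> x \<ominus> r \<otimes> y \<in> I)"

lemma simple_step_ext:
  assumes I: "saturated I" and a: "a \<in> carrier R" "\<And>p. p \<in> P \<Longrightarrow> p \<otimes> a \<in> I"
  shows "simple_step I (ext I a)"
  unfolding simple_step_def
proof (intro conjI ballI)
  fix p x assume p: "p \<in> P" and "x \<in> ext I a"
  from this(2) obtain s r where c: "x \<in> carrier R" "s \<in> carrier R" "s \<notin> P" "r \<in> carrier R" "s \<otimes> x \<ominus> r \<otimes> a \<in> I"
    by (elim extE)
  have pc: "p \<in> carrier R" using p P_carr by simp
  have "p \<otimes> (s \<otimes> x \<ominus> r \<otimes> a) \<oplus> r \<otimes> (p \<otimes> a) \<in> I"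
    by (rule saturated_lin2[OF I c(5) a(2)[OF p] pc c(4)])
  also have "p \<otimes> (s \<otimes> x \<ominus> r \<otimes> a) \<oplus> r \<otimes> (p \<otimes> a) = s \<otimes> (p \<otimes> x)" using pc c a(1) by algebra
  finally show "p \<otimes> x \<in> I" using saturatedD[OF I] c pc by simp
next
  fix x y assume "x \<in> ext I a" and "y \<in> ext I a - I"
  then have x: "x \<in> ext I a" and y: "y \<in> ext I a" "y \<notin> I" by auto
  obtain s r where c: "x \<in> carrier R" "s \<in> carrier R" "s \<notin> P" "r \<in> carrier R" "s \<otimes> x \<ominus> r \<otimes> a \<in> I"
    using x by (elim extE)
  obtain t q where d: "y \<in> carrier R" "t \<in> carrier R" "t \<notin> P" "q \<in> carrier R" "t \<otimes> y \<ominus> q \<otimes> a \<in> I"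
    using y(1) by (elim extE)
  \<comment> \<open>Elements of \<open>P\<close> multiply \<open>a\<close> into \<open>I\<close>.
    Since \<open>y\<close> is not in \<open>I\<close>, the coefficient \<open>q\<close> is a unit
    locally and serves to eliminate \<open>a\<close> from \<open>x\<close>.\<close>
  have q: "q \<notin> P"
  proof
    assume "q \<in> P"
    then have "q \<otimes> a \<in> I" by (rule a(2))
    then have "t \<otimes> y \<in> I" using ideal_swap_diff[OF saturated_ideal[OF I] d(5)] d a(1) by simp
    then show False using saturatedD[OF I] d y(2) by simp
  qed
  have "q \<otimes> (s \<otimes> x \<ominus> r \<otimes> a) \<ominus> r \<otimes> (t \<otimes> y \<ominus> q \<otimes> a) \<in> I"
    by (rule saturated_lin[OF I c(5) d(5,4) c(4)])
  also have "q \<otimes> (s \<otimes> x \<ominus> r \<otimes> a) \<ominus> r \<otimes> (t \<otimes> y \<ominus> q \<otimes> a) = (q \<otimes> s) \<otimes> x \<ominus> (r \<otimes> t) \<otimes> y"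
    using c d a(1) by algebra
  finally show "\<exists>s\<in>carrier R - P. \<exists>r\<in>carrier R. s \<otimes> x \<ominus> r \<otimes> y \<in> I"
    using notin_P_mult[of q s] q c d by blast
qed (use assms saturated_ext ext_subset in simp_all)

text \<open>Multiplication by an element \<open>a\<close> of \<open>K'\<close> outside
  \<open>K\<close> maps \<open>L : K\<close> into the socle \<open>L : P\<close>, because
  \<open>P\<close> sends \<open>K'\<close> into \<open>K\<close>. The elements of
  \<open>L : K\<close> sent into \<open>L\<close> form \<open>L : K'\<close>, since \<open>K\<close>
  and \<open>a\<close> generate \<open>K'\<close> locally. So \<open>L : K\<close> modulo
  \<open>L : K'\<close> embeds into a socle of dimension at most one.\<close>

lemma simple_step_idq:
  assumes L: "saturated L" "simple_socle L" and st: "simple_step K K'"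
  shows "simple_step (ideal_quotient R L K') (ideal_quotient R L K)"
  unfolding simple_step_def
proof (intro conjI ballI)
  have K: "saturated K" "saturated K'" "K \<subseteq> K'"
    and pK: "\<And>p x. p \<in> P \<Longrightarrow> x \<in> K' \<Longrightarrow> p \<otimes> x \<in> K"
    and sK: "\<And>x y. x \<in> K' \<Longrightarrow> y \<in> K' \<Longrightarrow> y \<notin> K \<Longrightarrow> \<exists>s\<in>carrier R - P. \<exists>r\<in>carrier R. s \<otimes> x \<ominus> r \<otimes> y \<in> K"
    using st unfolding simple_step_def by auto
  have Kc: "\<And>x. x \<in> K' \<Longrightarrow> x \<in> carrier R" using saturated_carr[OF K(2)] .
  show "saturated (ideal_quotient R L K')" "saturated (ideal_quotient R L K)"
    using K Kc by (auto intro!: saturated_ideal_quotient[OF L(1)])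
  show "ideal_quotient R L K' \<subseteq> ideal_quotient R L K" using K(3) by (auto simp: ideal_quotient_def)
  show "p \<otimes> c \<in> ideal_quotient R L K'" if p: "p \<in> P" and c: "c \<in> ideal_quotient R L K" for p c
  proof (rule idqI)
    have cc: "p \<in> carrier R" "c \<in> carrier R" using p c P_carr idq_carr by auto
    show "p \<otimes> c \<in> carrier R" using cc by simp
    fix x assume x: "x \<in> K'"
    have "c \<otimes> (p \<otimes> x) \<in> L" using idqD[OF c pK[OF p x]] .
    also have "c \<otimes> (p \<otimes> x) = p \<otimes> c \<otimes> x" using cc Kc[OF x] by (simp add: m_ac)
    finally show "p \<otimes> c \<otimes> x \<in> L" .
  qed
  fix c c' assume c: "c \<in> ideal_quotient R L K" and "c' \<in> ideal_quotient R L K - ideal_quotient R L K'"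
  then have c': "c' \<in> ideal_quotient R L K" "c' \<notin> ideal_quotient R L K'" by auto
  have cc: "c \<in> carrier R" "c' \<in> carrier R" using c c' idq_carr by auto
  obtain a where a: "a \<in> K'" "c' \<otimes> a \<notin> L" using c'(2) cc idqI by blast
  have ac: "a \<in> carrier R" using a Kc by simp
  have aK: "a \<notin> K" using a idqD[OF c'(1)] by auto
  have soc: "d \<otimes> a \<in> ideal_quotient R L P" if d: "d \<in> ideal_quotient R L K" for d
  proof (rule idqI)
    have dc: "d \<in> carrier R" using d idq_carr by simp
    show "d \<otimes> a \<in> carrier R" using dc ac by simp
    fix p assume p: "p \<in> P"
    have "d \<otimes> (p \<otimes> a) \<in> L" using idqD[OF d pK[OF p a(1)]] .
    also have "d \<otimes> (p \<otimes> a) = d \<otimes> a \<otimes> p" using dc ac P_carr[OF p] by (simp add: m_ac)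
    finally show "d \<otimes> a \<otimes> p \<in> L" .
  qed
  obtain s r where sr: "s \<in> carrier R - P" "r \<in> carrier R" "s \<otimes> (c \<otimes> a) \<ominus> r \<otimes> (c' \<otimes> a) \<in> L"
    using L(2) soc[OF c] soc[OF c'(1)] a(2) unfolding simple_socle_def by blast
  have sc: "s \<in> carrier R" using sr by simp
  \<comment> \<open>The combination sends \<open>a\<close> into \<open>L\<close> by the choice of
    \<open>s\<close> and \<open>r\<close>, and \<open>K\<close> into \<open>L\<close> because
    \<open>c\<close> and \<open>c'\<close> do. Up to a denominator every element of
    \<open>K'\<close> is a multiple of \<open>a\<close> modulo \<open>K\<close>.\<close>
  have "s \<otimes> c \<ominus> r \<otimes> c' \<in> ideal_quotient R L K'"
  proof (rule idqI)
    show d: "s \<otimes> c \<ominus> r \<otimes> c' \<in> carrier R" using sr cc by simp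
    have da: "(s \<otimes> c \<ominus> r \<otimes> c') \<otimes> a \<in> L"
    proof -
      have "(s \<otimes> c \<ominus> r \<otimes> c') \<otimes> a = s \<otimes> (c \<otimes> a) \<ominus> r \<otimes> (c' \<otimes> a)" using sc sr(2) cc ac by algebra
      then show ?thesis using sr(3) by simp
    qed
    have dK: "(s \<otimes> c \<ominus> r \<otimes> c') \<in> ideal_quotient R L K"
    proof (rule idqI[OF d])
      fix x assume x: "x \<in> K"
      then have xc: "x \<in> carrier R" using K(3) Kc by auto
      have "s \<otimes> (c \<otimes> x) \<ominus> r \<otimes> (c' \<otimes> x) \<in> L"
        by (rule saturated_lin[OF L(1) idqD[OF c x] idqD[OF c'(1) x] sc sr(2)])
      also have "s \<otimes> (c \<otimes> x) \<ominus> r \<otimes> (c' \<otimes> x) = (s \<otimes> c \<ominus> r \<otimes> c') \<otimes> x" using sc sr(2) cc xc by algebra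
      finally show "(s \<otimes> c \<ominus> r \<otimes> c') \<otimes> x \<in> L" .
    qed
    fix x assume x: "x \<in> K'"
    obtain t q where tq: "t \<in> carrier R - P" "q \<in> carrier R" "t \<otimes> x \<ominus> q \<otimes> a \<in> K"
      using sK[OF x a(1) aK] by blast
    let ?e = "s \<otimes> c \<ominus> r \<otimes> c'"
    have tc: "t \<in> carrier R" using tq by simp
    have "\<one> \<otimes> (?e \<otimes> (t \<otimes> x \<ominus> q \<otimes> a)) \<oplus> q \<otimes> (?e \<otimes> a) \<in> L"
      by (rule saturated_lin2[OF L(1) idqD[OF dK tq(3)] da one_closed tq(2)])
    also have "\<one> \<otimes> (?e \<otimes> (t \<otimes> x \<ominus> q \<otimes> a)) \<oplus> q \<otimes> (?e \<otimes> a) = t \<otimes> (?e \<otimes> x)"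
      using d tc tq(2) ac Kc[OF x] by algebra
    finally show "?e \<otimes> x \<in> L" using saturatedD[OF L(1) _ tq(1)] d Kc[OF x] by simp
  qed
  then show "\<exists>s\<in>carrier R - P. \<exists>r\<in>carrier R. s \<otimes> c \<ominus> r \<otimes> c' \<in> ideal_quotient R L K'" using sr by blast
qed

definition minimal_over :: "'a set \<Rightarrow> bool" where
  "minimal_over L \<longleftrightarrow> (\<forall>Q. primeideal Q R \<longrightarrow> L \<subseteq> Q \<longrightarrow> Q \<subseteq> P \<longrightarrow> Q = P)"

lemma annih_subset_P:
  assumes K: "saturated K" and x: "x \<in> carrier R" "x \<notin> K"
  shows "annih R K x \<subseteq> P" "K \<subseteq> annih R K x"
proof -
  show "annih R K x \<subseteq> P" using saturatedD[OF K] x by (auto simp: annih_def)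
  show "K \<subseteq> annih R K x"
  proof
    fix y assume y: "y \<in> K"
    then have "y \<in> carrier R" "x \<otimes> y \<in> K" using saturated_carr[OF K] saturated_mult[OF K] x by auto
    then show "y \<in> annih R K x" using x by (simp add: annih_def m_comm)
  qed
qed

text \<open>Elements outside \<open>P\<close> are nonzerodivisors modulo a saturated ideal, so an
  associated prime of \<open>K\<close> lies in \<open>P\<close>. It contains \<open>L\<close>, and
  minimality of \<open>P\<close> over \<open>L\<close> leaves only \<open>P\<close> itself.\<close>

lemma exists_simple_step:
  assumes K: "saturated K" "L \<subseteq> K" and L: "minimal_over L" and b: "b \<in> carrier R" "b \<notin> K"
  shows "\<exists>r\<in>carrier R. r \<otimes> b \<notin> K \<and> annih R K (r \<otimes> b) = P"
proof -
  obtain r where r: "r \<in> carrier R" "r \<otimes> b \<notin> K" "primeideal (annih R K (r \<otimes> b)) R"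
    using exists_prime_annih[OF saturated_ideal[OF K(1)] b] by blast
  have rb: "r \<otimes> b \<in> carrier R" using r b by simp
  have "annih R K (r \<otimes> b) = P"
    using L r(3) annih_subset_P[OF K(1) rb r(2)] K(2) unfolding minimal_over_def by blast
  then show ?thesis using r by blast
qed

section \<open>Composition series and lengths locally at \<open>P\<close>\<close>

definition composition :: "'a set \<Rightarrow> (nat \<Rightarrow> 'a set) \<Rightarrow> nat \<Rightarrow> bool" where
  "composition K M l \<longleftrightarrow> M 0 = carrier R \<and> M l = K \<and> (\<forall>i<l. simple_step (M (Suc i)) (M i))"

text \<open>The series for \<open>K\<close> is the one for the larger ideal \<open>ext K r\<close>,
  where \<open>P\<close> kills \<open>r\<close> modulo \<open>K\<close>, with \<open>K\<close>
  appended at the lower end. Noetherian induction thus yields finite length directly.\<close>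

lemma exists_composition:
  assumes "saturated K" and L: "L \<subseteq> K" "minimal_over L"
  shows "\<exists>M l. composition K M l"
  using saturated_ideal[OF assms(1)] assms(1) L(1)
proof (induction K rule: ideal_induct)
  case (less K)
  show ?case
  proof (cases "\<one> \<in> K")
    case True
    then have "composition K (\<lambda>_. carrier R) 0"
      using ideal.one_imp_carrier[OF less(1)] by (simp add: composition_def)
    then show ?thesis by blast
  next
    case False
    then obtain r where "r \<in> carrier R" "r \<otimes> \<one> \<notin> K" "annih R K (r \<otimes> \<one>) = P"
      using exists_simple_step[OF less(3,4) L(2) one_closed] by blast
    then have r: "r \<in> carrier R" "r \<notin> K" "annih R K r = P" by simp_all
    have st: "simple_step K (ext K r)"
      using r(3) by (intro simple_step_ext[OF less(3) r(1)]) (auto simp: annih_def)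
    have sub: "K \<subseteq> ext K r" "r \<in> ext K r" using ext_subset[OF less(3) r(1)] ext_mem[OF less(3) r(1)] by auto
    then have "K \<subset> ext K r" "L \<subseteq> ext K r" using r(2) less(4) by auto
    moreover have s: "saturated (ext K r)" using saturated_ext[OF less(3) r(1)] .
    ultimately obtain M l where M: "composition (ext K r) M l"
      using less(2)[OF saturated_ideal[OF s]] by blast
    then have "composition K (M(Suc l := K)) (Suc l)"
      using st by (auto simp: composition_def less_Suc_eq)
    then show ?thesis by blast
  qed
qed

text \<open>The factors of the fixed series \<open>M\<close> in which \<open>I\<close> has a nonzero
  image. For saturated \<open>I\<close> above the end of the series their number is the local length
  of \<open>I\<close> modulo that end. Measuring every ideal against the same series makes it
  unnecessary to compare different series.\<close>

definition jumps :: "(nat \<Rightarrow> 'a set) \<Rightarrow> nat \<Rightarrow> 'a set \<Rightarrow> nat set" where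
  "jumps M l I = {i. i < l \<and> (\<exists>x\<in>I. x \<in> M i \<and> x \<notin> M (Suc i))}"

lemma finite_jumps [simp]: "finite (jumps M l I)" by (simp add: jumps_def)

lemma jumps_mono: "I \<subseteq> I' \<Longrightarrow> jumps M l I \<subseteq> jumps M l I'" by (auto simp: jumps_def)

lemma composition_antimono:
  assumes "composition L M l" "i \<le> j" "j \<le> l" shows "M j \<subseteq> M i"
  using assms(2,3)
proof (induction j rule: dec_induct)
  case (step n)
  have "simple_step (M (Suc n)) (M n)" using step assms(1) by (simp add: composition_def)
  then have "M (Suc n) \<subseteq> M n" by (simp add: simple_step_def)
  then show ?case using step by auto
qed simp

text \<open>If both ideals had nonzero images in the same factors, \<open>I'\<close> could be pushed
  into \<open>I\<close> from the lower end of the series upwards: modulo \<open>M (Suc i)\<close> an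
  element of \<open>I'\<close> is, up to a denominator, a multiple of an element of
  \<open>I\<close>, and the difference is covered by the previous stage.\<close>

lemma jumps_strict:
  assumes M: "composition L M l" and I: "saturated I" "saturated I'" "L \<subseteq> I" "I \<subset> I'"
  shows "card (jumps M l I) < card (jumps M l I')"
proof (rule psubset_card_mono)
  have "jumps M l I \<noteq> jumps M l I'"
  proof
    assume e: "jumps M l I = jumps M l I'"
    have "I' \<inter> M i \<subseteq> I" if "i \<le> l" for i
      using that
    proof (induction i rule: inc_induct)
      case base
      show ?case using M I(3) by (auto simp: composition_def)
    next
      case (step i)
      have st: "simple_step (M (Suc i)) (M i)" using M step by (simp add: composition_def)
      show ?case
      proof
        fix x assume x: "x \<in> I' \<inter> M i"
        show "x \<in> I"
        proof (cases "x \<in> M (Suc i)")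
          case True
          then show ?thesis using x step by auto
        next
          case False
          then have "i \<in> jumps M l I'" using x step by (auto simp: jumps_def)
          then obtain y where y: "y \<in> I" "y \<in> M i" "y \<notin> M (Suc i)" using e by (auto simp: jumps_def)
          then obtain s r where sr: "s \<in> carrier R - P" "r \<in> carrier R" "s \<otimes> x \<ominus> r \<otimes> y \<in> M (Suc i)"
            using st x unfolding simple_step_def by blast
          have c: "x \<in> carrier R" "y \<in> carrier R" using x y saturated_carr[OF I(1)] saturated_carr[OF I(2)] by auto
          have "s \<otimes> x \<ominus> r \<otimes> y \<in> I'" using sr x y I(4) by - (rule saturated_lin[OF I(2)], auto)
          then have d: "s \<otimes> x \<ominus> r \<otimes> y \<in> I" using sr step by auto
          have "r \<otimes> y \<in> I" using saturated_mult[OF I(1) y(1)] sr by simp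
          then have "s \<otimes> x \<in> I" using ideal_swap_diff[OF saturated_ideal[OF I(1)] d] sr c by simp
          then show ?thesis using saturatedD[OF I(1) _ sr(1)] c by simp
        qed
      qed
    qed
    from this[of 0] have "I' \<subseteq> I" using M saturated_carr[OF I(2)] by (auto simp: composition_def)
    then show False using I(4) by auto
  qed
  then show "jumps M l I \<subset> jumps M l I'" using jumps_mono[of I I' M l] I(4) by auto
qed simp

text \<open>Two new jumps \<open>i < j\<close> are impossible. Let \<open>x\<close> and
  \<open>y\<close> in \<open>I'\<close> witness them. Then \<open>y\<close> is not in
  \<open>I\<close>, so \<open>s x - r y \<in> I\<close> for some \<open>s\<close> outside
  \<open>P\<close>. As \<open>y\<close> lies in \<open>M (Suc i)\<close>, this difference jumps at
  \<open>i\<close> just as \<open>x\<close> does, so \<open>i\<close> was a jump of \<open>I\<close>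
  already.\<close>

lemma jumps_step:
  assumes M: "composition L M l" and st: "simple_step I I'"
  shows "card (jumps M l I') \<le> card (jumps M l I) + 1"
proof -
  have I: "saturated I" "saturated I'" "I \<subseteq> I'" using st by (auto simp: simple_step_def)
  have False if ij: "i \<in> jumps M l I' - jumps M l I" "j \<in> jumps M l I' - jumps M l I" "i < j" for i j
  proof -
    obtain x where x: "x \<in> I'" "x \<in> M i" "x \<notin> M (Suc i)" "i < l" using ij by (auto simp: jumps_def)
    obtain y where y: "y \<in> I'" "y \<in> M j" "y \<notin> M (Suc j)" "j < l" using ij by (auto simp: jumps_def)
    have sM: "saturated (M i)" "saturated (M (Suc i))"
      using M x(4) by (auto simp: composition_def simple_step_def)
    have yI: "y \<notin> I" using ij(2) y by (auto simp: jumps_def)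
    then obtain s r where sr: "s \<in> carrier R - P" "r \<in> carrier R" "s \<otimes> x \<ominus> r \<otimes> y \<in> I"
      using st x(1) y(1) unfolding simple_step_def by blast
    have c: "x \<in> carrier R" "y \<in> carrier R" "s \<in> carrier R" using x y saturated_carr[OF I(2)] sr by auto
    have yM: "y \<in> M i" "y \<in> M (Suc i)"
      using composition_antimono[OF M, of i j] composition_antimono[OF M, of "Suc i" j] y ij(3) by auto
    have "s \<otimes> x \<ominus> r \<otimes> y \<in> M i" by (rule saturated_lin[OF sM(1) x(2) yM(1) c(3) sr(2)])
    moreover have "s \<otimes> x \<ominus> r \<otimes> y \<notin> M (Suc i)"
    proof
      assume d: "s \<otimes> x \<ominus> r \<otimes> y \<in> M (Suc i)"
      have "r \<otimes> y \<in> M (Suc i)" using saturated_mult[OF sM(2) yM(2) sr(2)] .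
      then have "s \<otimes> x \<in> M (Suc i)" using ideal_swap_diff[OF saturated_ideal[OF sM(2)] d] sr c by simp
      then show False using saturatedD[OF sM(2) _ sr(1) c(1)] x(3) by simp
    qed
    ultimately have "i \<in> jumps M l I" using sr(3) x(4) by (auto simp: jumps_def)
    then show False using ij(1) by simp
  qed
  then have "i = j" if "i \<in> jumps M l I' - jumps M l I" "j \<in> jumps M l I' - jumps M l I" for i j
    using that by (meson linorder_neqE_nat)
  then have "card (jumps M l I' - jumps M l I) \<le> 1"
    using card_le_Suc0_iff_eq[of "jumps M l I' - jumps M l I"] by (metis One_nat_def finite_Diff finite_jumps)
  moreover have "card (jumps M l I') = card (jumps M l I' - jumps M l I) + card (jumps M l I)"
    using card_Diff_subset[OF finite_jumps jumps_mono[OF I(3), of M l]] card_mono[OF finite_jumps jumps_mono[OF I(3), of M l]]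
    by simp
  ultimately show ?thesis by simp
qed

text \<open>Along a composition series from \<open>K\<close> to \<open>I\<close> each step raises the length of the ideal by
  exactly one and lowers the length of its annihilator by at most one.\<close>

lemma length_sum_mono:
  assumes L: "saturated L" "simple_socle L" "minimal_over L" and M: "composition L M l"
    and I: "saturated I" and K: "saturated K" "L \<subseteq> K" "K \<subseteq> I"
  shows "card (jumps M l (ideal_quotient R L K)) + card (jumps M l K)
       \<le> card (jumps M l (ideal_quotient R L I)) + card (jumps M l I)"
  using saturated_ideal[OF K(1)] K
proof (induction K rule: ideal_induct)
  case (less K)
  show ?case
  proof (cases "K = I")
    case False
    then obtain b where b: "b \<in> I" "b \<notin> K" using less by auto
    have bc: "b \<in> carrier R" using saturated_carr[OF I b(1)] .
    obtain r where r: "r \<in> carrier R" "r \<otimes> b \<notin> K" "annih R K (r \<otimes> b) = P"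
      using exists_simple_step[OF less(3,4) L(3) bc b(2)] by blast
    have rb: "r \<otimes> b \<in> carrier R" using r bc by simp
    let ?K = "ext K (r \<otimes> b)"
    have st: "simple_step K ?K"
      using r(3) by (intro simple_step_ext[OF less(3) rb]) (auto simp: annih_def)
    have sub: "K \<subseteq> ?K" "r \<otimes> b \<in> ?K" using ext_subset[OF less(3) rb] ext_mem[OF less(3) rb] by auto
    have s: "saturated ?K" using saturated_ext[OF less(3) rb] .
    have ps: "K \<subset> ?K" using sub r by auto
    have le: "?K \<subseteq> I" using ext_least[OF I less(5)] saturated_mult[OF I b(1) r(1)] by simp
    have "card (jumps M l (ideal_quotient R L ?K)) + card (jumps M l ?K)
       \<le> card (jumps M l (ideal_quotient R L I)) + card (jumps M l I)"
      using less(2)[OF saturated_ideal[OF s] ps s _ le] less(4) sub(1) by auto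
    moreover have "card (jumps M l K) < card (jumps M l ?K)"
      by (rule jumps_strict[OF M less(3) s less(4) ps])
    moreover have "card (jumps M l (ideal_quotient R L K)) \<le> card (jumps M l (ideal_quotient R L ?K)) + 1"
      by (rule jumps_step[OF M simple_step_idq[OF L(1,2) st]])
    ultimately show ?thesis by linarith
  qed simp
qed

text \<open>The sum of the lengths of \<open>I\<close> and \<open>L : I\<close> grows weakly with
  \<open>I\<close>, yet it takes the same value at \<open>L\<close> and at \<open>R\<close>, since
  \<open>L : L = R\<close> and \<open>L : R = L\<close>. So it is constant. Comparing its values at
  \<open>I\<close> and at \<open>L : I\<close> shows that \<open>I\<close> and its double
  annihilator have the same length, and one contains the other.\<close>

theorem double_ideal_quotient:
  assumes L: "saturated L" "simple_socle L" "minimal_over L" and I: "saturated I" "L \<subseteq> I"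
  shows "ideal_quotient R L (ideal_quotient R L I) = I"
proof -
  obtain M l where M: "composition L M l" using exists_composition[OF L(1) _ L(3)] by blast
  let ?t = "\<lambda>I. card (jumps M l (ideal_quotient R L I)) + card (jumps M l I)"
  have Lc: "L \<subseteq> carrier R" using saturated_carr[OF L(1)] by auto
  have R: "ideal_quotient R L (carrier R) = L"
  proof
    show "ideal_quotient R L (carrier R) \<subseteq> L"
    proof
      fix x assume "x \<in> ideal_quotient R L (carrier R)"
      then show "x \<in> L" using idqD[of x L "carrier R" \<one>] idq_carr[of x] by simp
    qed
    show "L \<subseteq> ideal_quotient R L (carrier R)"
      using Lc ideal.I_r_closed[OF saturated_ideal[OF L(1)]] by (auto simp: ideal_quotient_def)
  qed
  have LL: "ideal_quotient R L L = carrier R"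
    using Lc saturated_mult[OF L(1)] by (auto simp: ideal_quotient_def)
  have t: "?t I = ?t L" if I: "saturated I" "L \<subseteq> I" for I
  proof -
    have "?t L \<le> ?t I" using length_sum_mono[OF L M I(1) L(1) _ I(2)] by simp
    moreover have "?t I \<le> ?t (carrier R)"
      using length_sum_mono[OF L M saturated_carrier I] saturated_carr[OF I(1)] by auto
    moreover have "?t (carrier R) = ?t L" by (simp add: R LL)
    ultimately show ?thesis by linarith
  qed
  let ?N = "ideal_quotient R L I"
  let ?NN = "ideal_quotient R L ?N"
  have Ic: "I \<subseteq> carrier R" using saturated_carr[OF I(1)] by auto
  have N: "saturated ?N" "saturated ?NN"
    using Ic idq_carr by (auto intro!: saturated_ideal_quotient[OF L(1)])
  have LN: "L \<subseteq> ?N" using Ic Lc saturated_mult[OF L(1)] by (auto simp: ideal_quotient_def m_comm subset_iff)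
  have sub: "I \<subseteq> ?NN" using Ic by (auto simp: ideal_quotient_def m_comm subset_iff)
  have "card (jumps M l ?NN) = card (jumps M l I)" using t[OF I] t[OF N(1) LN] by simp
  then show ?thesis using jumps_strict[OF M I(1) N(2) I(2)] sub by auto
qed

end

subsection \<open>Powers of regular sequences\<close>

context noetherian_cring_prime begin

text \<open>\<open>x\<close> is cancelled from \<open>b x \<in> (H, x y, ws)\<close>. Taking off the
  last element \<open>w\<close> leaves \<open>b x = d w\<close> modulo the rest; modulo
  \<open>x\<close> this forces \<open>d\<close> to become a multiple \<open>e x\<close>, and the
  induction hypothesis applies to \<open>b - e w\<close>, all up to denominators.\<close>

lemma mem_span_ext_mult:
  assumes H: "saturated H" and c: "x \<in> carrier R" "y \<in> carrier R" "set ws \<subseteq> carrier R"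
    and n: "nzd R H x" "regular_on (ext H x) ws" and b: "b \<in> carrier R" "b \<otimes> x \<in> span (ext H (x \<otimes> y)) ws"
  shows "b \<in> span (ext H y) ws"
  using c(3) n(2) b
proof (induction ws arbitrary: b rule: rev_induct)
  case Nil
  then obtain s r where sr: "s \<in> carrier R" "s \<notin> P" "r \<in> carrier R" "s \<otimes> (b \<otimes> x) \<ominus> r \<otimes> (x \<otimes> y) \<in> H"
    by (auto elim: extE)
  have bc: "b \<in> carrier R" using Nil by simp
  have "s \<otimes> (b \<otimes> x) \<ominus> r \<otimes> (x \<otimes> y) = (s \<otimes> b \<ominus> r \<otimes> y) \<otimes> x" using sr bc c(1,2) by algebra
  then have "s \<otimes> b \<ominus> r \<otimes> y \<in> H" using nzdD[OF n(1)] sr bc c by simp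
  then show ?case using sr bc by (auto intro: extI[of b s r])
next
  case (snoc w ws)
  have wc: "w \<in> carrier R" "set ws \<subseteq> carrier R" using snoc.prems(1) by auto
  have bc: "b \<in> carrier R" using snoc by simp
  let ?S = "span (ext H (x \<otimes> y)) ws"
  let ?Sx = "span (ext H x) ws"
  have sat: "saturated ?S" "saturated ?Sx" "saturated (span H ws)"
    using H c wc by (simp_all add: saturated_span saturated_ext)
  have xy: "x \<otimes> y \<in> carrier R" using c by simp
  have le: "ext H (x \<otimes> y) \<subseteq> ext H x"
    using ext_least[OF saturated_ext[OF H c(1)] ext_subset[OF H c(1)]]
      ideal.I_r_closed[OF saturated_ideal[OF saturated_ext[OF H c(1)]] ext_mem[OF H c(1)] c(2)] by simp
  have SSx: "?S \<subseteq> ?Sx"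
    using span_mono[OF saturated_ext[OF H xy] saturated_ext[OF H c(1)] le wc(2)] .
  have HS: "span H ws \<subseteq> ?S"
    using span_mono[OF H saturated_ext[OF H xy] ext_subset[OF H xy] wc(2)] .
  have r: "regular_on (ext H x) ws" "nzd R ?Sx w" using snoc.prems(2) by (auto simp: regular_on_snoc)
  obtain s d where sd: "s \<in> carrier R" "s \<notin> P" "d \<in> carrier R" "s \<otimes> (b \<otimes> x) \<ominus> d \<otimes> w \<in> ?S"
    using snoc.prems(4) by (auto elim: extE)
  have xS: "x \<in> ?Sx"
    using span_subset[OF saturated_ext[OF H c(1)] wc(2)] ext_mem[OF H c(1)] by auto
  have "s \<otimes> (b \<otimes> x) \<in> ?Sx"
    using saturated_mult[OF sat(2) xS, of "s \<otimes> b"] sd bc c by (simp add: m_assoc)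
  then have "d \<otimes> w \<in> ?Sx"
    using ideal_swap_diff[OF saturated_ideal[OF sat(2)], of "s \<otimes> (b \<otimes> x)" "d \<otimes> w"] sd SSx bc c wc by auto
  then have "d \<in> ?Sx" using nzdD[OF r(2)] sd by simp
  then have "d \<in> ext (span H ws) x" using span_ext_commute[OF H wc(2) c(1)] by simp
  then obtain t e where te: "t \<in> carrier R" "t \<notin> P" "e \<in> carrier R" "t \<otimes> d \<ominus> e \<otimes> x \<in> span H ws"
    by (elim extE)
  have "t \<otimes> (s \<otimes> (b \<otimes> x) \<ominus> d \<otimes> w) \<oplus> w \<otimes> (t \<otimes> d \<ominus> e \<otimes> x) \<in> ?S"
    using te(4) HS by (intro saturated_lin2[OF sat(1) sd(4)] te wc) auto
  also have "t \<otimes> (s \<otimes> (b \<otimes> x) \<ominus> d \<otimes> w) \<oplus> w \<otimes> (t \<otimes> d \<ominus> e \<otimes> x) = (t \<otimes> s \<otimes> b \<ominus> e \<otimes> w) \<otimes> x"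
    using te(1,3) sd(1,3) wc(1) bc c(1) by algebra
  finally have "t \<otimes> s \<otimes> b \<ominus> e \<otimes> w \<in> span (ext H y) ws"
    using snoc.IH[OF wc(2) r(1)] te sd wc bc by simp
  then show ?case using notin_P_mult[of t s] te sd bc by (auto intro!: extI[of b "t \<otimes> s" e])
qed

text \<open>Multiplication by \<open>x\<close> gives an exact sequence 0 -> R/(H, y) -> R/(H, x y)
  -> R/(H, x) -> 0, and what is regular on both outer terms is regular in the middle.
  \<open>mem_span_ext_mult\<close> says that the left map stays injective modulo the initial parts
  of \<open>ws\<close>.\<close>

lemma regular_on_mult:
  assumes H: "saturated H" and c: "x \<in> carrier R" "y \<in> carrier R" "set ws \<subseteq> carrier R"
    and n: "nzd R H x" "regular_on (ext H x) ws" "regular_on (ext H y) ws"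
  shows "regular_on (ext H (x \<otimes> y)) ws"
  using c(3) n(2,3)
proof (induction ws rule: rev_induct)
  case (snoc w ws)
  have wc: "w \<in> carrier R" "set ws \<subseteq> carrier R" using snoc.prems(1) by auto
  let ?S = "span (ext H (x \<otimes> y)) ws"
  let ?Sx = "span (ext H x) ws"
  let ?Sy = "span (ext H y) ws"
  have sat: "saturated ?S" "saturated ?Sx" "saturated ?Sy" "saturated (span H ws)"
    using H c wc by (simp_all add: saturated_span saturated_ext)
  have xy: "x \<otimes> y \<in> carrier R" using c by simp
  have le: "ext H (x \<otimes> y) \<subseteq> ext H x"
    using ext_least[OF saturated_ext[OF H c(1)] ext_subset[OF H c(1)]]
      ideal.I_r_closed[OF saturated_ideal[OF saturated_ext[OF H c(1)]] ext_mem[OF H c(1)] c(2)] by simp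
  have SSx: "?S \<subseteq> ?Sx"
    using span_mono[OF saturated_ext[OF H xy] saturated_ext[OF H c(1)] le wc(2)] .
  have HS: "span H ws \<subseteq> ?S"
    using span_mono[OF H saturated_ext[OF H xy] ext_subset[OF H xy] wc(2)] .
  have xyS: "x \<otimes> y \<in> ?S"
    using span_subset[OF saturated_ext[OF H xy] wc(2)] ext_mem[OF H xy] by auto
  have r: "regular_on (ext H x) ws" "nzd R ?Sx w" "regular_on (ext H y) ws" "nzd R ?Sy w"
    using snoc.prems(2,3) by (auto simp: regular_on_snoc)
  have "nzd R ?S w"
    unfolding nzd_def
  proof (intro ballI impI)
    fix a assume a: "a \<in> carrier R" "a \<otimes> w \<in> ?S"
    then have "a \<in> ?Sx" using SSx nzdD[OF r(2)] by auto
    then have "a \<in> ext (span H ws) x" using span_ext_commute[OF H wc(2) c(1)] by simp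
    then obtain s b where sb: "s \<in> carrier R" "s \<notin> P" "b \<in> carrier R" "s \<otimes> a \<ominus> b \<otimes> x \<in> span H ws"
      by (elim extE)
    have sbS: "s \<otimes> a \<ominus> b \<otimes> x \<in> ?S" using sb(4) HS by auto
    have "s \<otimes> (a \<otimes> w) \<ominus> w \<otimes> (s \<otimes> a \<ominus> b \<otimes> x) \<in> ?S"
      by (rule saturated_lin[OF sat(1) a(2) sbS sb(1) wc(1)])
    also have "s \<otimes> (a \<otimes> w) \<ominus> w \<otimes> (s \<otimes> a \<ominus> b \<otimes> x) = (b \<otimes> w) \<otimes> x" using sb(1,3) wc(1) a(1) c(1) by algebra
    finally have "b \<otimes> w \<in> ?Sy"
      using mem_span_ext_mult[OF H c(1,2) wc(2) n(1) r(1)] sb wc by simp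
    then have "b \<in> ?Sy" using nzdD[OF r(4)] sb by simp
    then have "b \<in> ext (span H ws) y" using span_ext_commute[OF H wc(2) c(2)] by simp
    then obtain t e where te: "t \<in> carrier R" "t \<notin> P" "e \<in> carrier R" "t \<otimes> b \<ominus> e \<otimes> y \<in> span H ws"
      by (elim extE)
    have teS: "t \<otimes> b \<ominus> e \<otimes> y \<in> ?S" using te(4) HS by auto
    have "x \<otimes> (t \<otimes> b \<ominus> e \<otimes> y) \<oplus> e \<otimes> (x \<otimes> y) \<in> ?S"
      by (rule saturated_lin2[OF sat(1) teS xyS c(1) te(3)])
    then have m: "\<one> \<otimes> (x \<otimes> (t \<otimes> b \<ominus> e \<otimes> y) \<oplus> e \<otimes> (x \<otimes> y)) \<oplus> t \<otimes> (s \<otimes> a \<ominus> b \<otimes> x) \<in> ?S"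
      by (rule saturated_lin2[OF sat(1) _ sbS one_closed te(1)])
    also have "\<one> \<otimes> (x \<otimes> (t \<otimes> b \<ominus> e \<otimes> y) \<oplus> e \<otimes> (x \<otimes> y)) \<oplus> t \<otimes> (s \<otimes> a \<ominus> b \<otimes> x) = (t \<otimes> s) \<otimes> a"
      using te(1,3) sb(1,3) a(1) c(1,2) by algebra
    finally show "a \<in> ?S" using saturatedD[OF sat(1)] notin_P_mult[of t s] te sb a by simp
  qed
  then show ?case using snoc.IH[OF wc(2) r(1,3)] by (simp add: regular_on_snoc)
qed simp

lemma nzd_mult:
  assumes "nzd R H x" "nzd R H y" "x \<in> carrier R" "y \<in> carrier R" shows "nzd R H (x \<otimes> y)"
  using assms unfolding nzd_def by (metis m_assoc m_closed)

lemma regular_on_pow: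
  assumes H: "saturated H" and c: "x \<in> carrier R" "set ws \<subseteq> carrier R" and r: "regular_on H (x # ws)"
  shows "regular_on H (x [^] Suc k # ws)"
proof (induction k)
  case 0
  then show ?case using r c by simp
next
  case (Suc k)
  have n: "nzd R H x" "regular_on (ext H x) ws" using r by (auto simp: regular_on_Cons)
  have m: "nzd R H (x [^] Suc k)" "regular_on (ext H (x [^] Suc k)) ws" using Suc by (auto simp: regular_on_Cons)
  have e: "x [^] Suc (Suc k) = x [^] Suc k \<otimes> x" using c by simp
  have pc: "x [^] Suc k \<in> carrier R" using c by simp
  show ?case unfolding e regular_on_Cons
    using nzd_mult[OF m(1) n(1) pc c(1)] regular_on_mult[OF H pc c(1,2) m n(2)] by simp
qed

lemma regular_on_map_pow:
  assumes "saturated H" "set gs \<subseteq> carrier R" "regular_on H gs"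
  shows "regular_on H (map (\<lambda>x. x [^] Suc k) gs)"
  using assms
proof (induction gs arbitrary: H)
  case (Cons g gs)
  then have c: "g \<in> carrier R" "set gs \<subseteq> carrier R" by auto
  have r: "regular_on H (g [^] Suc k # gs)" by (rule regular_on_pow[OF Cons.prems(1) c Cons.prems(3)])
  then have "regular_on (ext H (g [^] Suc k)) gs" by (simp only: regular_on_Cons)
  then have "regular_on (ext H (g [^] Suc k)) (map (\<lambda>x. x [^] Suc k) gs)"
    using c Cons.prems(1) by (intro Cons.IH saturated_ext) auto
  then show ?case using r by (simp only: regular_on_Cons list.map)
qed simp

subsection \<open>Complete intersections\<close>

text \<open>The contraction of the extension of \<open>K\<close> to the localization at
  \<open>P\<close>. For \<open>K = {\<zero>}\<close> it is the kernel of the localization map and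
  the least saturated ideal, so spans of sequences start from there.\<close>

definition localized :: "'a set \<Rightarrow> 'a set" where
  "localized K = {a \<in> carrier R. \<exists>s\<in>carrier R - P. s \<otimes> a \<in> K}"

lemma localizedI: "a \<in> carrier R \<Longrightarrow> s \<in> carrier R - P \<Longrightarrow> s \<otimes> a \<in> K \<Longrightarrow> a \<in> localized K"
  unfolding localized_def by blast

lemma localizedE:
  assumes "a \<in> localized K"
  obtains s where "a \<in> carrier R" "s \<in> carrier R - P" "s \<otimes> a \<in> K"
  using assms unfolding localized_def by blast

lemma localized_subset: "ideal K R \<Longrightarrow> K \<subseteq> localized K"
  using one_notin_P ideal_carr by (fastforce intro: localizedI[of _ \<one>])

lemma localized_least:
  assumes "K \<subseteq> H" "saturated H" shows "localized K \<subseteq> H"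
proof
  fix a assume "a \<in> localized K"
  then obtain s where "a \<in> carrier R" "s \<in> carrier R - P" "s \<otimes> a \<in> K" by (elim localizedE)
  then show "a \<in> H" using saturatedD[OF assms(2), of s a] assms(1) by auto
qed

lemma saturated_localized:
  assumes K: "ideal K R" shows "saturated (localized K)"
  unfolding saturated_def
proof (intro conjI ballI impI)
  show "ideal (localized K) R"
  proof (rule idealI_add_mult)
    show "localized K \<subseteq> carrier R" by (auto simp: localized_def)
    show "\<zero> \<in> localized K" using localized_subset[OF K] ideal_zero[OF K] by auto
  next
    fix x y assume "x \<in> localized K" "y \<in> localized K"
    then obtain s t where c: "x \<in> carrier R" "s \<in> carrier R - P" "s \<otimes> x \<in> K"
      "y \<in> carrier R" "t \<in> carrier R - P" "t \<otimes> y \<in> K" by (elim localizedE)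
    then have st: "s \<in> carrier R" "t \<in> carrier R" by auto
    have "t \<otimes> (s \<otimes> x) \<oplus> s \<otimes> (t \<otimes> y) \<in> K" by (rule ideal_lin2[OF K c(3,6) st(2,1)])
    also have "t \<otimes> (s \<otimes> x) \<oplus> s \<otimes> (t \<otimes> y) = (s \<otimes> t) \<otimes> (x \<oplus> y)" using st c(1,4) by algebra
    finally show "x \<oplus> y \<in> localized K" using c notin_P_mult[OF c(2,5)] by (intro localizedI) auto
  next
    fix r x assume r: "r \<in> carrier R" and "x \<in> localized K"
    then obtain s where c: "x \<in> carrier R" "s \<in> carrier R - P" "s \<otimes> x \<in> K" by (elim localizedE)
    have "r \<otimes> (s \<otimes> x) \<in> K" using ideal.I_l_closed[OF K c(3) r] .
    also have "r \<otimes> (s \<otimes> x) = s \<otimes> (r \<otimes> x)" using r c by (simp add: m_ac)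
    finally show "r \<otimes> x \<in> localized K" using c r by (intro localizedI) auto
  qed
  fix t a assume t: "t \<in> carrier R - P" "a \<in> carrier R" "t \<otimes> a \<in> localized K"
  from t(3) obtain s where c: "s \<in> carrier R - P" "s \<otimes> (t \<otimes> a) \<in> K" by (elim localizedE)
  then have "(s \<otimes> t) \<otimes> a \<in> K" using t by (simp add: m_assoc)
  then show "a \<in> localized K" using notin_P_mult[OF c(1) t(1)] t by (intro localizedI) auto
qed

abbreviation zero_loc :: "'a set" where "zero_loc \<equiv> localized {\<zero>}"

lemma saturated_zero_loc: "saturated zero_loc"
  by (rule saturated_localized[OF zeroideal])

lemma zero_loc_least: "saturated H \<Longrightarrow> zero_loc \<subseteq> H"
  using localized_least[of "{\<zero>}" H] saturated_zero[of H] by simp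

text \<open>Saturating after each new generator has the same effect as saturating the generated
  ideal once at the end.\<close>

lemma localized_genideal:
  assumes "set fs \<subseteq> carrier R" shows "localized (Idl (set fs)) = span zero_loc fs"
proof
  have s: "saturated (span zero_loc fs)" using saturated_span[OF saturated_zero_loc assms] .
  have "Idl (set fs) \<subseteq> span zero_loc fs"
    using genideal_minimal[OF saturated_ideal[OF s]] span_mem[OF saturated_zero_loc assms] by simp
  then show "localized (Idl (set fs)) \<subseteq> span zero_loc fs" using localized_least s by simp
  have i: "ideal (Idl (set fs)) R" using genideal_ideal[OF assms] .
  show "span zero_loc fs \<subseteq> localized (Idl (set fs))"
    using zero_loc_least[OF saturated_localized[OF i]] genideal_self[OF assms] localized_subset[OF i]
    by (intro span_least[OF saturated_localized[OF i]]) auto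
qed

lemma regular_on_take: "regular_on H fs \<Longrightarrow> regular_on H (take i fs)"
  unfolding regular_on_def by (simp add: min_def)

text \<open>The next element of the sequence lies in \<open>P\<close> and is a nonzerodivisor, so
  \<open>P\<close> kills nothing outside the initial span: a sequence that can be continued inside
  \<open>P\<close> has zero socle.\<close>

lemma regular_on_idq_P:
  assumes "regular_on H xs" "set xs \<subseteq> P" "i < length xs"
  shows "ideal_quotient R (span H (take i xs)) P \<subseteq> span H (take i xs)"
proof
  fix b assume b: "b \<in> ideal_quotient R (span H (take i xs)) P"
  have "xs ! i \<in> P" using assms by auto
  then have "b \<otimes> xs ! i \<in> span H (take i xs)" using idqD[OF b] by simp
  moreover have "nzd R (span H (take i xs)) (xs ! i)" using assms by (simp add: regular_on_def)
  ultimately show "b \<in> span H (take i xs)" using nzdD idq_carr[OF b] by metis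
qed

lemma prime_nat_pow:
  assumes "primeideal Q R" "x \<in> carrier R" "x [^] (k :: nat) \<in> Q" shows "x \<in> Q"
  using assms(3)
proof (induction k)
  case 0
  then show ?case using primeideal_one[OF assms(1)] by simp
next
  case (Suc k)
  then show ?case using primeideal_mult[OF assms(1), of "x [^] k" x] assms(2) by auto
qed

text \<open>Regularity of the local ring at \<open>P\<close>, expressed through a regular sequence
  that generates its maximal ideal.\<close>

definition regular_prime :: bool where
  "regular_prime \<longleftrightarrow> (\<exists>gs. set gs \<subseteq> P \<and> regular_on zero_loc gs \<and> span zero_loc gs = P)"

text \<open>Both lengths equal the depth at \<open>P\<close>. The socle modulo each sequence is
  nonzero: for \<open>gs\<close> it contains the class of \<open>\<one>\<close>, for
  \<open>fs\<close> that of \<open>d\<close>. If one sequence were shorter, exchange would carry its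
  socle to the initial part of equal length of the other, where the next element forces the socle to
  vanish.\<close>

lemma regular_length:
  assumes g: "set gs \<subseteq> P" "regular_on zero_loc gs" "span zero_loc gs = P"
    and f: "set fs \<subseteq> P" "regular_on zero_loc fs"
    and d: "d \<in> ideal_quotient R (span zero_loc fs) P" "d \<notin> span zero_loc fs"
  shows "length fs = length gs"
proof -
  have tk: "set (take i xs) \<subseteq> P" if "set xs \<subseteq> P" for i and xs :: "'a list" using that set_take_subset by fastforce
  have Pc: "P \<subseteq> carrier R" using P_carr by auto
  have sat: "saturated (span zero_loc xs)" if "set xs \<subseteq> P" for xs
    using saturated_span[OF saturated_zero_loc] that Pc by simp
  show ?thesis
  proof (rule ccontr)
    assume "length fs \<noteq> length gs"
    then consider "length gs < length fs" | "length fs < length gs" by linarith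
    then show False
    proof cases
      case 1
      let ?f = "take (length gs) fs"
      have "corresponds P (span zero_loc gs) (span zero_loc ?f)"
        using 1 by (intro corresponds_span saturated_zero_loc P_ideal g f regular_on_take tk) simp
      moreover have "\<one> \<in> ideal_quotient R P P" using Pc by (auto simp: ideal_quotient_def subset_iff)
      ultimately obtain b where "b \<in> ideal_quotient R (span zero_loc ?f) P" "b \<notin> span zero_loc ?f"
        using corresponds_not_subset[of P P "span zero_loc ?f" \<one>] g(3) saturated_P one_notin_P by auto
      then show False using regular_on_idq_P[OF f(2,1) 1] by auto
    next
      case 2
      let ?g = "take (length fs) gs"
      have "corresponds P (span zero_loc fs) (span zero_loc ?g)"
        using 2 by (intro corresponds_span saturated_zero_loc P_ideal g f regular_on_take tk) simp
      then obtain b where "b \<in> ideal_quotient R (span zero_loc ?g) P" "b \<notin> span zero_loc ?g"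
        using corresponds_not_subset[OF _ sat[OF f(1)] d] by auto
      then show False using regular_on_idq_P[OF g(2,1) 2] by auto
    qed
  qed
qed

lemma simple_socle_span:
  assumes g: "set gs \<subseteq> P" "regular_on zero_loc gs" "span zero_loc gs = P"
    and f: "set fs \<subseteq> P" "regular_on zero_loc fs" "length fs = length gs"
  shows "simple_socle (span zero_loc fs)"
proof (rule corresponds_simple_socle)
  show "corresponds P (span zero_loc fs) P"
    using corresponds_span[OF saturated_zero_loc P_ideal f(3,1) g(1) f(2) g(2)] g(3) by simp
  show "saturated (span zero_loc fs)"
    using saturated_span[OF saturated_zero_loc, of fs] f(1) P_carr by auto
qed (rule simple_socle_P)

text \<open>If \<open>Q\<close> lies strictly between, the ideals \<open>J : (Q + (g\<^sub>1\<^sup>k, \<dots>, g\<^sub>e\<^sup>k))\<close> form a strictly increasing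
  sequence, by duality modulo \<open>(g\<^sub>1\<^sup>k\<^sup>+\<^sup>1, \<dots>, g\<^sub>e\<^sup>k\<^sup>+\<^sup>1)\<close> and Nakayama's lemma.\<close>

theorem associated_minimal_over:
  assumes "regular_prime" and f: "set fs \<subseteq> P" "regular_on zero_loc fs"
    and d: "d \<in> ideal_quotient R (span zero_loc fs) P" "d \<notin> span zero_loc fs"
  shows "minimal_over (span zero_loc fs)"
  unfolding minimal_over_def
proof (intro allI impI, rule ccontr)
  let ?J = "span zero_loc fs"
  obtain gs where g: "set gs \<subseteq> P" "regular_on zero_loc gs" "span zero_loc gs = P"
    using assms(1) unfolding regular_prime_def by blast
  have len: "length fs = length gs" by (rule regular_length[OF g f d])
  have gc: "set gs \<subseteq> carrier R" "set fs \<subseteq> carrier R" using g(1) f(1) P_carr by auto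
  have J: "saturated ?J" using saturated_span[OF saturated_zero_loc gc(2)] .
  fix Q assume Q: "primeideal Q R" "?J \<subseteq> Q" "Q \<subseteq> P" "Q \<noteq> P"
  have sQ: "saturated Q" using saturated_prime[OF Q(1,3)] .
  \<comment> \<open>The exponent is \<open>Suc k\<close>, so that the powers lie in \<open>P\<close>
    for \<open>k = 0\<close> as well.\<close>
  define G where "G k = map (\<lambda>x. x [^] Suc k) gs" for k
  have Gc: "set (G k) \<subseteq> carrier R" for k using gc by (auto simp: G_def simp del: nat_pow_Suc)
  have GP: "set (G k) \<subseteq> P" for k
    using g(1) P_carr ideal.I_l_closed[OF P_ideal] by (auto simp: G_def subset_iff)
  define K where "K k = span Q (G k)" for k
  have sK: "saturated (K k)" for k unfolding K_def using saturated_span[OF sQ Gc] .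
  have QK: "Q \<subseteq> K k" and GK: "set (G k) \<subseteq> K k" for k
    unfolding K_def using span_subset[OF sQ Gc] span_mem[OF sQ Gc] by auto
  have Kc: "K k \<subseteq> carrier R" for k using saturated_carr[OF sK] by auto
  have "set (G (Suc k)) \<subseteq> K k" for k
  proof
    fix y assume "y \<in> set (G (Suc k))"
    then obtain x where x: "x \<in> set gs" "y = x [^] Suc (Suc k)" by (auto simp: G_def)
    have "x [^] Suc k \<in> K k" using GK[of k] x(1) by (auto simp: G_def)
    moreover have "x \<in> carrier R" using x gc by auto
    ultimately have "x [^] Suc k \<otimes> x \<in> K k" using ideal.I_r_closed[OF saturated_ideal[OF sK]] by simp
    then show "y \<in> K k" using x by simp
  qed
  then have Kmono: "K (Suc k) \<subseteq> K k" for k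
    unfolding K_def[of "Suc k"] using span_least[OF sK QK] by simp
  \<comment> \<open>The ideals \<open>K k\<close> decrease, so the colon ideals increase and become
    stationary; a single coincidence of neighbours is enough.\<close>
  have "\<exists>k. \<forall>j\<ge>k. ideal_quotient R ?J (K j) = ideal_quotient R ?J (K k)"
    using ideal_seq_stable[of "\<lambda>k. ideal_quotient R ?J (K k)"]
      ideal_ideal_quotient[OF saturated_ideal[OF J] Kc] Kmono
    by (auto simp: ideal_quotient_def subset_iff)
  then obtain k where "ideal_quotient R ?J (K (Suc k)) = ideal_quotient R ?J (K k)"
    using le_Suc_eq by blast
  then have st: "ideal_quotient R ?J (K (Suc k)) \<subseteq> ideal_quotient R ?J (K k)" by simp
  let ?G = "span zero_loc (G (Suc k))"
  have rG: "regular_on zero_loc (G (Suc k))"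
    unfolding G_def by (rule regular_on_map_pow[OF saturated_zero_loc gc(1) g(2)])
  have lG: "length fs = length (G (Suc k))" using len by (simp add: G_def)
  have sG: "saturated ?G" using saturated_span[OF saturated_zero_loc Gc] .
  have fK: "set fs \<subseteq> K (Suc k)"
    using span_mem[OF saturated_zero_loc gc(2)] Q(2) QK[of "Suc k"] by blast
  \<comment> \<open>\<open>K (Suc k)\<close> contains both sequences: \<open>fs\<close> because
    \<open>Q\<close> contains \<open>J\<close>, and the powers by construction. So the coincidence
    passes to colon ideals of \<open>?G\<close>, over which \<open>P\<close> is minimal; double
    annihilators with respect to \<open>?G\<close> then turn it into
    \<open>K k \<subseteq> K (Suc k)\<close>.\<close>
  have "corresponds (K (Suc k)) ?J ?G"
    using corresponds_span[OF saturated_zero_loc saturated_ideal[OF sK] lG fK GK f(2) rG] .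
  then have le: "ideal_quotient R ?G (K (Suc k)) \<subseteq> ideal_quotient R ?G (K k)"
    using corresponds_idq_mono[OF _ sG subset_refl Kc Kc st] by blast
  have soc: "simple_socle ?G"
    using simple_socle_span[OF g GP rG] lG len by simp
  have min: "minimal_over ?G"
    unfolding minimal_over_def
  proof (intro allI impI)
    fix Q' assume Q': "primeideal Q' R" "?G \<subseteq> Q'" "Q' \<subseteq> P"
    have "set gs \<subseteq> Q'"
    proof
      fix x assume x: "x \<in> set gs"
      then have "x [^] Suc (Suc k) \<in> set (G (Suc k))" by (simp add: G_def del: nat_pow_Suc)
      then have "x [^] Suc (Suc k) \<in> Q'" using span_mem[OF saturated_zero_loc Gc, of "Suc k"] Q'(2) by blast
      then show "x \<in> Q'" using prime_nat_pow[OF Q'(1)] x gc by blast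
    qed
    then have "P \<subseteq> Q'"
      using span_least[OF saturated_prime[OF Q'(1,3)] zero_loc_least[OF saturated_prime[OF Q'(1,3)]]] g(3) by auto
    then show "Q' = P" using Q'(3) by simp
  qed
  have GsubK: "?G \<subseteq> K (Suc k)" using span_least[OF sK zero_loc_least[OF sK] GK] .
  have "K k \<subseteq> K (Suc k)"
  proof -
    have "K k = ideal_quotient R ?G (ideal_quotient R ?G (K k))"
      using double_ideal_quotient[OF sG soc min sK] GsubK Kmono[of k] by auto
    also have "\<dots> \<subseteq> ideal_quotient R ?G (ideal_quotient R ?G (K (Suc k)))"
      using le by (auto simp: ideal_quotient_def)
    also have "\<dots> = K (Suc k)" using double_ideal_quotient[OF sG soc min sK GsubK] .
    finally show ?thesis .
  qed
  have ne: "Q \<noteq> K k"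
  proof
    assume e: "Q = K k"
    have "set gs \<subseteq> Q"
    proof
      fix x assume x: "x \<in> set gs"
      then have "x [^] Suc k \<in> set (G k)" by (simp add: G_def del: nat_pow_Suc)
      then have "x [^] Suc k \<in> Q" using GK[of k] e by blast
      then show "x \<in> Q" using prime_nat_pow[OF Q(1)] x gc by blast
    qed
    then have "P \<subseteq> Q" using span_least[OF sQ zero_loc_least[OF sQ]] g(3) by auto
    then show False using Q(3,4) by simp
  qed
  \<comment> \<open>Nakayama's argument: for a maximal saturated \<open>L\<close> with
    \<open>Q \<subseteq> L \<subset> K k\<close> the quotient \<open>K k / L\<close> is simple, so
    \<open>P\<close> multiplies \<open>K k\<close> into \<open>L\<close>. But the new generators of
    \<open>K (Suc k)\<close> are products \<open>x \<otimes> x [^] Suc k\<close> with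
    \<open>x \<in> P\<close>, so \<open>K (Suc k)\<close> would lie in \<open>L\<close>.\<close>
  let ?S = "{L. saturated L \<and> Q \<subseteq> L \<and> L \<subset> K k}"
  have "Q \<in> ?S" using ne QK[of k] sQ by auto
  then have "\<exists>L\<in>?S. \<forall>I\<in>?S. L \<subseteq> I \<longrightarrow> I = L"
    by (intro ideal_maximal) (auto dest: saturated_ideal)
  then obtain L where L0: "L \<in> ?S" "\<forall>I\<in>?S. L \<subseteq> I \<longrightarrow> I = L" by (elim bexE)
  then have L: "saturated L" "Q \<subseteq> L" "L \<subset> K k" by auto
  have max: "I = L" if "saturated I" "Q \<subseteq> I" "I \<subset> K k" "L \<subseteq> I" for I
    using L0(2) that by simp
  have PK: "p \<otimes> y \<in> L" if p: "p \<in> P" and y: "y \<in> K k" for p y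
  proof (rule ccontr)
    assume n: "p \<otimes> y \<notin> L"
    have c: "p \<in> carrier R" "y \<in> carrier R" using p y P_carr Kc by auto
    have yL: "y \<notin> L" using n saturated_mult[OF L(1) _ c(1)] by auto
    let ?I = "ext L (p \<otimes> y)"
    have pyc: "p \<otimes> y \<in> carrier R" using c by simp
    have I: "saturated ?I" "L \<subseteq> ?I" "p \<otimes> y \<in> ?I"
      using saturated_ext[OF L(1) pyc] ext_subset[OF L(1) pyc] ext_mem[OF L(1) pyc] by auto
    have "?I \<subseteq> K k" using ext_least[OF sK, of L k "p \<otimes> y"] L(3) saturated_mult[OF sK y c(1)] by auto
    then have "?I = K k" using max[OF I(1) _ _ I(2)] I(2,3) L(2) n by auto
    then have "y \<in> ?I" using y by simp
    then obtain s r where sr: "s \<in> carrier R" "s \<notin> P" "r \<in> carrier R" "s \<otimes> y \<ominus> r \<otimes> (p \<otimes> y) \<in> L"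
      by (elim extE)
    \<comment> \<open>\<open>s\<close> is outside \<open>P\<close> and \<open>r \<otimes> p\<close>
      inside, so their difference is a unit locally and \<open>y\<close> itself would lie in
      \<open>L\<close>.\<close>
    have rp: "r \<otimes> p \<in> P" using ideal.I_l_closed[OF P_ideal p sr(3)] .
    have "s \<ominus> r \<otimes> p \<notin> P"
      using ideal_swap_diff[OF P_ideal, of s "r \<otimes> p"] rp sr c by auto
    moreover have "s \<otimes> y \<ominus> r \<otimes> (p \<otimes> y) = (s \<ominus> r \<otimes> p) \<otimes> y" using sr(1,3) c by algebra
    ultimately show False using saturatedD[OF L(1), of "s \<ominus> r \<otimes> p" y] sr c yL by simp
  qed
  have "set (G (Suc k)) \<subseteq> L"
  proof
    fix z assume "z \<in> set (G (Suc k))"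
    then obtain x where x: "x \<in> set gs" "z = x [^] Suc (Suc k)" by (auto simp: G_def)
    have "x [^] Suc k \<in> K k" using GK[of k] x(1) by (auto simp: G_def)
    then have "x \<otimes> x [^] Suc k \<in> L" using PK x g(1) by blast
    moreover have "z = x \<otimes> x [^] Suc k" using x gc by (auto simp: m_comm subset_iff)
    ultimately show "z \<in> L" by simp
  qed
  then have "K (Suc k) \<subseteq> L" unfolding K_def by (rule span_least[OF L(1,2)])
  then show False using L(3) \<open>K k \<subseteq> K (Suc k)\<close> by auto
qed

text \<open>Minimality of \<open>P\<close> provides an element with annihilator \<open>P\<close>, so
  the socle is nonzero. Hence \<open>fs\<close> has the length of a regular sequence generating
  \<open>P\<close> locally, and exchange with the latter shows that the socle is simple.\<close>

theorem double_ideal_quotient_regular: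
  assumes "regular_prime" and f: "set fs \<subseteq> P" "regular_on zero_loc fs"
    and m: "minimal_over (span zero_loc fs)" and I: "saturated I" "span zero_loc fs \<subseteq> I"
  shows "ideal_quotient R (span zero_loc fs) (ideal_quotient R (span zero_loc fs) I) = I"
proof -
  let ?J = "span zero_loc fs"
  obtain gs where g: "set gs \<subseteq> P" "regular_on zero_loc gs" "span zero_loc gs = P"
    using assms(1) unfolding regular_prime_def by blast
  have gc: "set fs \<subseteq> carrier R" using f(1) P_carr by auto
  have J: "saturated ?J" using saturated_span[OF saturated_zero_loc gc] .
  have "?J \<subseteq> P" using span_least[OF saturated_P zero_loc_least[OF saturated_P] f(1)] .
  then have "\<one> \<notin> ?J" using one_notin_P by auto
  then obtain r where "r \<in> carrier R" "r \<otimes> \<one> \<notin> ?J" "annih R ?J (r \<otimes> \<one>) = P"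
    using exists_simple_step[OF J subset_refl m one_closed] by blast
  then have r: "r \<in> carrier R" "r \<notin> ?J" "annih R ?J r = P" by simp_all
  have "r \<in> ideal_quotient R ?J P"
  proof (rule idqI[OF r(1)])
    fix x assume "x \<in> P"
    then have "x \<in> carrier R" "x \<otimes> r \<in> ?J" using r(3) by (auto simp: annih_def)
    then show "r \<otimes> x \<in> ?J" using m_comm[OF r(1)] by simp
  qed
  then have "length fs = length gs" using regular_length[OF g f _ r(2)] by simp
  then have "simple_socle ?J" by (rule simple_socle_span[OF g f])
  then show ?thesis using double_ideal_quotient[OF J _ m I] by simp
qed

end

subsection \<open>Heights\<close>

definition weakly_regular :: "('a, 'm) ring_scheme \<Rightarrow> 'a list \<Rightarrow> bool" where
  "weakly_regular R xs \<longleftrightarrow> set xs \<subseteq> carrier R \<and>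
     (\<forall>i<length xs. \<forall>r\<in>carrier R.
        r \<otimes>\<^bsub>R\<^esub> xs ! i \<in> Idl\<^bsub>R\<^esub> (set (take i xs)) \<longrightarrow> r \<in> Idl\<^bsub>R\<^esub> (set (take i xs)))"

definition prime_chain :: "('a, 'm) ring_scheme \<Rightarrow> (nat \<Rightarrow> 'a set) \<Rightarrow> nat \<Rightarrow> 'a set \<Rightarrow> bool" where
  "prime_chain R c l P \<longleftrightarrow> (\<forall>i\<le>l. primeideal (c i) R) \<and> (\<forall>i<l. c i \<subset> c (Suc i)) \<and> c l = P"

lemma prime_height_ge: "prime_chain R c l P \<Longrightarrow> enat l \<le> prime_height R P"
  unfolding prime_height_def prime_chain_def by (rule Sup_upper) blast

lemma prime_chain_extend:
  assumes "prime_chain R c l Q" "primeideal P R" "Q \<subset> P"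
  shows "prime_chain R (c(Suc l := P)) (Suc l) P"
  using assms unfolding prime_chain_def by (auto simp: le_Suc_eq less_Suc_eq)

text \<open>A height is a supremum and may be infinite, so the bound is first turned into an actual
  chain of length at least \<open>r\<close>: if all chains ending in \<open>Q\<close> were shorter,
  the supremum would be at most \<open>r - 1\<close>. The chain is then prolonged by
  \<open>P\<close>.\<close>

lemma prime_height_psubset:
  assumes "primeideal Q R" "primeideal P R" "Q \<subset> P" "enat r \<le> prime_height R Q"
  shows "enat (Suc r) \<le> prime_height R P"
proof -
  have "\<exists>l\<ge>r. \<exists>c. prime_chain R c l Q"
  proof (rule ccontr)
    assume n: "\<nexists>l. l \<ge> r \<and> (\<exists>c. prime_chain R c l Q)"
    have "prime_chain R (\<lambda>_. Q) 0 Q" using assms(1) by (simp add: prime_chain_def)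
    then have r: "r > 0" using n by (metis gr0I le_refl)
    have "prime_height R Q \<le> enat (r - 1)"
      unfolding prime_height_def
    proof (rule Sup_least, clarify)
      fix l c assume "\<forall>i\<le>l. primeideal (c i) R" "\<forall>i<l. c i \<subset> c (Suc i)" "Q = c l"
      then have "prime_chain R c l Q" by (simp add: prime_chain_def)
      then have "l < r" using n not_le by blast
      then show "enat l \<le> enat (r - 1)" by simp
    qed
    with assms(4) have "enat r \<le> enat (r - 1)" by (rule order_trans)
    then show False using r by simp
  qed
  then obtain l c where "l \<ge> r" "prime_chain R c l Q" by blast
  then have "enat (Suc l) \<le> prime_height R P" "enat (Suc r) \<le> enat (Suc l)"
    using prime_height_ge prime_chain_extend assms(2,3) by fastforce+
  then show ?thesis using order_trans by blast
qed

lemma weakly_regular_butlast: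
  assumes "weakly_regular R (fs @ [f])" shows "weakly_regular R fs"
  unfolding weakly_regular_def
proof (intro conjI allI impI ballI)
  show "set fs \<subseteq> carrier R" using assms by (simp add: weakly_regular_def)
  fix i r assume i: "i < length fs" "r \<in> carrier R" "r \<otimes>\<^bsub>R\<^esub> fs ! i \<in> Idl\<^bsub>R\<^esub> (set (take i fs))"
  then have "i < length (fs @ [f])" "(fs @ [f]) ! i = fs ! i" "take i (fs @ [f]) = take i fs"
    by (auto simp: nth_append)
  then show "r \<in> Idl\<^bsub>R\<^esub> (set (take i fs))"
    using assms i(2,3) unfolding weakly_regular_def by metis
qed

lemma (in noetherian_cring_prime) weakly_regular_regular_on:
  assumes "weakly_regular R fs" shows "regular_on zero_loc fs"
  unfolding regular_on_def nzd_def
proof (intro allI impI ballI)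
  have c: "set fs \<subseteq> carrier R" using assms by (simp add: weakly_regular_def)
  have tk: "set (take i fs) \<subseteq> carrier R" for i using c set_take_subset by fastforce
  fix i a assume i: "i < length fs" "a \<in> carrier R" "a \<otimes> fs ! i \<in> span zero_loc (take i fs)"
  then have "a \<otimes> fs ! i \<in> localized (Idl (set (take i fs)))" using localized_genideal[OF tk] by simp
  then obtain s where s: "s \<in> carrier R - P" "s \<otimes> (a \<otimes> fs ! i) \<in> Idl (set (take i fs))"
    by (elim localizedE)
  have "fs ! i \<in> carrier R" using c i by auto
  then have "(s \<otimes> a) \<otimes> fs ! i \<in> Idl (set (take i fs))" using s i by (simp add: m_assoc)
  then have "s \<otimes> a \<in> Idl (set (take i fs))" using assms i s unfolding weakly_regular_def by auto
  then have "a \<in> localized (Idl (set (take i fs)))" using s i by (intro localizedI)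
  then show "a \<in> span zero_loc (take i fs)" using localized_genideal[OF tk] by simp
qed

context noetherian_cring begin

lemma prime_locale: "primeideal P R \<Longrightarrow> noetherian_cring_prime R P"
  by (simp add: noetherian_cring_prime_def noetherian_cring_prime_axioms_def noetherian_cring_axioms)

text \<open>Locally at \<open>P\<close> the initial part \<open>fs\<close> has an associated prime.
  It avoids the last element \<open>f\<close>, a nonzerodivisor modulo \<open>fs\<close>, so it is
  strictly smaller than \<open>P\<close>, and the construction continues below it. The localization
  changes with each prime, so the regularity assumed is the one in \<open>R\<close>.\<close>

lemma exists_prime_chain:
  assumes "weakly_regular R fs" "primeideal P R" "set fs \<subseteq> P"
  shows "\<exists>c. prime_chain R c (length fs) P"
  using assms
proof (induction fs arbitrary: P rule: rev_induct)
  case Nil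
  then have "prime_chain R (\<lambda>_. P) 0 P" by (simp add: prime_chain_def)
  then show ?case by auto
next
  case (snoc f fs)
  interpret L: noetherian_cring_prime R P by (rule prime_locale[OF snoc.prems(2)])
  have c: "set fs \<subseteq> carrier R" using snoc.prems(1) by (simp add: weakly_regular_def)
  have fP: "set fs \<subseteq> P" "f \<in> P" using snoc.prems(3) by auto
  let ?L = "L.span L.zero_loc fs"
  have L: "L.saturated ?L" using L.saturated_span[OF L.saturated_zero_loc c] .
  have "?L \<subseteq> P" using L.span_least[OF L.saturated_P L.zero_loc_least[OF L.saturated_P] fP(1)] .
  then have "\<one> \<notin> ?L" using L.one_notin_P by auto
  then obtain r where "r \<in> carrier R" "r \<otimes> \<one> \<notin> ?L" "primeideal (annih R ?L (r \<otimes> \<one>)) R"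
    using exists_prime_annih[OF L.saturated_ideal[OF L] one_closed] by blast
  then have r: "r \<in> carrier R" "r \<notin> ?L" "primeideal (annih R ?L r) R" by simp_all
  let ?Q = "annih R ?L r"
  have Q: "?Q \<subseteq> P" "?L \<subseteq> ?Q" using L.annih_subset_P[OF L r(1,2)] by auto
  have "nzd R ?L f"
    using L.weakly_regular_regular_on[OF snoc.prems(1)] by (simp add: L.regular_on_snoc)
  moreover have "f \<in> carrier R" using fP L.P_carr by simp
  ultimately have "f \<notin> ?Q" using r nzdD[of R ?L f r] by (auto simp: annih_def m_comm)
  then have ps: "?Q \<subset> P" using Q(1) fP(2) by auto
  have "set fs \<subseteq> ?Q" using Q(2) L.span_mem[OF L.saturated_zero_loc c] by blast
  then obtain c where "prime_chain R c (length fs) ?Q"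
    using snoc.IH[OF weakly_regular_butlast[OF snoc.prems(1)] r(3)] by blast
  then have "prime_chain R (c(Suc (length fs) := P)) (Suc (length fs)) P"
    by (rule prime_chain_extend[OF _ snoc.prems(2) ps])
  then show ?case by auto
qed

lemma prime_height_weakly_regular:
  assumes "weakly_regular R fs" "primeideal P R" "set fs \<subseteq> P"
  shows "enat (length fs) \<le> prime_height R P"
  using exists_prime_chain[OF assms] prime_height_ge by blast

end

text \<open>Infima of nonempty sets in \<open>enat\<close> are attained, and a finite value excludes
  the empty set, whose infimum is \<open>\<infinity>\<close>.\<close>

lemma ideal_height_attained:
  assumes "enat r = ideal_height R I"
  obtains P where "primeideal P R" "I \<subseteq> P" "prime_height R P = enat r"
proof -
  let ?S = "prime_height R ` {P. primeideal P R \<and> I \<subseteq> P}"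
  have e: "enat r = Inf ?S" using assms by (simp add: ideal_height_def)
  have ne: "?S \<noteq> {}"
  proof
    assume "?S = {}"
    then show False using e by (simp add: Inf_enat_def)
  qed
  then obtain x where "x \<in> ?S" by blast
  then have "(LEAST x. x \<in> ?S) \<in> ?S" by (rule LeastI)
  moreover have "Inf ?S = (LEAST x. x \<in> ?S)" using ne unfolding Inf_enat_def by (simp only: if_False)
  ultimately have "enat r \<in> ?S" using e by (simp only:)
  then show ?thesis using that by auto
qed

text \<open>A prime \<open>P\<close> over \<open>I\<close> of height \<open>r\<close> is minimal
  over \<open>I\<close>, since a smaller prime over \<open>I\<close> has height at least
  \<open>r\<close> and would force that of \<open>P\<close> up to \<open>r + 1\<close>.
  Equidimensionality passes the value on to the other minimal primes.\<close>

lemma minimal_prime_height: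
  assumes r: "enat r = ideal_height R I" and e: "equidimensional_quotient R I" and Q: "Q \<in> minimal_primes R I"
  shows "prime_height R Q = enat r"
proof -
  obtain P where P: "primeideal P R" "I \<subseteq> P" "prime_height R P = enat r"
    using ideal_height_attained[OF r] by blast
  have "Q = P" if Q: "primeideal Q R" "I \<subseteq> Q" "Q \<subseteq> P" for Q
  proof (rule ccontr)
    assume "Q \<noteq> P"
    then have ps: "Q \<subset> P" using Q by auto
    have "enat r \<le> prime_height R Q"
      unfolding r ideal_height_def using Q by (intro INF_lower) auto
    then have "enat (Suc r) \<le> enat r" using prime_height_psubset[OF Q(1) P(1) ps] P(3) by simp
    then show False by simp
  qed
  then have "P \<in> minimal_primes R I" using P by (auto simp: minimal_primes_def)
  then show ?thesis using e Q P(3) unfolding equidimensional_quotient_def by metis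
qed

subsection \<open>The unmixed part of an ideal\<close>

text \<open>The intersection of the primary components of \<open>I\<close> at its minimal primes,
  described by denominators instead of a primary decomposition.\<close>

definition unmixed_part :: "('a, 'm) ring_scheme \<Rightarrow> 'a set \<Rightarrow> 'a set" where
  "unmixed_part R I = {b \<in> carrier R. \<forall>Q\<in>minimal_primes R I. \<exists>s\<in>carrier R - Q. s \<otimes>\<^bsub>R\<^esub> b \<in> I}"

lemma (in noetherian_cring_prime) common_denominator:
  assumes "ideal J R" "finite A" "A \<subseteq> localized J"
  shows "\<exists>s\<in>carrier R - P. \<forall>a\<in>A. s \<otimes> a \<in> J"
  using assms(2,3)
proof (induction A)
  case empty
  then show ?case using one_notin_P by auto
next
  case (insert x A)
  then obtain s where s: "s \<in> carrier R - P" "\<forall>a\<in>A. s \<otimes> a \<in> J" by auto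
  obtain t where t: "t \<in> carrier R - P" "x \<in> carrier R" "t \<otimes> x \<in> J"
    using insert.prems by (auto elim: localizedE)
  have "(s \<otimes> t) \<otimes> a \<in> J" if "a \<in> insert x A" for a
  proof (cases "a = x")
    case True
    have "s \<otimes> (t \<otimes> x) \<in> J" using ideal.I_l_closed[OF assms(1) t(3)] s by simp
    then show ?thesis using s t True by (simp add: m_assoc)
  next
    case False
    then have a: "a \<in> A" "a \<in> carrier R" using that insert.prems by (auto elim: localizedE)
    then have "t \<otimes> (s \<otimes> a) \<in> J" using ideal.I_l_closed[OF assms(1)] s t by simp
    moreover have "t \<otimes> (s \<otimes> a) = (s \<otimes> t) \<otimes> a" using s t a by (simp add: m_ac)
    ultimately show ?thesis by simp
  qed
  then show ?case using notin_P_mult[OF s(1) t(1)] by blast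
qed

text \<open>Colon ideals commute with localization because \<open>I\<close> is finitely generated:
  one denominator serves for all generators.\<close>

lemma (in noetherian_cring_prime) localized_idq:
  assumes J: "ideal J R" and I: "ideal I R" and c: "c \<in> ideal_quotient R (localized J) (localized I)"
  shows "\<exists>s\<in>carrier R - P. s \<otimes> c \<in> ideal_quotient R J I"
proof -
  have cc: "c \<in> carrier R" using idq_carr[OF c] .
  obtain A where A: "A \<subseteq> carrier R" "finite A" "I = Idl A" using finetely_gen[OF I] by blast
  have AI: "A \<subseteq> I" using genideal_self[OF A(1)] A(3) by simp
  have "(\<lambda>a. c \<otimes> a) ` A \<subseteq> localized J"
    using idqD[OF c] AI localized_subset[OF I] by auto
  from common_denominator[OF J finite_imageI[OF A(2)] this]
  obtain s where s: "s \<in> carrier R - P" "\<forall>a\<in>A. s \<otimes> (c \<otimes> a) \<in> J" by auto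
  have scc: "s \<otimes> c \<in> carrier R" using s cc by simp
  have "A \<subseteq> annih R J (s \<otimes> c)"
    using s A(1) cc by (auto simp: annih_def m_ac subset_iff)
  then have "I \<subseteq> annih R J (s \<otimes> c)"
    using genideal_minimal[OF ideal_annih[OF J scc]] A(3) by simp
  then have "s \<otimes> c \<in> ideal_quotient R J I"
    using scc by (auto simp: annih_def ideal_quotient_def m_comm)
  then show ?thesis using s by blast
qed

theorem (in noetherian_cring) double_ideal_quotient_unmixed_part:
  assumes reg: "\<And>P. primeideal P R \<Longrightarrow> noetherian_cring_prime.regular_prime R P"
    and I: "ideal I R" and e: "equidimensional_quotient R I" and f: "weakly_regular R fs"
    and J: "J = Idl (set fs)" "J \<subseteq> I" and h: "enat (length fs) = ideal_height R I"
  shows "ideal_quotient R J (ideal_quotient R J I) = unmixed_part R I"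
proof
  have fc: "set fs \<subseteq> carrier R" using f by (simp add: weakly_regular_def)
  have iJ: "ideal J R" unfolding J(1) by (rule genideal_ideal[OF fc])
  have fJ: "set fs \<subseteq> J" unfolding J(1) by (rule genideal_self[OF fc])
  have Ic: "I \<subseteq> carrier R" using ideal_carr[OF I] by auto
  show "ideal_quotient R J (ideal_quotient R J I) \<subseteq> unmixed_part R I"
  proof
    fix b assume b: "b \<in> ideal_quotient R J (ideal_quotient R J I)"
    then have bc: "b \<in> carrier R" by (simp add: ideal_quotient_def)
    have "\<exists>s\<in>carrier R - Q. s \<otimes> b \<in> I" if Qm: "Q \<in> minimal_primes R I" for Q
    proof -
      have Q: "primeideal Q R" "I \<subseteq> Q" using Qm by (auto simp: minimal_primes_def)
      interpret L: noetherian_cring_prime R Q by (rule prime_locale[OF Q(1)])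
      have fQ: "set fs \<subseteq> Q" using fJ J(2) Q(2) by simp
      have s: "L.localized J = L.span L.zero_loc fs" using L.localized_genideal[OF fc] by (simp only: J(1)[symmetric])
      \<comment> \<open>A prime strictly below \<open>Q\<close> that contains \<open>fs\<close>
        would have height at least \<open>length fs\<close>, and \<open>Q\<close> a larger one; but
        the height of \<open>Q\<close> is exactly \<open>length fs\<close>.\<close>
      have m: "L.minimal_over (L.span L.zero_loc fs)"
        unfolding L.minimal_over_def
      proof (intro allI impI, rule ccontr)
        fix Q' assume Q': "primeideal Q' R" "L.span L.zero_loc fs \<subseteq> Q'" "Q' \<subseteq> Q" "Q' \<noteq> Q"
        then have ps: "Q' \<subset> Q" by auto
        have "set fs \<subseteq> Q'" using L.span_mem[OF L.saturated_zero_loc fc] Q'(2) by simp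
        then have "enat (length fs) \<le> prime_height R Q'" by (rule prime_height_weakly_regular[OF f Q'(1)])
        then have "enat (Suc (length fs)) \<le> prime_height R Q" by (rule prime_height_psubset[OF Q'(1) Q(1) ps])
        then show False using minimal_prime_height[OF h e Qm] by simp
      qed
      have sub: "L.span L.zero_loc fs \<subseteq> L.localized I"
        unfolding s[symmetric] using L.localized_least[OF _ L.saturated_localized[OF I]] L.localized_subset[OF I] J(2)
        by blast
      have d: "ideal_quotient R (L.localized J) (ideal_quotient R (L.localized J) (L.localized I)) = L.localized I"
        unfolding s by (rule L.double_ideal_quotient_regular[OF reg[OF Q(1)] fQ L.weakly_regular_regular_on[OF f] m
              L.saturated_localized[OF I] sub])
      have "b \<in> ideal_quotient R (L.localized J) (ideal_quotient R (L.localized J) (L.localized I))"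
      proof (rule L.idqI[OF bc])
        fix c assume c: "c \<in> ideal_quotient R (L.localized J) (L.localized I)"
        then have cc: "c \<in> carrier R" by (rule L.idq_carr)
        obtain s where s: "s \<in> carrier R - Q" "s \<otimes> c \<in> ideal_quotient R J I"
          using L.localized_idq[OF iJ I c] by blast
        have "b \<otimes> (s \<otimes> c) \<in> J" using L.idqD[OF b s(2)] .
        also have "b \<otimes> (s \<otimes> c) = s \<otimes> (b \<otimes> c)" using bc s cc by (simp add: m_ac)
        finally show "b \<otimes> c \<in> L.localized J" using s bc cc by (intro L.localizedI) auto
      qed
      then show ?thesis using d by (auto elim: L.localizedE)
    qed
    then show "b \<in> unmixed_part R I" using bc by (simp add: unmixed_part_def)
  qed
  show "unmixed_part R I \<subseteq> ideal_quotient R J (ideal_quotient R J I)"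
  proof
    fix b assume b: "b \<in> unmixed_part R I"
    then have bc: "b \<in> carrier R" by (simp add: unmixed_part_def)
    \<comment> \<open>If \<open>b c\<close> is not in \<open>J\<close>, a multiple of it has a prime
      annihilator modulo \<open>J\<close>, which contains \<open>I\<close> because
      \<open>c I \<subseteq> J\<close>. This prime is minimal over \<open>J\<close>, as
      \<open>J\<close> has no embedded primes, and therefore over \<open>I\<close>. So some
      \<open>t\<close> outside it multiplies \<open>b\<close> into \<open>I\<close>, but then
      \<open>t\<close> kills the multiple of \<open>b c\<close>.\<close>
    have "b \<otimes> c \<in> J" if c: "c \<in> ideal_quotient R J I" for c
    proof (rule ccontr)
      assume n: "b \<otimes> c \<notin> J"
      have cc: "c \<in> carrier R" and cI: "\<And>x. x \<in> I \<Longrightarrow> c \<otimes> x \<in> J" using c by (auto simp: ideal_quotient_def)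
      obtain r where r: "r \<in> carrier R" "r \<otimes> (b \<otimes> c) \<notin> J" "primeideal (annih R J (r \<otimes> (b \<otimes> c))) R"
        using exists_prime_annih[OF iJ _ n] bc cc by auto
      let ?d = "r \<otimes> (b \<otimes> c)"
      let ?P = "annih R J ?d"
      have dc: "?d \<in> carrier R" using r bc cc by simp
      interpret L: noetherian_cring_prime R ?P by (rule prime_locale[OF r(3)])
      have IP: "I \<subseteq> ?P"
      proof
        fix x assume x: "x \<in> I"
        then have xc: "x \<in> carrier R" using Ic by auto
        have "(r \<otimes> b) \<otimes> (c \<otimes> x) \<in> J" using ideal.I_l_closed[OF iJ cI[OF x]] r bc by simp
        also have "(r \<otimes> b) \<otimes> (c \<otimes> x) = x \<otimes> ?d" using r(1) bc cc xc by (simp add: m_ac)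
        finally show "x \<in> ?P" using xc by (simp add: annih_def)
      qed
      have fP: "set fs \<subseteq> ?P" using fJ J(2) IP by blast
      have s: "L.localized J = L.span L.zero_loc fs" using L.localized_genideal[OF fc] by (simp only: J(1)[symmetric])
      have d: "?d \<in> ideal_quotient R (L.span L.zero_loc fs) ?P" "?d \<notin> L.span L.zero_loc fs"
      proof -
        show "?d \<in> ideal_quotient R (L.span L.zero_loc fs) ?P"
        proof (rule L.idqI[OF dc])
          fix x assume x: "x \<in> ?P"
          then have "x \<in> carrier R" "x \<otimes> ?d \<in> J" by (auto simp: annih_def)
          then have "?d \<otimes> x \<in> J" using m_comm[OF dc] by simp
          then show "?d \<otimes> x \<in> L.span L.zero_loc fs" using L.localized_subset[OF iJ] s by auto
        qed
        show "?d \<notin> L.span L.zero_loc fs"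
        proof
          assume "?d \<in> L.span L.zero_loc fs"
          then have "?d \<in> L.localized J" using s by simp
          then obtain t where "t \<in> carrier R - ?P" "t \<otimes> ?d \<in> J" by (rule L.localizedE)
          then show False by (auto simp: annih_def)
        qed
      qed
      have m: "L.minimal_over (L.span L.zero_loc fs)"
        by (rule L.associated_minimal_over[OF reg[OF r(3)] fP L.weakly_regular_regular_on[OF f] d])
      have "?P \<in> minimal_primes R I"
        unfolding minimal_primes_def
      proof (intro CollectI conjI allI impI r(3) IP)
        fix Q assume Q: "primeideal Q R \<and> I \<subseteq> Q \<and> Q \<subseteq> ?P"
        have "L.span L.zero_loc fs \<subseteq> Q"
          unfolding s[symmetric] using Q J(2) by (intro L.localized_least L.saturated_prime) auto
        then show "Q = ?P" using m Q unfolding L.minimal_over_def by blast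
      qed
      then obtain t where t: "t \<in> carrier R - ?P" "t \<otimes> b \<in> I" using b unfolding unmixed_part_def by blast
      have tc: "t \<in> carrier R" using t by simp
      have "r \<otimes> (c \<otimes> (t \<otimes> b)) \<in> J" using ideal.I_l_closed[OF iJ cI[OF t(2)] r(1)] .
      also have "r \<otimes> (c \<otimes> (t \<otimes> b)) = t \<otimes> ?d" using tc r(1) bc cc by (simp add: m_ac)
      finally have "t \<in> ?P" using tc by (simp add: annih_def)
      then show False using t by simp
    qed
    then show "b \<in> ideal_quotient R J (ideal_quotient R J I)" using bc by (simp add: ideal_quotient_def)
  qed
qed

text \<open>If \<open>P\<close> is the annihilator of \<open>b\<close> and not minimal, no minimal
  prime contains \<open>P\<close>, so at each of them a denominator multiplies \<open>b\<close> into
  \<open>I\<close>. Conversely, an associated prime of the multiples of such a \<open>b\<close>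
  cannot be minimal, because that denominator would belong to it. The condition on \<open>t\<close>
  is \<open>t b \<in> I\<close>.\<close>

theorem (in noetherian_cring) exists_embedded_containing:
  assumes I: "ideal I R" and t: "t \<in> carrier R"
  shows "(\<exists>P. primeideal P R \<and> (\<exists>b\<in>carrier R. P = annih R I b) \<and> P \<notin> minimal_primes R I \<and> t \<in> P)
    \<longleftrightarrow> \<not> ideal_quotient R I (PIdl t) \<inter> unmixed_part R I \<subseteq> I"
proof
  assume "\<exists>P. primeideal P R \<and> (\<exists>b\<in>carrier R. P = annih R I b) \<and> P \<notin> minimal_primes R I \<and> t \<in> P"
  then obtain P b where P: "primeideal P R" "b \<in> carrier R" "P = annih R I b" "P \<notin> minimal_primes R I" "t \<in> P"
    by blast
  have IP: "I \<subseteq> P"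
    using P(2,3) ideal_carr[OF I] ideal.I_r_closed[OF I] by (auto simp: annih_def)
  have "b \<notin> I"
  proof
    assume "b \<in> I"
    then have "\<one> \<in> P" using P(2,3) by (simp add: annih_def)
    then show False using primeideal_one[OF P(1)] by simp
  qed
  moreover have "b \<in> ideal_quotient R I (PIdl t)"
  proof -
    have tb: "t \<otimes> b \<in> I" using P by (simp add: annih_def)
    have "b \<otimes> (x \<otimes> t) \<in> I" if "x \<in> carrier R" for x
    proof -
      have "b \<otimes> (x \<otimes> t) = x \<otimes> (t \<otimes> b)" using that t P(2) by (simp add: m_ac)
      then show ?thesis using ideal.I_l_closed[OF I tb that] by simp
    qed
    then show ?thesis using P(2) by (auto simp: ideal_quotient_def cgenideal_def)
  qed
  moreover have "b \<in> unmixed_part R I"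
    unfolding unmixed_part_def
  proof (intro CollectI conjI ballI P(2))
    fix Q assume Q: "Q \<in> minimal_primes R I"
    have "\<not> P \<subseteq> Q"
    proof
      assume "P \<subseteq> Q"
      then have "P = Q" using P(1) IP Q by (simp add: minimal_primes_def)
      then show False using P(4) Q by simp
    qed
    then show "\<exists>s\<in>carrier R - Q. s \<otimes> b \<in> I" using P(3) by (auto simp: annih_def)
  qed
  ultimately show "\<not> ideal_quotient R I (PIdl t) \<inter> unmixed_part R I \<subseteq> I" by blast
next
  assume "\<not> ideal_quotient R I (PIdl t) \<inter> unmixed_part R I \<subseteq> I"
  then obtain b where b: "b \<in> ideal_quotient R I (PIdl t)" "b \<in> unmixed_part R I" "b \<notin> I" by blast
  have bc: "b \<in> carrier R" using b by (simp add: unmixed_part_def)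
  obtain r where r: "r \<in> carrier R" "r \<otimes> b \<notin> I" "primeideal (annih R I (r \<otimes> b)) R"
    using exists_prime_annih[OF I bc b(3)] by blast
  let ?P = "annih R I (r \<otimes> b)"
  have rb: "r \<otimes> b \<in> carrier R" using r bc by simp
  have "t \<in> ?P"
  proof -
    have "t \<in> PIdl t" using cgenideal_self[OF t] .
    then have "b \<otimes> t \<in> I" using b(1) by (simp add: ideal_quotient_def)
    then have "r \<otimes> (b \<otimes> t) \<in> I" using ideal.I_l_closed[OF I _ r(1)] by simp
    then show ?thesis using t r(1) bc by (simp add: annih_def m_ac)
  qed
  moreover have "?P \<notin> minimal_primes R I"
  proof
    assume "?P \<in> minimal_primes R I"
    then obtain s where s: "s \<in> carrier R - ?P" "s \<otimes> b \<in> I" using b(2) unfolding unmixed_part_def by blast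
    have sc: "s \<in> carrier R" using s by simp
    have "r \<otimes> (s \<otimes> b) \<in> I" using ideal.I_l_closed[OF I s(2) r(1)] .
    then have "s \<in> ?P" using sc r(1) bc by (simp add: annih_def m_ac)
    then show False using s by simp
  qed
  ultimately show "\<exists>P. primeideal P R \<and> (\<exists>b\<in>carrier R. P = annih R I b) \<and> P \<notin> minimal_primes R I \<and> t \<in> P"
    using r(3) rb by blast
qed

section \<open>Polynomial extensions\<close>

text \<open>An interface for \<open>E = D[T]\<close>, where \<open>co p k\<close> is the coefficient
  of the \<open>k\<close>-th power of \<open>T\<close>. \<open>D\<close> is the same record with a
  smaller carrier, so an induction on the number of variables passes from \<open>D\<close> to
  \<open>E\<close> without isomorphisms. Coefficients of products are prescribed only for constants
  and \<open>T\<close>; with \<open>tail\<close> this permits Horner-style inductions on a degree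
  bound.\<close>

locale poly_extension = E: cring E + D: cring "E\<lparr>carrier := D\<rparr>" for E (structure) and D +
  fixes T :: 'a and co :: "'a \<Rightarrow> nat \<Rightarrow> 'a"
  assumes D_sub: "D \<subseteq> carrier E"
    and X_closed: "T \<in> carrier E"
    and co_closed: "p \<in> carrier E \<Longrightarrow> co p k \<in> D"
    and co_add: "p \<in> carrier E \<Longrightarrow> q \<in> carrier E \<Longrightarrow> co (p \<oplus> q) k = co p k \<oplus> co q k"
    and co_smult: "d \<in> D \<Longrightarrow> p \<in> carrier E \<Longrightarrow> co (d \<otimes> p) k = d \<otimes> co p k"
    and co_X_0: "p \<in> carrier E \<Longrightarrow> co (T \<otimes> p) 0 = \<zero>"
    and co_X_Suc: "p \<in> carrier E \<Longrightarrow> co (T \<otimes> p) (Suc k) = co p k"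
    and co_eq: "p \<in> carrier E \<Longrightarrow> q \<in> carrier E \<Longrightarrow> (\<And>k. co p k = co q k) \<Longrightarrow> p = q"
    and co_fin: "p \<in> carrier E \<Longrightarrow> \<exists>N. \<forall>k\<ge>N. co p k = \<zero>"
    and co_const_0: "d \<in> D \<Longrightarrow> co d 0 = d"
    and co_const_Suc: "d \<in> D \<Longrightarrow> co d (Suc k) = \<zero>"
    and tail: "p \<in> carrier E \<Longrightarrow> \<exists>p'\<in>carrier E. p = co p 0 \<oplus> T \<otimes> p'"
begin

abbreviation DR where "DR \<equiv> E\<lparr>carrier := D\<rparr>"

lemma D_carr: "d \<in> D \<Longrightarrow> d \<in> carrier E" using D_sub by auto

lemma co_carr: "p \<in> carrier E \<Longrightarrow> co p k \<in> carrier E" using co_closed D_carr by auto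

lemma D_mult: "c \<in> D \<Longrightarrow> d \<in> D \<Longrightarrow> c \<otimes> d \<in> D" using D.m_closed by simp
lemma D_add: "c \<in> D \<Longrightarrow> d \<in> D \<Longrightarrow> c \<oplus> d \<in> D" using D.a_closed by simp
lemma D_zero: "\<zero> \<in> D" using D.zero_closed by simp
lemma D_one: "\<one> \<in> D" using D.one_closed by simp

lemma co_zero: "co \<zero> k = \<zero>" using co_const_0[OF D_zero] co_const_Suc[OF D_zero] by (cases k) auto

lemma co_diff:
  assumes "p \<in> carrier E" "q \<in> carrier E" shows "co (p \<ominus> q) k = co p k \<ominus> co q k"
proof -
  have "p = (p \<ominus> q) \<oplus> q" using assms by algebra
  then have "co p k = co (p \<ominus> q) k \<oplus> co q k" using co_add[of "p \<ominus> q" q k] assms by simp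
  moreover have "co (p \<ominus> q) k \<in> carrier E" "co q k \<in> carrier E" using assms co_carr by auto
  ultimately show ?thesis by (simp add: a_minus_def E.a_assoc E.r_neg)
qed

lemma tail_co:
  assumes "p \<in> carrier E"
  obtains p' where "p' \<in> carrier E" "p = co p 0 \<oplus> T \<otimes> p'" "\<And>k. co p' k = co p (Suc k)"
proof -
  obtain p' where p: "p' \<in> carrier E" "p = co p 0 \<oplus> T \<otimes> p'" using tail assms by blast
  have c: "co p 0 \<in> D" "co p 0 \<in> carrier E" "T \<otimes> p' \<in> carrier E" using assms co_closed co_carr X_closed p by auto
  have "co p' k = co p (Suc k)" for k
  proof -
    have "co p (Suc k) = co (co p 0 \<oplus> T \<otimes> p') (Suc k)" using p(2) by simp
    also have "\<dots> = \<zero> \<oplus> co p' k" using co_add[OF c(2,3)] co_const_Suc[OF c(1)] co_X_Suc[OF p(1)] by simp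
    also have "\<dots> = co p' k" using co_carr p(1) by simp
    finally show ?thesis by simp
  qed
  then show ?thesis using that p by blast
qed

lemma co_bounded_zero: "p \<in> carrier E \<Longrightarrow> (\<And>k. co p k = \<zero>) \<Longrightarrow> p = \<zero>"
  using co_eq[of p \<zero>] co_zero by simp

lemma co_pow_mult:
  assumes "p \<in> carrier E" shows "co (T [^] (j::nat) \<otimes> p) k = (if k < j then \<zero> else co p (k - j))"
  using assms
proof (induction j arbitrary: k p)
  case (Suc j)
  have "T [^] Suc j \<otimes> p = T [^] j \<otimes> (T \<otimes> p)" using Suc X_closed by (simp add: E.m_assoc)
  then have "co (T [^] Suc j \<otimes> p) k = (if k < j then \<zero> else co (T \<otimes> p) (k - j))"
    using Suc X_closed by simp
  also have "\<dots> = (if k < Suc j then \<zero> else co p (k - Suc j))"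
  proof (cases "k < Suc j")
    case True
    then show ?thesis using co_X_0[OF Suc.prems] by (cases "k = j") auto
  next
    case False
    then have "k - j = Suc (k - Suc j)" by simp
    then show ?thesis using co_X_Suc[OF Suc.prems] False by simp
  qed
  finally show ?case .
qed simp

text \<open>Horner's scheme \<open>h = co h 0 + T p\<close> lowers the degree bound by one.\<close>

lemma mem_ideal_of_co:
  assumes K: "ideal K E" and h: "h \<in> carrier E" "\<And>k. co h k \<in> K"
  shows "h \<in> K"
proof -
  obtain N where "\<forall>k\<ge>N. co h k = \<zero>" using co_fin h by blast
  then show ?thesis using h
  proof (induction N arbitrary: h)
    case 0
    then have "h = \<zero>" by - (rule co_bounded_zero, auto)
    then show ?case using E.ideal_zero[OF K] by simp
  next
    case (Suc N)
    obtain p where p: "p \<in> carrier E" "h = co h 0 \<oplus> T \<otimes> p" "\<And>k. co p k = co h (Suc k)"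
      using tail_co[OF Suc.prems(2)] by blast
    have "p \<in> K" by (rule Suc.IH) (use p(1,3) Suc.prems in auto)
    then have "T \<otimes> p \<in> K" using ideal.I_l_closed[OF K] X_closed by simp
    then have "co h 0 \<oplus> T \<otimes> p \<in> K" using E.ideal_add[OF K Suc.prems(3)] by simp
    then show ?case using p(2) by simp
  qed
qed

text \<open>For an ideal \<open>q\<close> of \<open>D\<close> this is the extended ideal
  \<open>q E\<close>.\<close>

definition coefs_in :: "'a set \<Rightarrow> 'a set" where
  "coefs_in q = {h \<in> carrier E. \<forall>k. co h k \<in> q}"

lemma DR_ideal_mult: "ideal q DR \<Longrightarrow> x \<in> q \<Longrightarrow> d \<in> D \<Longrightarrow> d \<otimes> x \<in> q"
  using ideal.I_l_closed[of q DR x d] by simp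
lemma DR_ideal_add: "ideal q DR \<Longrightarrow> x \<in> q \<Longrightarrow> y \<in> q \<Longrightarrow> x \<oplus> y \<in> q"
  using D.ideal_add[of q x y] by simp
lemma DR_ideal_zero: "ideal q DR \<Longrightarrow> \<zero> \<in> q"
  using D.ideal_zero[of q] by simp
lemma ideal_coefs_in:
  assumes q: "ideal q DR" shows "ideal (coefs_in q) E"
proof (rule E.idealI_add_mult)
  show "coefs_in q \<subseteq> carrier E" "\<zero> \<in> coefs_in q"
    using DR_ideal_zero[OF q] by (auto simp: coefs_in_def co_zero)
  show add: "x \<oplus> y \<in> coefs_in q" if "x \<in> coefs_in q" "y \<in> coefs_in q" for x y
    using that DR_ideal_add[OF q] by (auto simp: coefs_in_def co_add)
  fix r x assume r: "r \<in> carrier E" and x: "x \<in> coefs_in q"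
  have xc: "x \<in> carrier E" using x by (simp add: coefs_in_def)
  obtain N where "\<forall>k\<ge>N. co r k = \<zero>" using co_fin r by blast
  then show "r \<otimes> x \<in> coefs_in q" using r
  proof (induction N arbitrary: r)
    case 0
    then have "r = \<zero>" by - (rule co_bounded_zero, auto)
    then show ?case using xc \<open>\<zero> \<in> coefs_in q\<close> by simp
  next
    case (Suc N)
    obtain p where p: "p \<in> carrier E" "r = co r 0 \<oplus> T \<otimes> p" "\<And>k. co p k = co r (Suc k)"
      using tail_co[OF Suc.prems(2)] by blast
    have "p \<otimes> x \<in> coefs_in q" by (rule Suc.IH) (use p(1,3) Suc.prems in auto)
    moreover have "p \<otimes> x \<in> carrier E" using p(1) xc by simp
    ultimately have 1: "T \<otimes> (p \<otimes> x) \<in> coefs_in q"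
      using co_pow_mult[of "p \<otimes> x" 1] X_closed DR_ideal_zero[OF q] by (simp add: coefs_in_def)
    have c: "co r 0 \<in> D" "co r 0 \<in> carrier E" using Suc.prems(2) co_closed co_carr by auto
    have 2: "co r 0 \<otimes> x \<in> coefs_in q"
      using x c DR_ideal_mult[OF q] by (simp add: coefs_in_def co_smult)
    have "r \<otimes> x = (co r 0 \<oplus> T \<otimes> p) \<otimes> x" using p(2) by simp
    also have "\<dots> = co r 0 \<otimes> x \<oplus> T \<otimes> (p \<otimes> x)" using c(2) X_closed p(1) xc by algebra
    finally show ?case using add[OF 2 1] by simp
  qed
qed

subsection \<open>Hilbert's basis theorem\<close>

text \<open>Leading coefficients of the members of \<open>I\<close> of degree \<open>k\<close>,
  together with zero. Keeping the degrees apart gives an ascending sequence of ideals of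
  \<open>D\<close>, whose stabilization bounds the degrees of generators.\<close>

definition lead :: "'a set \<Rightarrow> nat \<Rightarrow> 'a set" where
  "lead I k = {c. \<exists>p\<in>I. (\<forall>j>k. co p j = \<zero>) \<and> co p k = c}"

lemma ideal_lead:
  assumes I: "ideal I E" shows "ideal (lead I k) DR"
proof (rule D.idealI_add_mult)
  note c = E.ideal_carr[OF I]
  show "lead I k \<subseteq> carrier DR" using c co_closed by (auto simp: lead_def)
  show "\<zero>\<^bsub>DR\<^esub> \<in> lead I k" using E.ideal_zero[OF I] by (auto simp: lead_def co_zero intro!: bexI[of _ \<zero>])
next
  note c = E.ideal_carr[OF I]
  fix x y assume "x \<in> lead I k" "y \<in> lead I k"
  then obtain p q where p: "p \<in> I" "\<forall>j>k. co p j = \<zero>" "co p k = x" "q \<in> I" "\<forall>j>k. co q j = \<zero>" "co q k = y"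
    by (auto simp: lead_def)
  then have "p \<oplus> q \<in> I" "\<forall>j>k. co (p \<oplus> q) j = \<zero>" "co (p \<oplus> q) k = x \<oplus> y"
    using c E.ideal_add[OF I] by (auto simp: co_add)
  then show "x \<oplus>\<^bsub>DR\<^esub> y \<in> lead I k" by (auto simp: lead_def)
next
  note c = E.ideal_carr[OF I]
  fix r x assume r: "r \<in> carrier DR" and "x \<in> lead I k"
  then obtain p where p: "p \<in> I" "\<forall>j>k. co p j = \<zero>" "co p k = x" by (auto simp: lead_def)
  then have "r \<otimes> p \<in> I" "\<forall>j>k. co (r \<otimes> p) j = \<zero>" "co (r \<otimes> p) k = r \<otimes> x"
    using c r ideal.I_l_closed[OF I] D_carr by (auto simp: co_smult)
  then show "r \<otimes>\<^bsub>DR\<^esub> x \<in> lead I k" by (auto simp: lead_def)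
qed

lemma lead_Suc:
  assumes I: "ideal I E" shows "lead I k \<subseteq> lead I (Suc k)"
proof
  fix x assume "x \<in> lead I k"
  then obtain p where p: "p \<in> I" "\<forall>j>k. co p j = \<zero>" "co p k = x" by (auto simp: lead_def)
  have pc: "p \<in> carrier E" using E.ideal_carr[OF I p(1)] .
  have "T \<otimes> p \<in> I" "\<forall>j>Suc k. co (T \<otimes> p) j = \<zero>" "co (T \<otimes> p) (Suc k) = x"
    using p ideal.I_l_closed[OF I p(1) X_closed] co_pow_mult[OF pc, of 1] X_closed by auto
  then show "x \<in> lead I (Suc k)" by (auto simp: lead_def)
qed

lemma lead_mono: "ideal I E \<Longrightarrow> j \<le> k \<Longrightarrow> lead I j \<subseteq> lead I k"
  by (rule lift_Suc_mono_le[of "lead I"]) (auto simp: lead_Suc)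

text \<open>Subtracting an element of \<open>I'\<close> with the same top coefficient lowers the
  degree bound, and the difference stays in \<open>I\<close> because
  \<open>I' \<subseteq> I\<close>.\<close>

lemma subset_of_lead_subset:
  assumes I: "ideal I E" "ideal I' E" "I' \<subseteq> I" and l: "\<And>k. lead I k \<subseteq> lead I' k"
  shows "I \<subseteq> I'"
proof
  fix p assume p: "p \<in> I"
  then obtain N where "\<forall>k\<ge>N. co p k = \<zero>" using co_fin E.ideal_carr[OF I(1)] by blast
  then show "p \<in> I'" using p
  proof (induction N arbitrary: p)
    case 0
    then have "p = \<zero>" using E.ideal_carr[OF I(1)] by - (rule co_bounded_zero, auto)
    then show ?case using E.ideal_zero[OF I(2)] by simp
  next
    case (Suc N)
    have "co p N \<in> lead I N"
      unfolding lead_def using Suc.prems by (intro CollectI bexI[of _ p]) auto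
    then have "co p N \<in> lead I' N" using l by auto
    then obtain q where q: "q \<in> I'" "\<forall>j>N. co q j = \<zero>" "co q N = co p N" by (auto simp: lead_def)
    have c: "p \<in> carrier E" "q \<in> carrier E" using Suc.prems q E.ideal_carr I by auto
    have "p \<ominus> q \<in> I'"
    proof (rule Suc.IH)
      show "p \<ominus> q \<in> I" using E.ideal_diff[OF I(1) Suc.prems(2)] q(1) I(3) by auto
      show "\<forall>k\<ge>N. co (p \<ominus> q) k = \<zero>"
      proof (intro allI impI)
        fix k assume "N \<le> k"
        then have "co p k = co q k" using Suc.prems(1) q by (cases "k = N") auto
        then show "co (p \<ominus> q) k = \<zero>" using co_carr[OF c(2)] unfolding co_diff[OF c] by (simp add: a_minus_def E.r_neg)
      qed
    qed
    then have "(p \<ominus> q) \<oplus> q \<in> I'" using E.ideal_add[OF I(2) _ q(1)] by simp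
    moreover have "(p \<ominus> q) \<oplus> q = p" using c by algebra
    ultimately show ?case by simp
  qed
qed

theorem noetherian_extension:
  assumes "noetherian_ring DR" shows "noetherian_ring E"
proof (rule E.noetherian_ringI)
  interpret N: noetherian_ring DR by fact
  fix I assume I: "ideal I E"
  obtain d where d: "\<forall>j\<ge>d. lead I j = lead I d"
    using N.ideal_seq_stable[of "lead I", OF ideal_lead[OF I] lead_Suc[OF I]] by blast
  have "\<forall>k. \<exists>A. A \<subseteq> carrier DR \<and> finite A \<and> lead I k = Idl\<^bsub>DR\<^esub> A"
    using N.finetely_gen[OF ideal_lead[OF I]] by blast
  then obtain A where A: "\<And>k. A k \<subseteq> carrier DR" "\<And>k. finite (A k)" "\<And>k. lead I k = Idl\<^bsub>DR\<^esub> (A k)" by metis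
  have AI: "A k \<subseteq> lead I k" for k using D.genideal_self[OF A(1)] A(3) by simp
  have "\<forall>k a. a \<in> A k \<longrightarrow> (\<exists>p. p \<in> I \<and> (\<forall>j>k. co p j = \<zero>) \<and> co p k = a)"
    using AI by (auto simp: lead_def)
  then obtain g where g: "\<And>k a. a \<in> A k \<Longrightarrow> g k a \<in> I \<and> (\<forall>j>k. co (g k a) j = \<zero>) \<and> co (g k a) k = a"
    by metis
  \<comment> \<open>Lifts of generators of the leading ideals up to the stabilization index
    \<open>d\<close>. Beyond \<open>d\<close> the leading ideals of \<open>I\<close> are those at
    \<open>d\<close>, and multiplication by \<open>T\<close> keeps them inside the leading ideals of
    \<open>Idl F\<close>.\<close>
  define F where "F = (\<Union>k\<le>d. g k ` A k)"
  have F: "F \<subseteq> I" "finite F" using g A(2) by (auto simp: F_def)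
  have Fc: "F \<subseteq> carrier E" using F(1) E.ideal_carr[OF I] by auto
  have iF: "ideal (Idl F) E" using E.genideal_ideal[OF Fc] .
  have le: "lead I k \<subseteq> lead (Idl F) k" if "k \<le> d" for k
  proof -
    have "A k \<subseteq> lead (Idl F) k"
    proof
      fix a assume a: "a \<in> A k"
      then have "g k a \<in> F" using that by (auto simp: F_def)
      then have "g k a \<in> Idl F" using E.genideal_self[OF Fc] by auto
      then show "a \<in> lead (Idl F) k" using g[OF a] by (auto simp: lead_def)
    qed
    then show ?thesis using D.genideal_minimal[OF ideal_lead[OF iF]] A(3) by simp
  qed
  have "lead I k \<subseteq> lead (Idl F) k" for k
  proof (cases "k \<le> d")
    case False
    then have "lead I k = lead I d" by (intro d[rule_format]) simp
    also have "\<dots> \<subseteq> lead (Idl F) d" using le by simp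
    also have "\<dots> \<subseteq> lead (Idl F) k" using False by (intro lead_mono iF) simp
    finally show ?thesis .
  qed (rule le)
  then have "I \<subseteq> Idl F"
    using subset_of_lead_subset[OF I iF E.genideal_minimal[OF I F(1)]] by simp
  then have "I = Idl F" using E.genideal_minimal[OF I F(1)] by auto
  then show "\<exists>A\<subseteq>carrier E. finite A \<and> I = Idl A" using Fc F(2) by blast
qed

subsection \<open>Primes of a polynomial extension\<close>

definition bounded :: "nat \<Rightarrow> 'a \<Rightarrow> bool" where
  "bounded M h \<longleftrightarrow> h \<in> carrier E \<and> (\<forall>j>M. co h j = \<zero>)"

text \<open>Induction on the degree bound of \<open>a\<close> along \<open>a = co a 0 + T p\<close>,
  which gives the one coefficient of a product that is needed without a convolution formula.\<close>

lemma co_mult_top: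
  assumes "bounded M a" "bounded N b"
  shows "co (a \<otimes> b) (M + N) = co a M \<otimes> co b N"
  using assms(1)
proof (induction M arbitrary: a)
  case 0
  have bc: "b \<in> carrier E" using assms(2) by (simp add: bounded_def)
  have ac: "a \<in> carrier E" using 0 by (simp add: bounded_def)
  have "a = co a 0"
  proof (rule co_eq[OF ac])
    show "co a 0 \<in> carrier E" using ac co_carr by simp
    show "co a k = co (co a 0) k" for k
      using 0 co_const_0[OF co_closed[OF ac]] co_const_Suc[OF co_closed[OF ac]] by (cases k) (auto simp: bounded_def)
  qed
  then have "a \<otimes> b = co a 0 \<otimes> b" by simp
  then show ?case using co_smult[OF co_closed[OF ac] bc] by simp
next
  case (Suc M)
  have bc: "b \<in> carrier E" using assms(2) by (simp add: bounded_def)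
  have ac: "a \<in> carrier E" using Suc.prems by (simp add: bounded_def)
  obtain p where p: "p \<in> carrier E" "a = co a 0 \<oplus> T \<otimes> p" "\<And>k. co p k = co a (Suc k)"
    using tail_co[OF ac] by blast
  have c: "co a 0 \<in> D" "co a 0 \<in> carrier E" "p \<otimes> b \<in> carrier E" "T \<otimes> (p \<otimes> b) \<in> carrier E" "co a 0 \<otimes> b \<in> carrier E"
    using co_closed[OF ac] co_carr[OF ac] p(1) bc X_closed by auto
  have IH: "co (p \<otimes> b) (M + N) = co a (Suc M) \<otimes> co b N"
    using Suc.IH[of p] p(1,3) Suc.prems by (simp add: bounded_def)
  have "a \<otimes> b = (co a 0 \<oplus> T \<otimes> p) \<otimes> b" using p(2) by simp
  also have "\<dots> = co a 0 \<otimes> b \<oplus> T \<otimes> (p \<otimes> b)" using c(2) X_closed p(1) bc by algebra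
  finally have "co (a \<otimes> b) (Suc M + N) = co (co a 0 \<otimes> b) (Suc M + N) \<oplus> co (T \<otimes> (p \<otimes> b)) (Suc M + N)"
    using co_add[OF c(5,4)] by simp
  also have "co (co a 0 \<otimes> b) (Suc M + N) = \<zero>"
    using co_smult[OF c(1) bc] assms(2) c(2) by (simp add: bounded_def)
  also have "co (T \<otimes> (p \<otimes> b)) (Suc M + N) = co a (Suc M) \<otimes> co b N"
    using co_X_Suc[OF c(3)] IH by simp
  finally show ?case using co_carr[OF ac] co_carr[OF bc] by simp
qed

text \<open>Top terms with coefficient in \<open>q\<close> vanish modulo \<open>q E\<close> and are
  discarded until the leading coefficient is outside \<open>q\<close>. The strict bound
  \<open>M < N\<close> allows the result to enter an argument by least degree.\<close>

lemma coefs_in_strip: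
  assumes q: "ideal q DR" and a: "a \<in> carrier E" "a \<notin> coefs_in q" "\<forall>j\<ge>N. co a j = \<zero>"
  shows "\<exists>M<N. \<exists>a'. bounded M a' \<and> a \<ominus> a' \<in> coefs_in q \<and> co a' M \<notin> q"
  using a
proof (induction N arbitrary: a)
  case 0
  then have "a = \<zero>" by - (rule co_bounded_zero, auto)
  then show ?case using 0(2) E.ideal_zero[OF ideal_coefs_in[OF q]] by simp
next
  case (Suc N)
  show ?case
  proof (cases "co a N \<in> q")
    case False
    have "a \<ominus> a = \<zero>" using Suc.prems(1) by algebra
    then have "a \<ominus> a \<in> coefs_in q" using E.ideal_zero[OF ideal_coefs_in[OF q]] by (simp only:)
    then show ?thesis using Suc.prems False by (intro exI[of _ N] exI[of _ a] conjI) (auto simp: bounded_def)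
  next
    case True
    \<comment> \<open>The monomial at degree \<open>N\<close>; the factor \<open>\<one>\<close>
      gives it the shape to which \<open>co_pow_mult\<close> applies.\<close>
    let ?t = "co a N \<otimes> (T [^] N \<otimes> \<one>)"
    let ?a = "a \<ominus> ?t"
    have c: "co a N \<in> D" "co a N \<in> carrier E" "T [^] N \<otimes> \<one> \<in> carrier E" "?t \<in> carrier E"
      using co_closed co_carr Suc.prems(1) X_closed by auto
    have cot: "co ?t k = (if k = N then co a N else \<zero>)" for k
    proof -
      have "co ?t k = co a N \<otimes> (if k < N then \<zero> else co \<one> (k - N))"
        unfolding co_smult[OF c(1,3)] co_pow_mult[OF E.one_closed] by (rule refl)
      moreover have "co \<one> (k - N) = (if k = N then \<one> else \<zero>)" if "\<not> k < N"
        using that co_const_0[OF D_one] co_const_Suc[OF D_one] by (cases "k - N") auto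
      ultimately show ?thesis using c(2) by auto
    qed
    have t: "?t \<in> coefs_in q" using c(4) cot True DR_ideal_zero[OF q] by (simp add: coefs_in_def)
    have ac: "?a \<in> carrier E" using Suc.prems(1) c by simp
    have n: "?a \<notin> coefs_in q"
    proof -
      have "?a \<oplus> ?t = a" using Suc.prems(1) c(4) by algebra
      then show ?thesis using E.ideal_add[OF ideal_coefs_in[OF q] _ t, of ?a] Suc.prems(2) by auto
    qed
    have "\<forall>j\<ge>N. co ?a j = \<zero>"
    proof (intro allI impI)
      fix j assume j: "N \<le> j"
      have "co ?a j = co a j \<ominus> co ?t j" by (rule co_diff[OF Suc.prems(1) c(4)])
      also have "\<dots> = \<zero>" using j cot[of j] Suc.prems(3) c(2)
        by (cases "j = N") (auto simp: a_minus_def E.r_neg)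
      finally show "co ?a j = \<zero>" .
    qed
    then obtain M a' where M: "M < N" "bounded M a'" "?a \<ominus> a' \<in> coefs_in q" "co a' M \<notin> q"
      using Suc.IH[OF ac n] by blast
    have a'c: "a' \<in> carrier E" using M(2) by (simp add: bounded_def)
    have "(?a \<ominus> a') \<oplus> ?t = a \<ominus> a'" using Suc.prems(1) a'c c(4) by algebra
    then have "a \<ominus> a' \<in> coefs_in q" using E.ideal_add[OF ideal_coefs_in[OF q] M(3) t] by simp
    then show ?thesis using M by (intro exI[of _ M] exI[of _ a'] conjI) auto
  qed
qed

lemma coefs_in_strip':
  assumes q: "ideal q DR" and a: "a \<in> carrier E" "a \<notin> coefs_in q"
  shows "\<exists>M a'. bounded M a' \<and> a \<ominus> a' \<in> coefs_in q \<and> co a' M \<notin> q"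
proof -
  obtain N where "\<forall>j\<ge>N. co a j = \<zero>" using co_fin a by blast
  then show ?thesis using coefs_in_strip[OF q a] by blast
qed

text \<open>After stripping, the leading coefficients of both factors are outside the prime
  \<open>q\<close>, hence so is their product, the leading coefficient of the product.\<close>

lemma coefs_in_mult_prime:
  assumes q: "primeideal q DR" and ab: "a \<in> carrier E" "b \<in> carrier E" "a \<otimes> b \<in> coefs_in q"
  shows "a \<in> coefs_in q \<or> b \<in> coefs_in q"
proof (rule ccontr)
  assume n: "\<not> (a \<in> coefs_in q \<or> b \<in> coefs_in q)"
  have iq: "ideal q DR" using q primeideal.axioms(1) by auto
  note I = ideal_coefs_in[OF iq]
  obtain M a' where a': "bounded M a'" "a \<ominus> a' \<in> coefs_in q" "co a' M \<notin> q"
    using coefs_in_strip'[OF iq ab(1)] n by blast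
  obtain N b' where b': "bounded N b'" "b \<ominus> b' \<in> coefs_in q" "co b' N \<notin> q"
    using coefs_in_strip'[OF iq ab(2)] n by blast
  have c: "a' \<in> carrier E" "b' \<in> carrier E" using a' b' by (auto simp: bounded_def)
  have "b \<otimes> (a \<ominus> a') \<oplus> a' \<otimes> (b \<ominus> b') \<in> coefs_in q"
    by (rule E.ideal_lin2[OF I a'(2) b'(2) ab(2) c(1)])
  also have "b \<otimes> (a \<ominus> a') \<oplus> a' \<otimes> (b \<ominus> b') = a \<otimes> b \<ominus> a' \<otimes> b'" using ab c by algebra
  finally have d: "a \<otimes> b \<ominus> a' \<otimes> b' \<in> coefs_in q" .
  have "a' \<otimes> b' \<in> coefs_in q" using E.ideal_swap_diff[OF I d] ab c by simp
  then have "co (a' \<otimes> b') (M + N) \<in> q" by (simp add: coefs_in_def)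
  then have "co a' M \<otimes> co b' N \<in> q" by (simp only: co_mult_top[OF a'(1) b'(1)])
  then show False using primeideal_mult[OF q, of "co a' M" "co b' N"] co_closed c a'(3) b'(3) by auto
qed

text \<open>Primes of \<open>E\<close> over \<open>q = P \<inter> D\<close> correspond to primes of
  a polynomial ring in one variable over the residue field of \<open>q\<close>, so modulo
  \<open>q E\<close> the prime \<open>P\<close> needs at most one generator \<open>f\<close>
  locally. A regular sequence for \<open>q\<close> stays regular in \<open>E\<close>, and
  \<open>f\<close> may be appended because \<open>q E\<close> is prime.\<close>

theorem regular_prime_extension:
  assumes N: "noetherian_ring DR" and P: "primeideal P E"
    and reg: "\<And>q. primeideal q DR \<Longrightarrow> noetherian_cring_prime.regular_prime DR q"
  shows "noetherian_cring_prime.regular_prime E P"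
proof -
  interpret NE: noetherian_cring E
    by (intro noetherian_cring.intro noetherian_extension[OF N] E.is_cring)
  interpret ND: noetherian_cring DR by (intro noetherian_cring.intro N D.is_cring)
  interpret LE: noetherian_cring_prime E P by (rule NE.prime_locale[OF P])
  define q where "q = P \<inter> D"
  have q: "primeideal q DR"
  proof (rule primeidealI)
    show "ideal q DR"
    proof (rule D.idealI_add_mult)
      show "q \<subseteq> carrier DR" by (auto simp: q_def)
      show "\<zero>\<^bsub>DR\<^esub> \<in> q" using E.ideal_zero[OF LE.P_ideal] D_zero by (simp add: q_def)
      show "x \<oplus>\<^bsub>DR\<^esub> y \<in> q" if "x \<in> q" "y \<in> q" for x y
        using that E.ideal_add[OF LE.P_ideal] D_add by (simp add: q_def)
      show "r \<otimes>\<^bsub>DR\<^esub> x \<in> q" if "r \<in> carrier DR" "x \<in> q" for r x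
        using that ideal.I_l_closed[OF LE.P_ideal] D_mult D_carr by (simp add: q_def)
    qed
    show "cring DR" by (rule D.is_cring)
    show "carrier DR \<noteq> q" using D_one LE.one_notin_P by (auto simp: q_def)
    show "a \<in> q \<or> b \<in> q" if "a \<in> carrier DR" "b \<in> carrier DR" "a \<otimes>\<^bsub>DR\<^esub> b \<in> q" for a b
      using that primeideal_mult[OF P, of a b] D_carr by (auto simp: q_def)
  qed
  interpret LD: noetherian_cring_prime DR q by (rule ND.prime_locale[OF q])
  obtain gs where g: "set gs \<subseteq> q" "LD.regular_on LD.zero_loc gs" "LD.span LD.zero_loc gs = q"
    using reg[OF q] unfolding LD.regular_prime_def by blast
  have notin: "s \<in> carrier E - P" if "s \<in> carrier DR - q" for s
    using that D_carr by (auto simp: q_def)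
  have restrict: "LD.saturated (K \<inter> D)" if K: "LE.saturated K" for K
    unfolding LD.saturated_def
  proof (intro conjI ballI impI)
    show "ideal (K \<inter> D) DR"
    proof (rule D.idealI_add_mult)
      show "\<zero>\<^bsub>DR\<^esub> \<in> K \<inter> D" using LE.saturated_zero[OF K] D_zero by simp
      show "x \<oplus>\<^bsub>DR\<^esub> y \<in> K \<inter> D" if "x \<in> K \<inter> D" "y \<in> K \<inter> D" for x y
        using that E.ideal_add[OF LE.saturated_ideal[OF K]] D_add by simp
      show "r \<otimes>\<^bsub>DR\<^esub> x \<in> K \<inter> D" if "r \<in> carrier DR" "x \<in> K \<inter> D" for r x
        using that LE.saturated_mult[OF K] D_mult D_carr by simp
    qed auto
    fix s a assume "s \<in> carrier DR - q" "a \<in> carrier DR" "s \<otimes>\<^bsub>DR\<^esub> a \<in> K \<inter> D"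
    then show "a \<in> K \<inter> D" using LE.saturatedD[OF K _ notin[of s], of a] D_carr by simp
  qed
  \<comment> \<open>Spans of elements of \<open>D\<close> are computed coefficientwise up to
    denominators, as \<open>E\<close> is flat over \<open>D\<close>. One inclusion holds because
    \<open>coefs_in\<close> of the span is an ideal containing \<open>xs\<close>, the other because
    saturated ideals of \<open>E\<close> contract to saturated ideals of \<open>D\<close>.\<close>
  have span: "LE.span LE.zero_loc xs = LE.localized (coefs_in (LD.span LD.zero_loc xs))" if xs: "set xs \<subseteq> D" for xs
  proof
    have xc: "set xs \<subseteq> carrier E" "set xs \<subseteq> carrier DR" using xs D_carr by auto
    let ?q = "LD.span LD.zero_loc xs"
    have sq: "LD.saturated ?q" using LD.saturated_span[OF LD.saturated_zero_loc xc(2)] .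
    have iq: "ideal (coefs_in ?q) E" by (rule ideal_coefs_in[OF LD.saturated_ideal[OF sq]])
    have "set xs \<subseteq> coefs_in ?q"
    proof
      fix x assume x: "x \<in> set xs"
      then have "x \<in> ?q" using LD.span_mem[OF LD.saturated_zero_loc xc(2)] by auto
      moreover have "co x k = (if k = 0 then x else \<zero>)" for k
        using x xs co_const_0[of x] co_const_Suc[of x] by (cases k) auto
      ultimately show "x \<in> coefs_in ?q"
        using x xc DR_ideal_zero[OF LD.saturated_ideal[OF sq]] by (auto simp: coefs_in_def)
    qed
    then show "LE.span LE.zero_loc xs \<subseteq> LE.localized (coefs_in ?q)"
      using LE.span_least[OF LE.saturated_localized[OF iq] LE.zero_loc_least[OF LE.saturated_localized[OF iq]]]
        LE.localized_subset[OF iq] by blast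
    have sE: "LE.saturated (LE.span LE.zero_loc xs)" using LE.saturated_span[OF LE.saturated_zero_loc xc(1)] .
    have "?q \<subseteq> LE.span LE.zero_loc xs \<inter> D"
      using LD.span_least[OF restrict[OF sE] LD.zero_loc_least[OF restrict[OF sE]]]
        LE.span_mem[OF LE.saturated_zero_loc xc(1)] xs by blast
    then have "coefs_in ?q \<subseteq> LE.span LE.zero_loc xs"
      using mem_ideal_of_co[OF LE.saturated_ideal[OF sE]] by (auto simp: coefs_in_def)
    then show "LE.localized (coefs_in ?q) \<subseteq> LE.span LE.zero_loc xs" by (rule LE.localized_least[OF _ sE])
  qed
  have gD: "set gs \<subseteq> D" "set gs \<subseteq> P" using g(1) by (auto simp: q_def)
  have rg: "LE.regular_on LE.zero_loc gs"
    unfolding LE.regular_on_def nzd_def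
  proof (intro allI impI ballI)
    fix i a assume i: "i < length gs" "a \<in> carrier E" "a \<otimes> gs ! i \<in> LE.span LE.zero_loc (take i gs)"
    have tD: "set (take i gs) \<subseteq> D" using gD(1) set_take_subset by fastforce
    let ?q = "LD.span LD.zero_loc (take i gs)"
    have gi: "gs ! i \<in> D" "gs ! i \<in> carrier E" using gD(1) i(1) D_sub nth_mem[OF i(1)] by blast+
    obtain s where s: "s \<in> carrier E - P" "s \<otimes> (a \<otimes> gs ! i) \<in> coefs_in ?q"
      using i(3) unfolding span[OF tD] by (rule LE.localizedE)
    have sa: "s \<otimes> a \<in> carrier E" using s i by simp
    have "s \<otimes> (a \<otimes> gs ! i) = gs ! i \<otimes> (s \<otimes> a)" using s i gi by (simp add: E.m_ac)
    then have "gs ! i \<otimes> co (s \<otimes> a) k \<in> ?q" for k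
      using s(2) co_smult[OF gi(1) sa] by (simp add: coefs_in_def)
    moreover have "gs ! i \<otimes> co (s \<otimes> a) k = co (s \<otimes> a) k \<otimes>\<^bsub>DR\<^esub> gs ! i" for k
      using E.m_comm[OF gi(2) co_carr[OF sa]] by simp
    moreover have "nzd DR ?q (gs ! i)" using g(2) i(1) unfolding LD.regular_on_def by blast
    ultimately have "co (s \<otimes> a) k \<in> ?q" for k
      using nzdD[of DR ?q "gs ! i" "co (s \<otimes> a) k"] co_closed[OF sa] by simp
    then have "s \<otimes> a \<in> coefs_in ?q" using sa by (simp add: coefs_in_def)
    then show "a \<in> LE.span LE.zero_loc (take i gs)" unfolding span[OF tD] by (rule LE.localizedI[OF i(2) s(1)])
  qed
  let ?C = "coefs_in q"
  have iq: "ideal q DR" using q primeideal.axioms(1) by auto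
  note iC = ideal_coefs_in[OF iq]
  have CP: "?C \<subseteq> P" using mem_ideal_of_co[OF LE.P_ideal] by (auto simp: coefs_in_def q_def)
  have sC: "LE.saturated ?C"
    unfolding LE.saturated_def using iC coefs_in_mult_prime[OF q] CP by blast
  have sg: "LE.span LE.zero_loc gs = ?C"
    unfolding span[OF gD(1)] g(3) using LE.localized_subset[OF iC] LE.localized_least[OF subset_refl sC] by auto
  show ?thesis
  proof (cases "P = ?C")
    case True
    then show ?thesis unfolding LE.regular_prime_def using gD(2) rg sg by blast
  next
    case False
    \<comment> \<open>The degrees of members of \<open>P\<close> with leading coefficient outside
      \<open>q\<close>. The least one belongs to a generator of \<open>P\<close> over the residue
      field of \<open>q\<close>.\<close>
    let ?Z = "\<lambda>M. \<exists>f\<in>P. bounded M f \<and> co f M \<notin> q"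
    have strip: "\<exists>M<N. ?Z M"
      if h: "h \<in> P" "h \<notin> ?C" "\<forall>j\<ge>N. co h j = \<zero>" for h N
    proof -
      have hc: "h \<in> carrier E" using h LE.P_carr by simp
      obtain M h' where M: "M < N" "bounded M h'" "h \<ominus> h' \<in> ?C" "co h' M \<notin> q"
        using coefs_in_strip[OF iq hc h(2,3)] by blast
      have h'c: "h' \<in> carrier E" using M(2) by (simp add: bounded_def)
      have "h \<ominus> h' \<in> P" using M(3) CP by auto
      then have "h' \<in> P" using E.ideal_swap_diff[OF LE.P_ideal _ hc h'c] h(1) by simp
      then show ?thesis using M by blast
    qed
    obtain h where h: "h \<in> P" "h \<notin> ?C" using False CP by auto
    obtain N0 where "\<forall>j\<ge>N0. co h j = \<zero>" using co_fin[OF LE.P_carr[OF h(1)]] by blast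
    then obtain M0 where M0: "?Z M0" using strip[OF h] by blast
    define N where "N = (LEAST M. ?Z M)"
    have "?Z N" unfolding N_def using M0 by (rule LeastI)
    then obtain f where f: "f \<in> P" "bounded N f" "co f N \<notin> q" by blast
    have Nmin: "N \<le> M" if "?Z M" for M unfolding N_def using that by (rule Least_le)
    have fc: "f \<in> carrier E" using f(1) LE.P_carr by simp
    have fC: "f \<notin> ?C" using f(3) by (auto simp: coefs_in_def)
    let ?c = "co f N"
    have c: "?c \<in> D" "?c \<in> carrier E" "?c \<notin> P" using co_closed[OF fc] co_carr[OF fc] f(3) by (auto simp: q_def)
    let ?E = "LE.ext ?C f"
    have sE: "LE.saturated ?E" using LE.saturated_ext[OF sC fc] .
    have mem: "h \<in> ?E" if "h \<in> P" "\<forall>j\<ge>M. co h j = \<zero>" for h M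
      using that
    proof (induction M arbitrary: h)
      case 0
      then have "h = \<zero>" using LE.P_carr by - (rule co_bounded_zero, auto)
      then show ?case using LE.saturated_zero[OF sE] by simp
    next
      case (Suc M)
      have hc: "h \<in> carrier E" using Suc.prems LE.P_carr by simp
      show ?case
      proof (cases "h \<in> ?C")
        case True
        then show ?thesis using LE.ext_subset[OF sC fc] by auto
      next
        case False
        obtain M' where "M' < Suc M" "?Z M'" using strip[OF Suc.prems(1) False Suc.prems(2)] by blast
        then have NM: "N \<le> M" using Nmin[of M'] by simp
        let ?b = "co h M"
        \<comment> \<open>Pseudo-division: subtracting \<open>co h M\<close> times this multiple of
          \<open>f\<close> from \<open>h\<close>, scaled by the leading coefficient of
          \<open>f\<close>, lowers the degree bound. That leading coefficient lies outside
          \<open>P\<close>, so it can be cancelled afterwards.\<close>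
        let ?g = "T [^] (M - N) \<otimes> f"
        have b: "?b \<in> D" "?b \<in> carrier E" using co_closed[OF hc] co_carr[OF hc] by auto
        have gc: "?g \<in> carrier E" using X_closed fc by simp
        have gP: "?g \<in> P" using ideal.I_l_closed[OF LE.P_ideal f(1)] X_closed by simp
        have cc: "?c \<otimes> h \<in> carrier E" "?b \<otimes> ?g \<in> carrier E" using c b hc gc by auto
        let ?h = "?c \<otimes> h \<ominus> ?b \<otimes> ?g"
        have "?h \<in> ?E"
        proof (rule Suc.IH)
          show "?h \<in> P" by (rule E.ideal_lin[OF LE.P_ideal Suc.prems(1) gP c(2) b(2)])
          show "\<forall>j\<ge>M. co ?h j = \<zero>"
          proof (intro allI impI)
            fix j assume j: "M \<le> j"
            have e: "co ?h j = ?c \<otimes> co h j \<ominus> ?b \<otimes> co ?g j"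
              unfolding co_diff[OF cc] co_smult[OF c(1) hc] co_smult[OF b(1) gc] by (rule refl)
            have g: "co ?g j = co f (j - (M - N))" using co_pow_mult[OF fc, of "M - N" j] j by (simp split: if_splits)
            show "co ?h j = \<zero>"
            proof (cases "j = M")
              case True
              then have "co ?g j = ?c" using g NM by simp
              then have "co ?h j = ?c \<otimes> ?b \<ominus> ?b \<otimes> ?c" using e True by simp
              also have "\<dots> = \<zero>" using c(2) b(2) by algebra
              finally show ?thesis .
            next
              case False
              then have "co ?g j = \<zero>" "co h j = \<zero>" using g f(2) NM j Suc.prems(2) by (auto simp: bounded_def)
              then have "co ?h j = ?c \<otimes> \<zero> \<ominus> ?b \<otimes> \<zero>" using e by simp
              also have "\<dots> = \<zero>" using c(2) b(2) by algebra
              finally show ?thesis .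
            qed
          qed
        qed
        moreover have "?b \<otimes> ?g \<in> ?E"
          using LE.saturated_mult[OF sE LE.saturated_mult[OF sE LE.ext_mem[OF sC fc]] b(2)] X_closed by simp
        ultimately have "?c \<otimes> h \<in> ?E" using E.ideal_swap_diff[OF LE.saturated_ideal[OF sE] _ cc] by simp
        then show ?thesis using LE.saturatedD[OF sE, of ?c h] c hc by simp
      qed
    qed
    have "?E = P"
    proof
      show "?E \<subseteq> P" by (rule LE.ext_least[OF LE.saturated_P CP f(1)])
      show "P \<subseteq> ?E"
      proof
        fix h assume h: "h \<in> P"
        obtain M where "\<forall>j\<ge>M. co h j = \<zero>" using co_fin[OF LE.P_carr[OF h]] by blast
        then show "h \<in> ?E" using mem[OF h] by simp
      qed
    qed
    moreover have "nzd E ?C f"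
      using coefs_in_mult_prime[OF q _ fc] fC unfolding nzd_def by blast
    ultimately show ?thesis
      unfolding LE.regular_prime_def using gD(2) f(1) rg sg
      by (intro exI[of _ "gs @ [f]"]) (simp add: LE.regular_on_snoc)
  qed
qed

end

section \<open>The ring of polynomials in finitely many variables\<close>

lemma finite_subseteq_mset: "finite {k. k \<subseteq># (m :: 'c multiset)}"
proof (induction m)
  case (add x m)
  have "{k. k \<subseteq># add_mset x m} \<subseteq> {k. k \<subseteq># m} \<union> add_mset x ` {k. k \<subseteq># m}"
  proof
    fix k assume k: "k \<in> {k. k \<subseteq># add_mset x m}"
    show "k \<in> {k. k \<subseteq># m} \<union> add_mset x ` {k. k \<subseteq># m}"
    proof (cases "x \<in># k")
      case True
      then obtain k' where "k = add_mset x k'" by (metis mset_add)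
      then show ?thesis using k by simp
    next
      case False
      have "k \<subseteq># m"
      proof (rule mset_subset_eqI)
        show "count k y \<le> count m y" for y
          using mset_subset_eq_count[of k "add_mset x m" y] k False by (cases "y = x") (auto simp: not_in_iff)
      qed
      then show ?thesis by simp
    qed
  qed
  then show ?case using add finite_subset by blast
qed simp

lemma (in abelian_monoid) finsum_Sigma:
  assumes "finite A" "\<And>x. x \<in> A \<Longrightarrow> finite (B x)" "\<And>x y. x \<in> A \<Longrightarrow> y \<in> B x \<Longrightarrow> f x y \<in> carrier G"
  shows "(\<Oplus>x\<in>A. \<Oplus>y\<in>B x. f x y) = (\<Oplus>z\<in>Sigma A B. f (fst z) (snd z))"
  using assms
proof (induction A)
  case (insert a A)
  have e: "Sigma (insert a A) B = (\<lambda>y. (a, y)) ` B a \<union> Sigma A B" by auto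
  have fin: "finite ((\<lambda>y. (a, y)) ` B a)" "finite (Sigma A B)" using insert by auto
  have disj: "((\<lambda>y. (a, y)) ` B a) \<inter> Sigma A B = {}" using insert by auto
  have "(\<Oplus>z\<in>Sigma (insert a A) B. f (fst z) (snd z)) =
    (\<Oplus>z\<in>(\<lambda>y. (a, y)) ` B a. f (fst z) (snd z)) \<oplus> (\<Oplus>z\<in>Sigma A B. f (fst z) (snd z))"
    unfolding e by (rule finsum_Un_disjoint[OF fin disj]) (use insert.prems in auto)
  also have "(\<Oplus>z\<in>(\<lambda>y. (a, y)) ` B a. f (fst z) (snd z)) = (\<Oplus>y\<in>B a. f a y)"
    by (subst finsum_reindex) (use insert.prems in \<open>auto simp: inj_on_def\<close>)
  also have "(\<Oplus>z\<in>Sigma A B. f (fst z) (snd z)) = (\<Oplus>x\<in>A. \<Oplus>y\<in>B x. f x y)"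
    using insert by simp
  also have "(\<Oplus>y\<in>B a. f a y) \<oplus> (\<Oplus>x\<in>A. \<Oplus>y\<in>B x. f x y) = (\<Oplus>x\<in>insert a A. \<Oplus>y\<in>B x. f x y)"
    by (subst finsum_insert) (use insert in \<open>auto intro!: finsum_closed\<close>)
  finally show ?case by simp
qed simp

section \<open>Convolution of coefficient functions on multisets\<close>

context cring begin

definition conv :: "('c multiset \<Rightarrow> 'a) \<Rightarrow> ('c multiset \<Rightarrow> 'a) \<Rightarrow> 'c multiset \<Rightarrow> 'a" where
  "conv p q m = (\<Oplus>k\<in>{k. k \<subseteq># m}. p k \<otimes> q (m - k))"

definition monomial :: "'a \<Rightarrow> 'c multiset \<Rightarrow> 'c multiset \<Rightarrow> 'a" where
  "monomial c k = (\<lambda>m. if m = k then c else \<zero>)"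

lemma indexed_const_mono: "indexed_const c = monomial c {#}"
  by (simp add: indexed_const_def monomial_def)

lemma conv_closed: "(\<And>m. p m \<in> carrier R) \<Longrightarrow> (\<And>m. q m \<in> carrier R) \<Longrightarrow> conv p q m \<in> carrier R"
  unfolding conv_def by (rule finsum_closed) auto

lemma conv_mono:
  assumes "c \<in> carrier R" "\<And>m. p m \<in> carrier R"
  shows "conv (monomial c k0) p m = (if k0 \<subseteq># m then c \<otimes> p (m - k0) else \<zero>)"
proof -
  have "conv (monomial c k0) p m = (\<Oplus>k\<in>{k. k \<subseteq># m}. if k0 = k then c \<otimes> p (m - k) else \<zero>)"
    unfolding conv_def using assms by (intro finsum_cong') (auto simp: monomial_def)
  also have "\<dots> = (if k0 \<subseteq># m then c \<otimes> p (m - k0) else \<zero>)"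
  proof (cases "k0 \<subseteq># m")
    case True
    then show ?thesis
      using finsum_singleton[of k0 "{k. k \<subseteq># m}" "\<lambda>k. c \<otimes> p (m - k)"] assms finite_subseteq_mset[of m] by simp
  next
    case False
    have "(\<Oplus>k\<in>{k. k \<subseteq># m}. if k0 = k then c \<otimes> p (m - k) else \<zero>) = (\<Oplus>k\<in>{k. k \<subseteq># m}. \<zero>)"
      using False by (intro finsum_cong') auto
    then show ?thesis using False by simp
  qed
  finally show ?thesis .
qed

lemma conv_commute:
  assumes "\<And>m. p m \<in> carrier R" "\<And>m. q m \<in> carrier R"
  shows "conv p q m = conv q p m"
proof -
  let ?S = "{k. k \<subseteq># m}"
  have im: "(\<lambda>k. m - k) ` ?S = ?S"
  proof
    show "?S \<subseteq> (\<lambda>k. m - k) ` ?S"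
    proof
      fix k assume "k \<in> ?S"
      then have "k = m - (m - k)" "m - k \<in> ?S" by (auto simp: multiset_diff_union_assoc subset_mset.diff_diff_right)
      then show "k \<in> (\<lambda>k. m - k) ` ?S" by blast
    qed
  qed auto
  have inj: "inj_on (\<lambda>k. m - k) ?S"
    by (rule inj_on_inverseI[of _ "\<lambda>k. m - k"]) (auto simp: subset_mset.diff_diff_right)
  have "conv p q m = (\<Oplus>k\<in>(\<lambda>k. m - k) ` ?S. p k \<otimes> q (m - k))" unfolding im conv_def ..
  also have "\<dots> = (\<Oplus>k\<in>?S. p (m - k) \<otimes> q (m - (m - k)))"
    by (rule finsum_reindex[OF _ inj]) (use assms in auto)
  also have "\<dots> = conv q p m" unfolding conv_def
    using assms by (intro finsum_cong') (auto simp: subset_mset.diff_diff_right m_comm)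
  finally show ?thesis .
qed

text \<open>Both sides are sums over the decompositions of \<open>m\<close> into three parts: pairs
  \<open>j \<subseteq># k \<subseteq># m\<close> are reindexed by \<open>(j, l)\<close> with
  \<open>k = j + l\<close>.\<close>

lemma conv_assoc:
  assumes c: "\<And>m. p m \<in> carrier R" "\<And>m. q m \<in> carrier R" "\<And>m. r m \<in> carrier R"
  shows "conv (conv p q) r m = conv p (conv q r) m"
proof -
  let ?S = "\<lambda>m. {k. k \<subseteq># m}"
  let ?L = "Sigma (?S m) ?S" and ?R = "Sigma (?S m) (\<lambda>j. ?S (m - j))"
  let ?h = "\<lambda>z. (fst z + snd z, fst z)"
  have "conv (conv p q) r m = (\<Oplus>k\<in>?S m. \<Oplus>j\<in>?S k. p j \<otimes> q (k - j) \<otimes> r (m - k))"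
    unfolding conv_def using c
    by (intro finsum_cong') (auto intro!: finsum_ldistr finite_subseteq_mset finsum_closed)
  also have "\<dots> = (\<Oplus>z\<in>?L. p (snd z) \<otimes> q (fst z - snd z) \<otimes> r (m - fst z))"
    using c by (intro finsum_Sigma finite_subseteq_mset) auto
  also have "?L = ?h ` ?R"
  proof
    show "?L \<subseteq> ?h ` ?R"
    proof
      fix z assume "z \<in> ?L"
      then obtain k j where z: "z = (k, j)" "k \<subseteq># m" "j \<subseteq># k" by auto
      then obtain l l' where "k = j + l" "m = j + l + l'" by (metis mset_subset_eq_exists_conv)
      then show "z \<in> ?h ` ?R" using z(1) by (intro image_eqI[of _ _ "(j, l)"]) auto
    qed
    show "?h ` ?R \<subseteq> ?L"
      by (auto simp: subset_mset.le_diff_conv2 add.commute)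
  qed
  also have "(\<Oplus>z\<in>?h ` ?R. p (snd z) \<otimes> q (fst z - snd z) \<otimes> r (m - fst z))
     = (\<Oplus>z\<in>?R. p (snd (?h z)) \<otimes> q (fst (?h z) - snd (?h z)) \<otimes> r (m - fst (?h z)))"
    by (rule finsum_reindex) (use c in \<open>auto simp: inj_on_def\<close>)
  also have "\<dots> = (\<Oplus>z\<in>?R. p (fst z) \<otimes> (q (snd z) \<otimes> r (m - fst z - snd z)))"
    using c by (intro finsum_cong') (auto simp: m_assoc)
  also have "\<dots> = (\<Oplus>j\<in>?S m. \<Oplus>l\<in>?S (m - j). p j \<otimes> (q l \<otimes> r (m - j - l)))"
    using c by (intro finsum_Sigma[symmetric] finite_subseteq_mset) auto
  also have "\<dots> = conv p (conv q r) m"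
    unfolding conv_def using c
    by (intro finsum_cong') (auto intro!: finsum_rdistr[symmetric] finite_subseteq_mset finsum_closed)
  finally show ?thesis .
qed

lemma conv_distrib:
  assumes c: "\<And>m. p m \<in> carrier R" "\<And>m. q m \<in> carrier R" "\<And>m. r m \<in> carrier R"
  shows "conv (\<lambda>m. p m \<oplus> q m) r m = conv p r m \<oplus> conv q r m"
proof -
  have "conv (\<lambda>m. p m \<oplus> q m) r m = (\<Oplus>k\<in>{k. k \<subseteq># m}. p k \<otimes> r (m - k) \<oplus> q k \<otimes> r (m - k))"
    unfolding conv_def using c by (intro finsum_cong') (auto simp: l_distr)
  also have "\<dots> = conv p r m \<oplus> conv q r m"
    unfolding conv_def using c by (intro finsum_addf) auto
  finally show ?thesis .
qed

section \<open>Polynomials in finitely many variables as a commutative ring\<close>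

lemma mpoly_carrier:
  "p \<in> carrier (mpoly_ring R n) \<longleftrightarrow> (\<forall>m. p m \<in> carrier R) \<and> finite {m. p m \<noteq> \<zero>} \<and>
     (\<forall>m. p m \<noteq> \<zero> \<longrightarrow> set_mset m \<subseteq> {..<n})"
  by (simp add: mpoly_ring_def)

lemma mpoly_simps:
  "monoid.mult (mpoly_ring R n) = conv" "add (mpoly_ring R n) = (\<lambda>p q m. p m \<oplus> q m)"
  "monoid.one (mpoly_ring R n) = monomial \<one> {#}" "ring.zero (mpoly_ring R n) = (\<lambda>m. \<zero>)"
  by (auto simp: mpoly_ring_def conv_def fun_eq_iff indexed_const_def monomial_def)

lemma mono_carrier: "c \<in> carrier R \<Longrightarrow> set_mset k \<subseteq> {..<n} \<Longrightarrow> monomial c k \<in> carrier (mpoly_ring R n)"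
  by (auto simp: mpoly_carrier monomial_def)

lemma conv_nonzero:
  assumes "conv p q m \<noteq> \<zero>" "\<And>m. p m \<in> carrier R" "\<And>m. q m \<in> carrier R"
  shows "\<exists>k. k \<subseteq># m \<and> p k \<noteq> \<zero> \<and> q (m - k) \<noteq> \<zero>"
proof (rule ccontr)
  assume "\<nexists>k. k \<subseteq># m \<and> p k \<noteq> \<zero> \<and> q (m - k) \<noteq> \<zero>"
  then have z: "p k \<otimes> q (m - k) = \<zero>" if "k \<subseteq># m" for k
    using that assms(2,3) by (cases "p k = \<zero>") auto
  have "conv p q m = (\<Oplus>k\<in>{k. k \<subseteq># m}. \<zero>)" unfolding conv_def by (intro finsum_cong') (auto simp: z)
  then show False using assms(1) by simp
qed

lemma conv_carrier:
  assumes p: "p \<in> carrier (mpoly_ring R n)" and q: "q \<in> carrier (mpoly_ring R n)"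
  shows "conv p q \<in> carrier (mpoly_ring R n)"
proof -
  have c: "\<And>m. p m \<in> carrier R" "\<And>m. q m \<in> carrier R" using p q by (auto simp: mpoly_carrier)
  have ex: "\<exists>k l. m = k + l \<and> p k \<noteq> \<zero> \<and> q l \<noteq> \<zero>" if "conv p q m \<noteq> \<zero>" for m
    using conv_nonzero[OF that c] by (metis subset_mset.add_diff_inverse)
  have "{m. conv p q m \<noteq> \<zero>} \<subseteq> (\<lambda>(k, l). k + l) ` ({m. p m \<noteq> \<zero>} \<times> {m. q m \<noteq> \<zero>})"
    using ex by fastforce
  then have "finite {m. conv p q m \<noteq> \<zero>}"
    by (rule finite_subset) (use p q in \<open>simp add: mpoly_carrier\<close>)
  moreover have "set_mset m \<subseteq> {..<n}" if nz: "conv p q m \<noteq> \<zero>" for m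
  proof -
    obtain k l where "m = k + l" "p k \<noteq> \<zero>" "q l \<noteq> \<zero>" using ex[OF nz] by blast
    then show ?thesis using p q by (auto simp: mpoly_carrier)
  qed
  ultimately show ?thesis using conv_closed[of p q, OF c] by (auto simp: mpoly_carrier)
qed

lemma cring_mpoly_ring: "cring (mpoly_ring R n)"
proof (rule cringI)
  let ?E = "mpoly_ring R n"
  have c: "\<And>p m. p \<in> carrier ?E \<Longrightarrow> p m \<in> carrier R" by (simp add: mpoly_carrier)
  show "abelian_group ?E"
  proof (rule abelian_groupI)
    fix p q assume p: "p \<in> carrier ?E" "q \<in> carrier ?E"
    have "finite {m. p m \<oplus> q m \<noteq> \<zero>}"
      by (rule finite_subset[of _ "{m. p m \<noteq> \<zero>} \<union> {m. q m \<noteq> \<zero>}"]) (use p in \<open>auto simp: mpoly_carrier\<close>)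
    moreover have "set_mset m \<subseteq> {..<n}" if "p m \<oplus> q m \<noteq> \<zero>" for m
      using that p by (cases "p m = \<zero>") (auto simp: mpoly_carrier)
    ultimately show "p \<oplus>\<^bsub>?E\<^esub> q \<in> carrier ?E" using p by (simp add: mpoly_carrier mpoly_simps)
    show "p \<oplus>\<^bsub>?E\<^esub> q = q \<oplus>\<^bsub>?E\<^esub> p" using p c by (simp add: mpoly_simps a_comm)
  next
    show "\<zero>\<^bsub>?E\<^esub> \<in> carrier ?E" by (simp add: mpoly_carrier mpoly_simps)
  next
    fix p assume p: "p \<in> carrier ?E"
    then show "\<zero>\<^bsub>?E\<^esub> \<oplus>\<^bsub>?E\<^esub> p = p" using c by (simp add: mpoly_simps)
    have "(\<lambda>m. \<ominus> p m) \<in> carrier ?E"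
    proof -
      have "{m. \<ominus> p m \<noteq> \<zero>} = {m. p m \<noteq> \<zero>}" using c[OF p] by auto
      then show ?thesis using p by (auto simp: mpoly_carrier)
    qed
    then show "\<exists>q\<in>carrier ?E. q \<oplus>\<^bsub>?E\<^esub> p = \<zero>\<^bsub>?E\<^esub>"
      using c[OF p] by (intro bexI[of _ "\<lambda>m. \<ominus> p m"]) (auto simp: mpoly_simps l_neg)
  qed (use c in \<open>simp add: mpoly_simps a_assoc\<close>)
  show "comm_monoid ?E"
  proof (rule comm_monoidI)
    fix p q assume p: "p \<in> carrier ?E" "q \<in> carrier ?E"
    show "p \<otimes>\<^bsub>?E\<^esub> q \<in> carrier ?E" using p conv_carrier by (simp add: mpoly_simps)
    show "p \<otimes>\<^bsub>?E\<^esub> q = q \<otimes>\<^bsub>?E\<^esub> p" using conv_commute[of p q, OF c[OF p(1)] c[OF p(2)]] by (simp add: mpoly_simps fun_eq_iff)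
  next
    show "\<one>\<^bsub>?E\<^esub> \<in> carrier ?E" using mono_carrier[OF one_closed] by (simp add: mpoly_simps)
  next
    fix p assume p: "p \<in> carrier ?E"
    show "\<one>\<^bsub>?E\<^esub> \<otimes>\<^bsub>?E\<^esub> p = p" using conv_mono[OF one_closed, of p "{#}"] c[OF p] by (simp add: mpoly_simps fun_eq_iff)
  next
    fix p q r assume p: "p \<in> carrier ?E" "q \<in> carrier ?E" "r \<in> carrier ?E"
    show "p \<otimes>\<^bsub>?E\<^esub> q \<otimes>\<^bsub>?E\<^esub> r = p \<otimes>\<^bsub>?E\<^esub> (q \<otimes>\<^bsub>?E\<^esub> r)"
      using conv_assoc[of p q r, OF c[OF p(1)] c[OF p(2)] c[OF p(3)]] by (simp add: mpoly_simps fun_eq_iff)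
  qed
  fix p q r assume p: "p \<in> carrier ?E" "q \<in> carrier ?E" "r \<in> carrier ?E"
  show "(p \<oplus>\<^bsub>?E\<^esub> q) \<otimes>\<^bsub>?E\<^esub> r = p \<otimes>\<^bsub>?E\<^esub> r \<oplus>\<^bsub>?E\<^esub> q \<otimes>\<^bsub>?E\<^esub> r"
    using conv_distrib[of p q r, OF c[OF p(1)] c[OF p(2)] c[OF p(3)]] by (simp add: mpoly_simps fun_eq_iff)
qed

text \<open>The coefficient of the \<open>k\<close>-th power of the variable \<open>v\<close>, as a
  polynomial in the other variables. It is set to zero on monomials containing \<open>v\<close>, so
  that for the last variable it lies in the ring with one variable less.\<close>

definition var_coeff :: "'c \<Rightarrow> ('c multiset \<Rightarrow> 'a) \<Rightarrow> nat \<Rightarrow> 'c multiset \<Rightarrow> 'a" where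
  "var_coeff v p k = (\<lambda>m. if v \<in># m then \<zero> else p (m + replicate_mset k v))"

text \<open>The operations of \<open>mpoly_ring R n\<close> do not depend on \<open>n\<close>, only
  the carrier does. So the smaller ring is literally the record that \<open>poly_extension\<close>
  works with.\<close>

lemma mpoly_ring_restrict:
  "(mpoly_ring R (Suc n))\<lparr>carrier := carrier (mpoly_ring R n)\<rparr> = mpoly_ring R n"
  by (simp add: mpoly_ring_def)

lemma var_coeff_carrier:
  assumes p: "p \<in> carrier (mpoly_ring R (Suc n))"
  shows "var_coeff n p k \<in> carrier (mpoly_ring R n)"
  unfolding mpoly_carrier
proof (intro conjI allI impI)
  show "var_coeff n p k m \<in> carrier R" for m using p by (auto simp: var_coeff_def mpoly_carrier)
  have "{m. var_coeff n p k m \<noteq> \<zero>} \<subseteq> (\<lambda>m. m - replicate_mset k n) ` {m. p m \<noteq> \<zero>}"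
  proof
    fix m assume "m \<in> {m. var_coeff n p k m \<noteq> \<zero>}"
    then have "m + replicate_mset k n \<in> {m. p m \<noteq> \<zero>}" by (auto simp: var_coeff_def split: if_splits)
    then show "m \<in> (\<lambda>m. m - replicate_mset k n) ` {m. p m \<noteq> \<zero>}" by force
  qed
  then show "finite {m. var_coeff n p k m \<noteq> \<zero>}" using p finite_subset by (auto simp: mpoly_carrier)
  fix m assume m: "var_coeff n p k m \<noteq> \<zero>"
  then have "n \<notin># m" "p (m + replicate_mset k n) \<noteq> \<zero>" by (auto simp: var_coeff_def split: if_splits)
  then have "set_mset (m + replicate_mset k n) \<subseteq> {..<Suc n}" using p unfolding mpoly_carrier by blast
  then show "set_mset m \<subseteq> {..<n}" using \<open>n \<notin># m\<close> by (auto simp: less_Suc_eq)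
qed

lemma var_coeff_conv:
  assumes d: "d \<in> carrier (mpoly_ring R n)" and p: "\<And>m. p m \<in> carrier R"
  shows "var_coeff n (conv d p) k m = conv d (var_coeff n p k) m"
proof -
  have dc: "\<And>m. d m \<in> carrier R" and dn: "\<And>m. n \<in># m \<Longrightarrow> d m = \<zero>" using d by (auto simp: mpoly_carrier)
  have vc: "\<And>m. var_coeff n p k m \<in> carrier R" using p by (simp add: var_coeff_def)
  show ?thesis
  proof (cases "n \<in># m")
    case True
    have "conv d (var_coeff n p k) m = \<zero>"
    proof (rule ccontr)
      assume "conv d (var_coeff n p k) m \<noteq> \<zero>"
      then obtain j where j: "j \<subseteq># m" "d j \<noteq> \<zero>" "var_coeff n p k (m - j) \<noteq> \<zero>"
        using conv_nonzero[of d "var_coeff n p k" m, OF _ dc vc] by blast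
      have "n \<notin># j" "n \<notin># m - j" using j dn by (auto simp: var_coeff_def split: if_splits)
      then have "n \<notin># j + (m - j)" by simp
      then show False using True j(1) by simp
    qed
    then show ?thesis using True by (simp add: var_coeff_def)
  next
    case False
    let ?r = "replicate_mset k n"
    \<comment> \<open>The index set grows from the submultisets of \<open>m\<close> to those of
      \<open>m + ?r\<close>; the additional ones contain \<open>n\<close>, and \<open>d\<close>
      vanishes there.\<close>
    have "conv d (var_coeff n p k) m = conv d p (m + ?r)"
      unfolding conv_def
    proof (rule add.finprod_mono_neutral_cong_left)
      show "finite {j. j \<subseteq># m + ?r}" by (rule finite_subseteq_mset)
      show "{j. j \<subseteq># m} \<subseteq> {j. j \<subseteq># m + ?r}" using subset_mset.add_increasing2 by auto
      show "d j \<otimes> p (m + ?r - j) = \<zero>" if j: "j \<in> {j. j \<subseteq># m + ?r} - {j. j \<subseteq># m}" for j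
      proof -
        have "n \<in># j"
        proof (rule ccontr)
          assume "n \<notin># j"
          then have "count j x \<le> count m x" for x
            using j mset_subset_eq_count[of j "m + ?r" x] by (cases "x = n") (auto simp: not_in_iff)
          then have "j \<subseteq># m" by (rule mset_subset_eqI)
          then show False using j by simp
        qed
        then show ?thesis using dn p by simp
      qed
      show "d j \<otimes> var_coeff n p k (m - j) = d j \<otimes> p (m + ?r - j)" if "j \<in> {j. j \<subseteq># m}" for j
        using that False by (auto simp: var_coeff_def dest: in_diffD)
    qed (use dc p in auto)
    then show ?thesis using False by (simp add: var_coeff_def)
  qed
qed

lemma poly_extension_mpoly_ring:
  "poly_extension (mpoly_ring R (Suc n)) (carrier (mpoly_ring R n)) (monomial \<one> {#n#}) (var_coeff n)"
proof -
  let ?E = "mpoly_ring R (Suc n)" and ?D = "carrier (mpoly_ring R n)"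
  have c: "\<And>p m. p \<in> carrier ?E \<Longrightarrow> p m \<in> carrier R" by (simp add: mpoly_carrier)
  have cd: "\<And>p m. p \<in> ?D \<Longrightarrow> p m \<in> carrier R" by (simp add: mpoly_carrier)
  have dn: "\<And>p m. p \<in> ?D \<Longrightarrow> n \<in># m \<Longrightarrow> p m = \<zero>" by (auto simp: mpoly_carrier)
  have X: "conv (monomial \<one> {#n#}) p m = (if n \<in># m then p (m - {#n#}) else \<zero>)" if "p \<in> carrier ?E" for p m
    using conv_mono[OF one_closed, of p "{#n#}" m] c[OF that] by simp
  show ?thesis
  proof (intro poly_extension.intro poly_extension_axioms.intro)
    show "cring ?E" by (rule cring_mpoly_ring)
    show "cring (?E\<lparr>carrier := ?D\<rparr>)" unfolding mpoly_ring_restrict by (rule cring_mpoly_ring)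
    show "?D \<subseteq> carrier ?E" by (fastforce simp: mpoly_carrier)
    show "monomial \<one> {#n#} \<in> carrier ?E" by (rule mono_carrier) auto
    fix p assume p: "p \<in> carrier ?E"
    show "var_coeff n p k \<in> ?D" for k using var_coeff_carrier[OF p] .
    show "var_coeff n (p \<oplus>\<^bsub>?E\<^esub> q) k = var_coeff n p k \<oplus>\<^bsub>?E\<^esub> var_coeff n q k" for q k
      by (auto simp: mpoly_simps var_coeff_def fun_eq_iff)
    show "var_coeff n (d \<otimes>\<^bsub>?E\<^esub> p) k = d \<otimes>\<^bsub>?E\<^esub> var_coeff n p k" if "d \<in> ?D" for d k
      using var_coeff_conv[OF that c[OF p]] by (simp add: mpoly_simps fun_eq_iff)
    show "var_coeff n (monomial \<one> {#n#} \<otimes>\<^bsub>?E\<^esub> p) 0 = \<zero>\<^bsub>?E\<^esub>"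
      using X[OF p] by (auto simp: mpoly_simps var_coeff_def fun_eq_iff)
    show "var_coeff n (monomial \<one> {#n#} \<otimes>\<^bsub>?E\<^esub> p) (Suc k) = var_coeff n p k" for k
      using X[OF p] by (auto simp: mpoly_simps var_coeff_def fun_eq_iff)
    show "p = q" if q: "q \<in> carrier ?E" and e: "\<And>k. var_coeff n p k = var_coeff n q k" for q
    proof
      fix m
      \<comment> \<open>Each monomial is a power of the variable \<open>n\<close> times a part free
        of it, so the coefficients with respect to \<open>n\<close> determine
        \<open>p\<close>.\<close>
      let ?k = "count m n"
      let ?m = "m - replicate_mset ?k n"
      have m: "?m + replicate_mset ?k n = m" by (intro subset_mset.diff_add) (simp add: count_le_replicate_mset_subset_eq[symmetric])
      have "n \<notin># ?m" by (simp add: not_in_iff)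
      then show "p m = q m" using fun_cong[OF e[of ?k], of ?m] m by (simp add: var_coeff_def)
    qed
    show "\<exists>N. \<forall>k\<ge>N. var_coeff n p k = \<zero>\<^bsub>?E\<^esub>"
    proof -
      have "finite ((\<lambda>m. count m n) ` {m. p m \<noteq> \<zero>})" using p by (simp add: mpoly_carrier)
      then obtain N where N: "\<forall>x\<in>(\<lambda>m. count m n) ` {m. p m \<noteq> \<zero>}. x < N"
        using finite_nat_set_iff_bounded by blast
      have "var_coeff n p k m = \<zero>" if "k \<ge> N" for k m
      proof (rule ccontr)
        assume "var_coeff n p k m \<noteq> \<zero>"
        then have "p (m + replicate_mset k n) \<noteq> \<zero>" by (auto simp: var_coeff_def split: if_splits)
        then have "count (m + replicate_mset k n) n < N" using N by blast
        then show False using that by simp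
      qed
      then show ?thesis by (auto simp: mpoly_simps fun_eq_iff)
    qed
    show "\<exists>p'\<in>carrier ?E. p = var_coeff n p 0 \<oplus>\<^bsub>?E\<^esub> monomial \<one> {#n#} \<otimes>\<^bsub>?E\<^esub> p'"
    \<comment> \<open>The witness collects the terms of \<open>p\<close> divisible by the variable
      \<open>n\<close>, divided by it.\<close>
    proof (rule bexI[of _ "\<lambda>m. p (add_mset n m)"])
      have "{m. p (add_mset n m) \<noteq> \<zero>} \<subseteq> (\<lambda>m. m - {#n#}) ` {m. p m \<noteq> \<zero>}" by force
      then have "finite {m. p (add_mset n m) \<noteq> \<zero>}" using p finite_subset by (auto simp: mpoly_carrier)
      moreover have "set_mset m \<subseteq> {..<Suc n}" if "p (add_mset n m) \<noteq> \<zero>" for m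
      proof -
        have "set_mset (add_mset n m) \<subseteq> {..<Suc n}" using p that unfolding mpoly_carrier by blast
        then show ?thesis by simp
      qed
      ultimately show p': "(\<lambda>m. p (add_mset n m)) \<in> carrier ?E" using p by (auto simp: mpoly_carrier)
      show "p = var_coeff n p 0 \<oplus>\<^bsub>?E\<^esub> monomial \<one> {#n#} \<otimes>\<^bsub>?E\<^esub> (\<lambda>m. p (add_mset n m))"
        using X[OF p'] c[OF p] by (auto simp: mpoly_simps var_coeff_def fun_eq_iff)
    qed
  next
    fix d assume d: "d \<in> ?D"
    show "var_coeff n d 0 = d" using dn[OF d] by (auto simp: var_coeff_def fun_eq_iff)
    show "var_coeff n d (Suc k) = \<zero>\<^bsub>?E\<^esub>" for k using dn[OF d] by (auto simp: var_coeff_def fun_eq_iff mpoly_simps)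
  qed
qed

lemma mpoly_ring_0:
  assumes "p \<in> carrier (mpoly_ring R 0)" shows "p = indexed_const (p {#})"
  using assms by (auto simp: mpoly_carrier indexed_const_def fun_eq_iff)

lemma indexed_const_carrier: "a \<in> carrier R \<Longrightarrow> indexed_const a \<in> carrier (mpoly_ring R n)"
  unfolding indexed_const_mono by (rule mono_carrier) auto

lemma indexed_const_mult:
  "a \<in> carrier R \<Longrightarrow> b \<in> carrier R \<Longrightarrow> indexed_const a \<otimes>\<^bsub>mpoly_ring R n\<^esub> indexed_const b = indexed_const (a \<otimes> b)"
proof -
  assume c: "a \<in> carrier R" "b \<in> carrier R"
  have "conv (monomial a {#}) (monomial b {#}) m = monomial (a \<otimes> b) {#} m" for m :: "nat multiset"
  proof -
    have "monomial b {#} m \<in> carrier R" for m :: "nat multiset" using c by (simp add: monomial_def)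
    then have "conv (monomial a {#}) (monomial b {#}) m = a \<otimes> monomial b {#} m" using conv_mono[OF c(1), of "monomial b {#}" "{#}" m] by simp
    then show ?thesis using c by (simp add: monomial_def)
  qed
  then show ?thesis unfolding mpoly_simps indexed_const_mono by (simp add: fun_eq_iff)
qed

lemma indexed_const_add:
  "a \<in> carrier R \<Longrightarrow> b \<in> carrier R \<Longrightarrow> indexed_const a \<oplus>\<^bsub>mpoly_ring R n\<^esub> indexed_const b = indexed_const (a \<oplus> b)"
  unfolding mpoly_simps by (auto simp: fun_eq_iff indexed_const_def)

lemma indexed_const_inj: "indexed_const a = indexed_const b \<Longrightarrow> a = b"
  unfolding indexed_const_def by (metis (full_types))

end

section \<open>The base of the induction: principal primes and polynomials in no variable\<close>

lemma (in noetherian_cring_prime) regular_prime_principal: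
  assumes "domain R" "p \<in> carrier R" "P = PIdl p"
  shows "regular_prime"
proof -
  interpret domain R by fact
  have z: "zero_loc = {\<zero>}"
  proof
    show "zero_loc \<subseteq> {\<zero>}"
    proof
      fix a assume "a \<in> zero_loc"
      then obtain s where "a \<in> carrier R" "s \<in> carrier R - P" "s \<otimes> a \<in> {\<zero>}" by (elim localizedE)
      then show "a \<in> {\<zero>}" using integral[of s a] ideal_zero[OF P_ideal] by auto
    qed
  qed (use saturated_zero[OF saturated_zero_loc] in simp)
  have pP: "p \<in> P" using assms cgenideal_self by simp
  \<comment> \<open>The zero prime is generated by the empty sequence; otherwise \<open>p\<close>
    alone is a regular sequence, as the ring is a domain.\<close>
  show ?thesis
  proof (cases "p = \<zero>")
    case True
    then have "P = {\<zero>}" using assms(3) pP by (auto simp: cgenideal_def)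
    then have "set [] \<subseteq> P \<and> regular_on zero_loc [] \<and> span zero_loc [] = P"
      unfolding span_simps z by (intro conjI regular_on_Nil) simp_all
    then show ?thesis unfolding regular_prime_def by blast
  next
    case False
    have s: "saturated {\<zero>}" using saturated_zero_loc z by simp
    have "nzd R {\<zero>} p" using False integral assms(2) by (auto simp: nzd_def)
    moreover have "ext {\<zero>} p = P"
    proof
      show "ext {\<zero>} p \<subseteq> P" using ideal_zero[OF P_ideal] pP by (intro ext_least saturated_P) auto
      show "P \<subseteq> ext {\<zero>} p"
        using saturated_mult[OF saturated_ext[OF s assms(2)] ext_mem[OF s assms(2)]] assms(3)
        by (auto simp: cgenideal_def)
    qed
    ultimately show ?thesis unfolding regular_prime_def using pP
      by (intro exI[of _ "[p]"]) (simp add: z regular_on_Cons)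
  qed
qed

context principal_domain begin

lemma mpoly_ring_0_principal:
  assumes I: "ideal I (mpoly_ring R 0)"
  shows "\<exists>c\<in>carrier (mpoly_ring R 0). I = PIdl\<^bsub>mpoly_ring R 0\<^esub> c"
proof -
  let ?E = "mpoly_ring R 0"
  interpret E: cring ?E by (rule cring_mpoly_ring)
  define I0 where "I0 = {a \<in> carrier R. indexed_const a \<in> I}"
  have "ideal I0 R"
  proof (rule idealI_add_mult)
    have "indexed_const \<zero> = \<zero>\<^bsub>?E\<^esub>" by (simp add: mpoly_simps indexed_const_def)
    then show "\<zero> \<in> I0" using E.ideal_zero[OF I] by (simp add: I0_def)
    show "x \<oplus> y \<in> I0" if "x \<in> I0" "y \<in> I0" for x y
      using that E.ideal_add[OF I, of "indexed_const x" "indexed_const y"] indexed_const_add[of x y 0]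
      by (simp add: I0_def)
    show "r \<otimes> x \<in> I0" if "r \<in> carrier R" "x \<in> I0" for r x
      using that ideal.I_l_closed[OF I, of "indexed_const x" "indexed_const r"] indexed_const_mult[of r x 0]
        indexed_const_carrier[of r 0] by (simp add: I0_def)
  qed (auto simp: I0_def)
  then obtain c where c: "c \<in> carrier R" "I0 = PIdl c" using exists_gen by blast
  have cE: "indexed_const c \<in> carrier ?E" using indexed_const_carrier c by simp
  have "c \<in> I0" using c cgenideal_self by simp
  then have cI: "indexed_const c \<in> I" by (simp add: I0_def)
  have "I = PIdl\<^bsub>?E\<^esub> (indexed_const c)"
  proof
    show "PIdl\<^bsub>?E\<^esub> (indexed_const c) \<subseteq> I" by (rule E.cgenideal_minimal[OF I cI])
    show "I \<subseteq> PIdl\<^bsub>?E\<^esub> (indexed_const c)"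
    proof
      fix p assume p: "p \<in> I"
      then have pc: "p \<in> carrier ?E" using E.ideal_carr[OF I] by simp
      have pe: "p = indexed_const (p {#})" by (rule mpoly_ring_0[OF pc])
      have "p {#} \<in> carrier R" using pc by (simp add: mpoly_carrier)
      moreover have "indexed_const (p {#}) \<in> I" using p pe by (simp only: pe[symmetric])
      ultimately have "p {#} \<in> PIdl c" using c(2) by (auto simp: I0_def)
      then obtain x where x: "x \<in> carrier R" "p {#} = x \<otimes> c" by (auto simp: cgenideal_def)
      then have "p = indexed_const x \<otimes>\<^bsub>?E\<^esub> indexed_const c" using pe indexed_const_mult[OF x(1) c(1), of 0] by simp
      then show "p \<in> PIdl\<^bsub>?E\<^esub> (indexed_const c)"
        unfolding cgenideal_def using indexed_const_carrier[OF x(1), of 0] by blast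
    qed
  qed
  then show ?thesis using cE by blast
qed

lemma domain_mpoly_ring_0: "domain (mpoly_ring R 0)"
proof -
  let ?E = "mpoly_ring R 0"
  interpret E: cring ?E by (rule cring_mpoly_ring)
  have z: "indexed_const \<zero> = \<zero>\<^bsub>?E\<^esub>" by (simp add: mpoly_simps indexed_const_def)
  show ?thesis
  proof (intro domain.intro domain_axioms.intro E.is_cring)
    have "indexed_const \<one> = \<one>\<^bsub>?E\<^esub>" by (simp add: mpoly_simps indexed_const_mono)
    moreover have "indexed_const \<one> \<noteq> (indexed_const \<zero> :: nat multiset \<Rightarrow> 'a)"
      using indexed_const_inj[of \<one> \<zero>] by auto
    ultimately show "\<one>\<^bsub>?E\<^esub> \<noteq> \<zero>\<^bsub>?E\<^esub>" using z by simp
    fix p q assume p: "p \<otimes>\<^bsub>?E\<^esub> q = \<zero>\<^bsub>?E\<^esub>" "p \<in> carrier ?E" "q \<in> carrier ?E"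
    have e: "p = indexed_const (p {#})" "q = indexed_const (q {#})" using p mpoly_ring_0 by auto
    have c: "p {#} \<in> carrier R" "q {#} \<in> carrier R" using p by (auto simp: mpoly_carrier)
    have "indexed_const (p {#} \<otimes> q {#}) = p \<otimes>\<^bsub>?E\<^esub> q"
      using indexed_const_mult[OF c, of 0] by (simp only: e[symmetric])
    then have "indexed_const (p {#} \<otimes> q {#}) = (indexed_const \<zero> :: nat multiset \<Rightarrow> 'a)" using z p(1) by simp
    then have "p {#} \<otimes> q {#} = \<zero>" by (rule indexed_const_inj)
    then have "p {#} = \<zero> \<or> q {#} = \<zero>" using integral c by simp
    then show "p = \<zero>\<^bsub>?E\<^esub> \<or> q = \<zero>\<^bsub>?E\<^esub>" using e z by metis
  qed
qed

text \<open>The two claims go through the induction together, since the step for regular primes uses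
  that the coefficient ring is Noetherian.\<close>

theorem mpoly_ring_noetherian_regular:
  "noetherian_ring (mpoly_ring R n) \<and>
   (\<forall>P. primeideal P (mpoly_ring R n) \<longrightarrow> noetherian_cring_prime.regular_prime (mpoly_ring R n) P)"
proof (induction n)
  case 0
  let ?E = "mpoly_ring R 0"
  interpret E: cring ?E by (rule cring_mpoly_ring)
  interpret E: principal_domain ?E
    by (intro principal_domain.intro domain_mpoly_ring_0 principal_domain_axioms.intro mpoly_ring_0_principal)
  have N: "noetherian_cring ?E" by (intro noetherian_cring.intro E.is_cring E.noetherian_ring_axioms)
  moreover have "noetherian_cring_prime.regular_prime ?E P" if P: "primeideal P ?E" for P
  proof -
    interpret L: noetherian_cring_prime ?E P by (rule noetherian_cring.prime_locale[OF N P])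
    show ?thesis
      using E.exists_gen[OF L.P_ideal] L.regular_prime_principal[OF E.domain_axioms] by blast
  qed
  ultimately show ?case using E.noetherian_ring_axioms by blast
next
  case (Suc n)
  interpret L: poly_extension "mpoly_ring R (Suc n)" "carrier (mpoly_ring R n)" "monomial \<one> {#n#}" "var_coeff n"
    by (rule poly_extension_mpoly_ring)
  show ?case
    using L.noetherian_extension L.regular_prime_extension Suc unfolding mpoly_ring_restrict by blast
qed

end

section \<open>Flatness over a discrete valuation ring\<close>

subsection \<open>The tensor product\<close>

text \<open>The universal property of the free abelian group on \<open>S\<close>, with a target
  written additively; conditions on \<open>keys\<close> express membership in the group.\<close>

lemma frag_hom_exists:
  fixes M (structure)
  assumes "abelian_group M" "f ` S \<subseteq> carrier M"
  obtains h where "\<And>x. Poly_Mapping.keys x \<subseteq> S \<Longrightarrow> h x \<in> carrier M" "\<And>x. x \<in> S \<Longrightarrow> h (frag_of x) = f x"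
    "\<And>x y. Poly_Mapping.keys x \<subseteq> S \<Longrightarrow> Poly_Mapping.keys y \<subseteq> S \<Longrightarrow> h (x + y) = h x \<oplus> h y"
    "\<And>x. Poly_Mapping.keys x \<subseteq> S \<Longrightarrow> h (- x) = \<ominus> h x" "h 0 = \<zero>"
    "\<And>x y. Poly_Mapping.keys x \<subseteq> S \<Longrightarrow> Poly_Mapping.keys y \<subseteq> S \<Longrightarrow> h (x - y) = h x \<ominus> h y"
proof -
  interpret abelian_group M by fact
  let ?F = "free_Abelian_group S"
  obtain h where h: "h \<in> hom ?F (add_monoid M)" "\<And>x. x \<in> S \<Longrightarrow> h (frag_of x) = f x"
    using comm_group.free_Abelian_group_universal[OF a_comm_group, of f S] assms(2) by auto
  interpret h: group_hom ?F "add_monoid M" h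
    using h(1) by (intro group_hom.intro group_hom_axioms.intro) (auto simp: a_group)
  have 1: "h x \<in> carrier M" if "Poly_Mapping.keys x \<subseteq> S" for x
    using h.hom_closed[of x] that by simp
  have 2: "h (x + y) = h x \<oplus>\<^bsub>M\<^esub> h y" if "Poly_Mapping.keys x \<subseteq> S" "Poly_Mapping.keys y \<subseteq> S" for x y
    using h.hom_mult[of x y] that by simp
  have 3: "h (- x) = \<ominus>\<^bsub>M\<^esub> h x" if "Poly_Mapping.keys x \<subseteq> S" for x
    using h.hom_inv[of x] that by (simp add: a_inv_def)
  have 4: "h 0 = \<zero>" using h.hom_one by simp
  have 5: "h (x - y) = h x \<ominus> h y" if "Poly_Mapping.keys x \<subseteq> S" "Poly_Mapping.keys y \<subseteq> S" for x y
    using 2[of x "- y"] 3[of y] that by (simp add: a_minus_def)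
  show ?thesis by (rule that[of h]) (fact 1 2 3 4 5 h(2))+
qed

lemma keys_diff_subset:
  "Poly_Mapping.keys x \<subseteq> S \<Longrightarrow> Poly_Mapping.keys y \<subseteq> S \<Longrightarrow> Poly_Mapping.keys (x - y :: 'a \<Rightarrow>\<^sub>0 int) \<subseteq> S"
  using keys_diff[of x y] by blast

lemma tensor_relationsE:
  assumes "r \<in> tensor_relations A M N"
  obtains (left) x x' y where "r = frag_of (x \<oplus>\<^bsub>M\<^esub> x', y) - frag_of (x, y) - frag_of (x', y)"
        "x \<in> carrier M" "x' \<in> carrier M" "y \<in> carrier N"
  | (right) x y y' where "r = frag_of (x, y \<oplus>\<^bsub>N\<^esub> y') - frag_of (x, y) - frag_of (x, y')"
        "x \<in> carrier M" "y \<in> carrier N" "y' \<in> carrier N"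
  | (smult) a x y where "r = frag_of (a \<odot>\<^bsub>M\<^esub> x, y) - frag_of (x, a \<odot>\<^bsub>N\<^esub> y)"
        "a \<in> carrier A" "x \<in> carrier M" "y \<in> carrier N"
  using assms unfolding tensor_relations_def by blast

locale two_modules = M: module A M + N: module A N for A (structure) and M N
begin

abbreviation K where "K \<equiv> tensor_kernel A M N"
abbreviation S where "S \<equiv> carrier M \<times> carrier N"

lemma relations_keys: "r \<in> tensor_relations A M N \<Longrightarrow> Poly_Mapping.keys r \<subseteq> S"
  by (erule tensor_relationsE; hypsubst; intro keys_diff_subset) (simp_all add: keys_frag_of)

lemma subgroup_K: "subgroup K (free_Abelian_group S)"
  unfolding tensor_kernel_def
  by (rule group.generate_is_subgroup) (auto dest: relations_keys[THEN subsetD])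

lemma K_keys: "x \<in> K \<Longrightarrow> Poly_Mapping.keys x \<subseteq> S"
  using subgroup.mem_carrier[OF subgroup_K, of x] by simp

lemma K_zero: "0 \<in> K" using subgroup.one_closed[OF subgroup_K] by simp
lemma K_add: "x \<in> K \<Longrightarrow> y \<in> K \<Longrightarrow> x + y \<in> K" using subgroup.m_closed[OF subgroup_K, of x y] by simp
lemma K_neg: "x \<in> K \<Longrightarrow> - x \<in> K"
  using subgroup.m_inv_closed[OF subgroup_K, of x] K_keys[of x] by simp
lemma K_diff: "x \<in> K \<Longrightarrow> y \<in> K \<Longrightarrow> x - y \<in> K" using K_add[of x "- y"] K_neg by simp

lemma K_induct [consumes 1, case_names zero relation minus add]:
  assumes "x \<in> K" and "Q 0" "\<And>r. r \<in> tensor_relations A M N \<Longrightarrow> Q r"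
    "\<And>x. x \<in> K \<Longrightarrow> Q x \<Longrightarrow> Q (- x)" "\<And>x y. x \<in> K \<Longrightarrow> y \<in> K \<Longrightarrow> Q x \<Longrightarrow> Q y \<Longrightarrow> Q (x + y)"
  shows "Q x"
  using assms(1) unfolding tensor_kernel_def
proof (induction rule: generate.induct)
  case one
  then show ?case using assms(2) by simp
next
  case (incl h)
  then show ?case by (rule assms(3))
next
  case (inv h)
  then have "Q (- h)" using assms(3,4) by (auto simp: tensor_kernel_def intro: generate.incl)
  then show ?case using inv_free_Abelian_group[OF relations_keys[OF inv]] by simp
next
  case (eng h1 h2)
  then show ?case using assms(5)[of h1 h2] by (simp add: tensor_kernel_def)
qed

lemma rel_left:
  "x \<in> carrier M \<Longrightarrow> x' \<in> carrier M \<Longrightarrow> y \<in> carrier N \<Longrightarrow>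
   frag_of (x \<oplus>\<^bsub>M\<^esub> x', y) - frag_of (x, y) - frag_of (x', y) \<in> K"
  unfolding tensor_kernel_def tensor_relations_def by (rule generate.incl) blast

lemma rel_right:
  "x \<in> carrier M \<Longrightarrow> y \<in> carrier N \<Longrightarrow> y' \<in> carrier N \<Longrightarrow>
   frag_of (x, y \<oplus>\<^bsub>N\<^esub> y') - frag_of (x, y) - frag_of (x, y') \<in> K"
  unfolding tensor_kernel_def tensor_relations_def by (rule generate.incl) blast

lemma rel_smult:
  "a \<in> carrier A \<Longrightarrow> x \<in> carrier M \<Longrightarrow> y \<in> carrier N \<Longrightarrow>
   frag_of (a \<odot>\<^bsub>M\<^esub> x, y) - frag_of (x, a \<odot>\<^bsub>N\<^esub> y) \<in> K"
  unfolding tensor_kernel_def tensor_relations_def by (rule generate.incl) blast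

lemma zero_left: "y \<in> carrier N \<Longrightarrow> frag_of (\<zero>\<^bsub>M\<^esub>, y) \<in> K"
  using K_neg[OF rel_left[of "\<zero>\<^bsub>M\<^esub>" "\<zero>\<^bsub>M\<^esub>" y]] by simp

lemma zero_right: "x \<in> carrier M \<Longrightarrow> frag_of (x, \<zero>\<^bsub>N\<^esub>) \<in> K"
  using K_neg[OF rel_right[of x "\<zero>\<^bsub>N\<^esub>" "\<zero>\<^bsub>N\<^esub>"]] by simp

lemma diff_left:
  assumes "x \<in> carrier M" "x' \<in> carrier M" "y \<in> carrier N"
  shows "frag_of (x, y) - frag_of (x', y) - frag_of (x \<ominus>\<^bsub>M\<^esub> x', y) \<in> K"
proof -
  have "x \<ominus>\<^bsub>M\<^esub> x' \<oplus>\<^bsub>M\<^esub> x' = x"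
    using assms by (simp add: a_minus_def M.M.a_assoc M.M.l_neg)
  then show ?thesis using rel_left[of "x \<ominus>\<^bsub>M\<^esub> x'" x' y] assms by (simp add: algebra_simps)
qed

lemma coset: "K #>\<^bsub>free_Abelian_group S\<^esub> z = {k + z | k. k \<in> K}"
  by (auto simp: r_coset_def)

lemma coset_eq_iff: "K #>\<^bsub>free_Abelian_group S\<^esub> z = K #>\<^bsub>free_Abelian_group S\<^esub> z' \<longleftrightarrow> z - z' \<in> K"
proof
  assume "K #>\<^bsub>free_Abelian_group S\<^esub> z = K #>\<^bsub>free_Abelian_group S\<^esub> z'"
  moreover have "z \<in> K #>\<^bsub>free_Abelian_group S\<^esub> z" unfolding coset using K_zero by force
  ultimately show "z - z' \<in> K" unfolding coset by auto
next
  assume d: "z - z' \<in> K"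
  have "k + z \<in> {k + z' | k. k \<in> K}" if "k \<in> K" for k
    using K_add[OF that d] by (intro CollectI exI[of _ "k + (z - z')"]) simp
  moreover have "k + z' \<in> {k + z | k. k \<in> K}" if "k \<in> K" for k
    using K_diff[OF that d] by (intro CollectI exI[of _ "k - (z - z')"]) simp
  ultimately show "K #>\<^bsub>free_Abelian_group S\<^esub> z = K #>\<^bsub>free_Abelian_group S\<^esub> z'" unfolding coset by auto
qed

lemma carrier_tensor:
  "carrier (tensor_product A M N) = (\<lambda>z. K #>\<^bsub>free_Abelian_group S\<^esub> z) ` {z. Poly_Mapping.keys z \<subseteq> S}"
proof -
  have "carrier (free_Abelian_group S) = {z. Poly_Mapping.keys z \<subseteq> S}" by auto
  then show ?thesis unfolding tensor_product_def carrier_FactGroup by simp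
qed

end

section \<open>Maps induced on tensor products, in terms of representatives\<close>

definition frag_map :: "('u \<Rightarrow> 'w) \<Rightarrow> ('u \<times> 'v \<Rightarrow>\<^sub>0 int) \<Rightarrow> ('w \<times> 'v \<Rightarrow>\<^sub>0 int)" where
  "frag_map f = frag_extend (\<lambda>(x, y). frag_of (f x, y))"

lemma frag_map_simps [simp]: "frag_map f 0 = 0" "frag_map f (frag_of (x, y)) = frag_of (f x, y)"
  "frag_map f (u + v) = frag_map f u + frag_map f v" "frag_map f (u - v) = frag_map f u - frag_map f v"
  "frag_map f (- u) = - frag_map f u"
  by (simp_all add: frag_map_def frag_extend_add frag_extend_diff frag_extend_minus)

lemma module_homD:
  assumes "f \<in> module_hom A M M'"
  shows "x \<in> carrier M \<Longrightarrow> f x \<in> carrier M'"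
    "x \<in> carrier M \<Longrightarrow> y \<in> carrier M \<Longrightarrow> f (x \<oplus>\<^bsub>M\<^esub> y) = f x \<oplus>\<^bsub>M'\<^esub> f y"
    "a \<in> carrier A \<Longrightarrow> x \<in> carrier M \<Longrightarrow> f (a \<odot>\<^bsub>M\<^esub> x) = a \<odot>\<^bsub>M'\<^esub> f x"
  using assms by (auto simp: module_hom_def)

lemma frag_map_kernel:
  assumes "module A M" "module A M'" "module A N" and f: "f \<in> module_hom A M M'" and k: "k \<in> tensor_kernel A M N"
  shows "frag_map f k \<in> tensor_kernel A M' N"
proof -
  interpret T: two_modules A M N using assms by (simp add: two_modules_def)
  interpret T': two_modules A M' N using assms by (simp add: two_modules_def)
  note fD = module_homD[OF f]
  show ?thesis
    using k
  proof (induction rule: T.K_induct)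
    case zero
    show ?case using T'.K_zero by simp
  next
    case (relation r)
    then show ?case
      by (cases rule: tensor_relationsE) (simp_all add: fD T'.rel_left T'.rel_right T'.rel_smult)
  qed (use T'.K_neg T'.K_add in simp_all)
qed

lemma tensor_map_coset:
  assumes "module A M" "module A M'" "module A N" and f: "f \<in> module_hom A M M'"
  shows "tensor_map A M N f M' (tensor_kernel A M N #>\<^bsub>free_Abelian_group (carrier M \<times> carrier N)\<^esub> z)
     = tensor_kernel A M' N #>\<^bsub>free_Abelian_group (carrier M' \<times> carrier N)\<^esub> frag_map f z"
proof -
  interpret T: two_modules A M N using assms by (simp add: two_modules_def)
  interpret T': two_modules A M' N using assms by (simp add: two_modules_def)
  have "T'.K #>\<^bsub>free_Abelian_group T'.S\<^esub> frag_map f (k + z) = T'.K #>\<^bsub>free_Abelian_group T'.S\<^esub> frag_map f z"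
    if "k \<in> T.K" for k
    unfolding T'.coset_eq_iff using frag_map_kernel[OF assms that] by simp
  then show ?thesis
    unfolding tensor_map_def frag_map_def[symmetric] T.coset using T.K_zero by blast
qed

text \<open>The induced map is additive, so injectivity is triviality of the kernel. Once this is
  stated for representatives, flatness can be treated without touching cosets.\<close>

lemma inj_tensor_map_iff:
  assumes "module A M" "module A M'" "module A N" and f: "f \<in> module_hom A M M'"
  shows "inj_on (tensor_map A M N f M') (carrier (tensor_product A M N)) \<longleftrightarrow>
    (\<forall>w. Poly_Mapping.keys w \<subseteq> carrier M \<times> carrier N \<longrightarrow> frag_map f w \<in> tensor_kernel A M' N \<longrightarrow>
       w \<in> tensor_kernel A M N)"
proof -
  interpret T: two_modules A M N using assms by (simp add: two_modules_def)
  interpret T': two_modules A M' N using assms by (simp add: two_modules_def)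
  show ?thesis
  proof
    assume inj: "inj_on (tensor_map A M N f M') (carrier (tensor_product A M N))"
    show "\<forall>w. Poly_Mapping.keys w \<subseteq> T.S \<longrightarrow> frag_map f w \<in> T'.K \<longrightarrow> w \<in> T.K"
    proof (intro allI impI)
      fix w assume w: "Poly_Mapping.keys w \<subseteq> T.S" "frag_map f w \<in> T'.K"
      let ?C = "\<lambda>z. T.K #>\<^bsub>free_Abelian_group T.S\<^esub> z"
      have "tensor_map A M N f M' (?C w) = tensor_map A M N f M' (?C 0)"
        unfolding tensor_map_coset[OF assms] T'.coset_eq_iff using w(2) by simp
      moreover have "?C w \<in> carrier (tensor_product A M N)" "?C 0 \<in> carrier (tensor_product A M N)"
        unfolding T.carrier_tensor using w(1) by auto
      ultimately have "?C w = ?C 0" using inj_onD[OF inj] by blast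
      then show "w \<in> T.K" unfolding T.coset_eq_iff by simp
    qed
  next
    assume *: "\<forall>w. Poly_Mapping.keys w \<subseteq> T.S \<longrightarrow> frag_map f w \<in> T'.K \<longrightarrow> w \<in> T.K"
    show "inj_on (tensor_map A M N f M') (carrier (tensor_product A M N))"
    proof (rule inj_onI)
      fix C C' assume C: "C \<in> carrier (tensor_product A M N)" "C' \<in> carrier (tensor_product A M N)"
        "tensor_map A M N f M' C = tensor_map A M N f M' C'"
      then obtain z z' where z: "Poly_Mapping.keys z \<subseteq> T.S" "C = T.K #>\<^bsub>free_Abelian_group T.S\<^esub> z"
        "Poly_Mapping.keys z' \<subseteq> T.S" "C' = T.K #>\<^bsub>free_Abelian_group T.S\<^esub> z'"
        unfolding T.carrier_tensor by blast
      have "frag_map f (z - z') \<in> T'.K"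
        using C(3) unfolding z tensor_map_coset[OF assms] T'.coset_eq_iff by simp
      then have "z - z' \<in> T.K" using * keys_diff_subset z by blast
      then show "C = C'" unfolding z T.coset_eq_iff .
    qed
  qed
qed

subsection \<open>Flat modules are torsion-free\<close>

text \<open>A copy of \<open>A\<close> as a module over itself whose carrier lies in the type of the
  modules that test flatness.\<close>

definition sum_self_module :: "('a, 'm) ring_scheme \<Rightarrow> ('a, 'a + 'u) module" where
  "sum_self_module A = \<lparr>carrier = Inl ` carrier A, monoid.mult = (\<lambda>x y. x), one = Inl \<one>\<^bsub>A\<^esub>,
     ring.zero = Inl \<zero>\<^bsub>A\<^esub>, add = (\<lambda>x y. Inl (projl x \<oplus>\<^bsub>A\<^esub> projl y)),
     smult = (\<lambda>a x. Inl (a \<otimes>\<^bsub>A\<^esub> projl x))\<rparr>"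

lemma (in cring) module_sum_self: "module R (sum_self_module R)"
proof (rule moduleI)
  show "abelian_group (sum_self_module R)"
  proof (rule abelian_groupI)
    fix x assume "x \<in> carrier (sum_self_module R)"
    then obtain a where "x = Inl a" "a \<in> carrier R" by (auto simp: sum_self_module_def)
    then show "\<exists>y\<in>carrier (sum_self_module R). y \<oplus>\<^bsub>sum_self_module R\<^esub> x = \<zero>\<^bsub>sum_self_module R\<^esub>"
      by (intro bexI[of _ "Inl (\<ominus> a)"]) (auto simp: sum_self_module_def l_neg)
  qed (auto simp: sum_self_module_def a_ac)
qed (auto simp: sum_self_module_def l_distr r_distr m_assoc is_cring)

text \<open>Multiplication by \<open>t\<close> on \<open>A\<close> is injective and stays so after
  tensoring. It sends \<open>1 \<otimes> x\<close> to
  \<open>t \<otimes> x = 1 \<otimes> t x = 0\<close>, so \<open>1 \<otimes> x = 0\<close>, and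
  evaluating \<open>a \<otimes> y\<close> as \<open>a y\<close> gives \<open>x = 0\<close>.\<close>

lemma flat_module_torsion_free:
  assumes A: "domain A" and fl: "flat_module TYPE('u) A N" and t: "t \<in> carrier A" "t \<noteq> \<zero>\<^bsub>A\<^esub>"
    and x: "x \<in> carrier N" "t \<odot>\<^bsub>N\<^esub> x = \<zero>\<^bsub>N\<^esub>"
  shows "x = \<zero>\<^bsub>N\<^esub>"
proof -
  interpret A: domain A by fact
  let ?M = "sum_self_module A :: ('a, 'a + 'u) module"
  let ?f = "\<lambda>y. Inl (t \<otimes>\<^bsub>A\<^esub> projl y) :: 'a + 'u"
  have N: "module A N" using fl by (simp add: flat_module_def)
  have M: "module A ?M" by (rule A.module_sum_self)
  interpret T: two_modules A ?M N using M N by (simp add: two_modules_def)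
  have f: "?f \<in> module_hom A ?M ?M"
    using t by (auto simp: module_hom_def sum_self_module_def A.r_distr A.m_lcomm)
  have inj: "inj_on ?f (carrier ?M)"
    using t A.m_lcancel by (auto simp: inj_on_def sum_self_module_def)
  have "inj_on (tensor_map A ?M N ?f ?M) (carrier (tensor_product A ?M N))"
    using fl M f inj unfolding flat_module_def by blast
  then have *: "w \<in> T.K" if "Poly_Mapping.keys w \<subseteq> T.S" "frag_map ?f w \<in> T.K" for w
    using inj_tensor_map_iff[OF M M N f] that by blast
  have o: "Inl \<one>\<^bsub>A\<^esub> \<in> carrier ?M" by (simp add: sum_self_module_def)
  have "t \<odot>\<^bsub>?M\<^esub> Inl \<one>\<^bsub>A\<^esub> = Inl t" using t by (simp add: sum_self_module_def)
  then have "frag_of (Inl t, x) - frag_of (Inl \<one>\<^bsub>A\<^esub>, \<zero>\<^bsub>N\<^esub>) \<in> T.K"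
    using T.rel_smult[OF t(1) o x(1)] x(2) by simp
  then have tx: "frag_of (Inl t, x) \<in> T.K" using T.K_add[OF _ T.zero_right[OF o]] by force
  have k: "frag_of (Inl \<one>\<^bsub>A\<^esub>, x) \<in> T.K"
    by (rule *) (use tx t o x(1) in \<open>simp_all add: keys_frag_of\<close>)
  \<comment> \<open>The evaluation map on generators; that it descends to the tensor product is
    checked on the three kinds of relations.\<close>
  let ?g = "\<lambda>(a, y). projl a \<odot>\<^bsub>N\<^esub> y"
  have "?g ` T.S \<subseteq> carrier N" by (auto simp: sum_self_module_def)
  then obtain h where h:
    "\<And>x. Poly_Mapping.keys x \<subseteq> T.S \<Longrightarrow> h x \<in> carrier N" "\<And>x. x \<in> T.S \<Longrightarrow> h (frag_of x) = ?g x"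
    "\<And>x y. Poly_Mapping.keys x \<subseteq> T.S \<Longrightarrow> Poly_Mapping.keys y \<subseteq> T.S \<Longrightarrow> h (x + y) = h x \<oplus>\<^bsub>N\<^esub> h y"
    "\<And>x. Poly_Mapping.keys x \<subseteq> T.S \<Longrightarrow> h (- x) = \<ominus>\<^bsub>N\<^esub> h x" "h 0 = \<zero>\<^bsub>N\<^esub>"
    and hd: "\<And>x y. Poly_Mapping.keys x \<subseteq> T.S \<Longrightarrow> Poly_Mapping.keys y \<subseteq> T.S \<Longrightarrow> h (x - y) = h x \<ominus>\<^bsub>N\<^esub> h y"
    by (rule frag_hom_exists[OF T.N.M.abelian_group_axioms]) (rule that)
  have "h w = \<zero>\<^bsub>N\<^esub>" if "w \<in> T.K" for w
    using that
  proof (induction rule: T.K_induct)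
    case (relation r)
    have e: "u \<ominus>\<^bsub>N\<^esub> v \<ominus>\<^bsub>N\<^esub> w = \<zero>\<^bsub>N\<^esub>"
      if "u = v \<oplus>\<^bsub>N\<^esub> w" "v \<in> carrier N" "w \<in> carrier N" for u v w
    proof -
      have "u \<ominus>\<^bsub>N\<^esub> v = w" using that by (metis T.N.M.a_comm T.N.M.add.inv_solve_right T.N.M.a_closed a_minus_def)
      then show ?thesis using that by (simp add: a_minus_def T.N.M.r_neg)
    qed
    from relation show ?case
    proof (cases rule: tensor_relationsE)
      case (left x x' y)
      then have "x \<oplus>\<^bsub>?M\<^esub> x' \<in> carrier ?M" by simp
      then have "h r = ?g (x \<oplus>\<^bsub>?M\<^esub> x', y) \<ominus>\<^bsub>N\<^esub> ?g (x, y) \<ominus>\<^bsub>N\<^esub> ?g (x', y)"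
        using left by (simp add: hd keys_frag_of keys_diff_subset h(2) del: split_conv)
      also have "\<dots> = \<zero>\<^bsub>N\<^esub>" using left by (intro e) (auto simp: sum_self_module_def T.N.smult_l_distr)
      finally show ?thesis .
    next
      case (right x y y')
      then have "h r = ?g (x, y \<oplus>\<^bsub>N\<^esub> y') \<ominus>\<^bsub>N\<^esub> ?g (x, y) \<ominus>\<^bsub>N\<^esub> ?g (x, y')"
        by (simp add: hd keys_frag_of keys_diff_subset h(2) del: split_conv)
      also have "\<dots> = \<zero>\<^bsub>N\<^esub>" using right by (intro e) (auto simp: sum_self_module_def T.N.smult_r_distr)
      finally show ?thesis .
    next
      case (smult a x y)
      then have "a \<odot>\<^bsub>?M\<^esub> x \<in> carrier ?M" by simp
      then have "h r = ?g (a \<odot>\<^bsub>?M\<^esub> x, y) \<ominus>\<^bsub>N\<^esub> ?g (x, a \<odot>\<^bsub>N\<^esub> y)"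
        using smult by (simp add: hd keys_frag_of keys_diff_subset h(2) del: split_conv)
      also have "?g (a \<odot>\<^bsub>?M\<^esub> x, y) = ?g (x, a \<odot>\<^bsub>N\<^esub> y)"
        using smult by (auto simp: sum_self_module_def T.N.smult_assoc1[symmetric] A.m_comm)
      also have "?g (x, a \<odot>\<^bsub>N\<^esub> y) \<ominus>\<^bsub>N\<^esub> ?g (x, a \<odot>\<^bsub>N\<^esub> y) = \<zero>\<^bsub>N\<^esub>"
        using smult by (auto simp: sum_self_module_def a_minus_def T.N.M.r_neg)
      finally show ?thesis .
    qed
  qed (use h T.K_keys in simp_all)
  then have "h (frag_of (Inl \<one>\<^bsub>A\<^esub>, x)) = \<zero>\<^bsub>N\<^esub>" using k by simp
  then show ?thesis using h(2)[of "(Inl \<one>\<^bsub>A\<^esub>, x)"] o x(1) by simp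
qed

subsection \<open>Discrete valuation rings\<close>

context principal_domain begin

text \<open>If \<open>t\<close> were zero, the zero ideal would be maximal, leaving no room for the
  nonzero maximal ideal of a discrete valuation ring.\<close>

lemma uniformizer_nonzero:
  assumes d: "discrete_valuation_ring R" and t: "uniformizer R t" shows "t \<noteq> \<zero>"
proof
  assume "t = \<zero>"
  then have z: "PIdl t = {\<zero>}" by (auto simp: cgenideal_def intro!: exI[of _ \<zero>])
  then have m: "maximalideal {\<zero>} R" using t by (simp add: uniformizer_def)
  obtain M where M: "maximalideal M R" "M \<noteq> {\<zero>}" using d unfolding discrete_valuation_ring_def by blast
  have iM: "ideal M R" using M maximalideal.axioms(1) by blast
  have "M = {\<zero>} \<or> M = carrier R"
    using maximalideal.I_maximal[OF m iM] ideal_zero[OF iM] ideal_carr[OF iM] by blast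
  then show False using M maximalideal.I_notcarr by blast
qed

lemma uniformizer_not_unit:
  assumes t: "uniformizer R t" and w: "w \<in> carrier R" "w \<otimes> t = \<one>" shows False
proof -
  have m: "maximalideal (PIdl t) R" and tc: "t \<in> carrier R" using t by (auto simp: uniformizer_def)
  have "\<one> \<in> PIdl t" unfolding cgenideal_def using w by force
  then have "PIdl t = carrier R" using ideal.one_imp_carrier[OF cgenideal_ideal[OF tc]] by simp
  then show False using maximalideal.I_notcarr[OF m] by simp
qed

text \<open>A nonunit lies in a maximal ideal. Uniqueness is given for nonzero maximal ideals only,
  so the zero ideal, which means \<open>a = \<zero>\<close>, is a separate case.\<close>

lemma dvr_nonunit:
  assumes d: "discrete_valuation_ring R" and t: "uniformizer R t"
    and a: "a \<in> carrier R" "\<And>w. w \<in> carrier R \<Longrightarrow> w \<otimes> a \<noteq> \<one>"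
  shows "a \<in> PIdl t"
proof -
  have tc: "t \<in> carrier R" and mt: "maximalideal (PIdl t) R" using t by (auto simp: uniformizer_def)
  have tt: "t \<in> PIdl t" by (rule cgenideal_self[OF tc])
  let ?S = "{I. ideal I R \<and> PIdl a \<subseteq> I \<and> I \<noteq> carrier R}"
  have "\<one> \<notin> PIdl a"
  proof
    assume "\<one> \<in> PIdl a"
    then obtain w where "w \<in> carrier R" "\<one> = w \<otimes> a" by (auto simp: cgenideal_def)
    then show False using a(2)[of w] by simp
  qed
  then have "PIdl a \<in> ?S" using cgenideal_ideal[OF a(1)] by auto
  then have "\<exists>M\<in>?S. \<forall>I\<in>?S. M \<subseteq> I \<longrightarrow> I = M" by (intro ideal_maximal) auto
  then obtain M where "M \<in> ?S" "\<forall>I\<in>?S. M \<subseteq> I \<longrightarrow> I = M" by (elim bexE)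
  then have M: "ideal M R" "PIdl a \<subseteq> M" "M \<noteq> carrier R"
    and max: "\<And>I. ideal I R \<Longrightarrow> I \<noteq> carrier R \<Longrightarrow> M \<subseteq> I \<Longrightarrow> I = M" by auto
  have mM: "maximalideal M R"
    using M max by (intro maximalidealI) auto
  have aM: "a \<in> M" using M(2) cgenideal_self[OF a(1)] by auto
  show ?thesis
  proof (cases "M = {\<zero>}")
    case True
    then show ?thesis using aM ideal_zero[OF cgenideal_ideal[OF tc]] by auto
  next
    case False
    have "PIdl t \<noteq> {\<zero>}" using tt uniformizer_nonzero[OF d t] by auto
    then have "M = PIdl t" using d mM mt False unfolding discrete_valuation_ring_def by blast
    then show ?thesis using aM by simp
  qed
qed

text \<open>Divided by a greatest common divisor, the two elements become \<open>a'\<close> and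
  \<open>b'\<close> with \<open>x a' + y b' = 1\<close>. They cannot both lie in the maximal ideal,
  so one of them is a unit.\<close>

lemma dvr_divides_total:
  assumes d: "discrete_valuation_ring R" and t: "uniformizer R t" and c: "a \<in> carrier R" "b \<in> carrier R"
  shows "(\<exists>q\<in>carrier R. a = q \<otimes> b) \<or> (\<exists>q\<in>carrier R. b = q \<otimes> a)"
proof -
  have tc: "t \<in> carrier R" using t by (auto simp: uniformizer_def)
  let ?I = "{x \<otimes> a \<oplus> y \<otimes> b | x y. x \<in> carrier R \<and> y \<in> carrier R}"
  have I: "ideal ?I R"
  proof (rule idealI_add_mult)
    show "?I \<subseteq> carrier R" using c by auto
    have "\<zero> = \<zero> \<otimes> a \<oplus> \<zero> \<otimes> b" using c by simp
    then show "\<zero> \<in> ?I" by blast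
  next
    fix u v assume "u \<in> ?I" "v \<in> ?I"
    then obtain x y x' y' where u: "u = x \<otimes> a \<oplus> y \<otimes> b" "v = x' \<otimes> a \<oplus> y' \<otimes> b"
      "x \<in> carrier R" "y \<in> carrier R" "x' \<in> carrier R" "y' \<in> carrier R" by blast
    then have "u \<oplus> v = (x \<oplus> x') \<otimes> a \<oplus> (y \<oplus> y') \<otimes> b" using c by simp algebra
    then show "u \<oplus> v \<in> ?I" using u by blast
  next
    fix r u assume r: "r \<in> carrier R" "u \<in> ?I"
    then obtain x y where u: "u = x \<otimes> a \<oplus> y \<otimes> b" "x \<in> carrier R" "y \<in> carrier R" by blast
    then have "r \<otimes> u = (r \<otimes> x) \<otimes> a \<oplus> (r \<otimes> y) \<otimes> b" using c r(1) by simp algebra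
    then show "r \<otimes> u \<in> ?I" using u r(1) by blast
  qed
  obtain g where g: "g \<in> carrier R" "?I = PIdl g" using exists_gen[OF I] by blast
  have "a = \<one> \<otimes> a \<oplus> \<zero> \<otimes> b" "b = \<zero> \<otimes> a \<oplus> \<one> \<otimes> b" using c by simp_all
  then have "a \<in> PIdl g" "b \<in> PIdl g" unfolding g(2)[symmetric] by blast+
  then obtain a' b' where ab: "a' \<in> carrier R" "a = a' \<otimes> g" "b' \<in> carrier R" "b = b' \<otimes> g" by (auto simp: cgenideal_def)
  have "g \<in> ?I" unfolding g(2) by (rule cgenideal_self[OF g(1)])
  then obtain x y where xy: "g = x \<otimes> a \<oplus> y \<otimes> b" "x \<in> carrier R" "y \<in> carrier R" by blast
  show ?thesis
  proof (cases "g = \<zero>")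
    case True
    then show ?thesis using ab by auto
  next
    case False
    have "(x \<otimes> a' \<oplus> y \<otimes> b' \<ominus> \<one>) \<otimes> g = (x \<otimes> (a' \<otimes> g) \<oplus> y \<otimes> (b' \<otimes> g)) \<ominus> g"
      using xy(2,3) ab(1,3) g(1) by algebra
    also have "\<dots> = g \<ominus> g" using xy(1) ab(2,4) by simp
    also have "\<dots> = \<zero>" using g(1) by algebra
    finally have "x \<otimes> a' \<oplus> y \<otimes> b' \<ominus> \<one> = \<zero>" using integral False xy ab g by blast
    moreover have "x \<otimes> a' \<oplus> y \<otimes> b' = (x \<otimes> a' \<oplus> y \<otimes> b' \<ominus> \<one>) \<oplus> \<one>" using xy(2,3) ab(1,3) by algebra
    ultimately have one: "x \<otimes> a' \<oplus> y \<otimes> b' = \<one>" by simp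
    have "\<not> (a' \<in> PIdl t \<and> b' \<in> PIdl t)"
    proof
      assume "a' \<in> PIdl t \<and> b' \<in> PIdl t"
      then have "x \<otimes> a' \<oplus> y \<otimes> b' \<in> PIdl t" using ideal_lin2[OF cgenideal_ideal[OF tc]] xy by blast
      then obtain w where "w \<in> carrier R" "\<one> = w \<otimes> t" using one by (auto simp: cgenideal_def)
      then show False using uniformizer_not_unit[OF t, of w] by simp
    qed
    then consider "a' \<notin> PIdl t" | "b' \<notin> PIdl t" by blast
    then show ?thesis
    proof cases
      case 1
      then obtain w where w: "w \<in> carrier R" "w \<otimes> a' = \<one>" using dvr_nonunit[OF d t ab(1)] by blast
      have "b' \<otimes> w \<otimes> (a' \<otimes> g) = b' \<otimes> (w \<otimes> a') \<otimes> g" using w(1) ab(1,3) g(1) by (simp add: m_ac)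
      also have "\<dots> = b" using w ab g by simp
      finally have "b = b' \<otimes> w \<otimes> a" using ab by simp
      then show ?thesis using w ab by blast
    next
      case 2
      then obtain w where w: "w \<in> carrier R" "w \<otimes> b' = \<one>" using dvr_nonunit[OF d t ab(3)] by blast
      have "a' \<otimes> w \<otimes> (b' \<otimes> g) = a' \<otimes> (w \<otimes> b') \<otimes> g" using w(1) ab(1,3) g(1) by (simp add: m_ac)
      also have "\<dots> = a" using w ab g by simp
      finally have "a = a' \<otimes> w \<otimes> b" using ab by simp
      then show ?thesis using w ab by blast
    qed
  qed
qed

text \<open>A generator \<open>g\<close> of \<open>I\<close> is divided by \<open>t\<close>. If the
  quotient \<open>h\<close> were in \<open>I\<close>, then \<open>h = w g = w h t\<close>, and
  \<open>t\<close> would be a unit. This reduces statements about all nonzero scalars to the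
  uniformizer, both for annihilators and for contracted primes.\<close>

lemma dvr_ideal_divide:
  assumes d: "discrete_valuation_ring R" and t: "uniformizer R t"
    and I: "ideal I R" "I \<noteq> carrier R" "a \<in> I" "a \<noteq> \<zero>"
  shows "\<exists>h\<in>carrier R. h \<notin> I \<and> h \<otimes> t \<in> I"
proof -
  have tc: "t \<in> carrier R" using t by (auto simp: uniformizer_def)
  obtain g where g: "g \<in> carrier R" "I = PIdl g" using exists_gen[OF I(1)] by blast
  have gI: "g \<in> I" using g cgenideal_self by simp
  have g0: "g \<noteq> \<zero>" using I(3,4) g by (auto simp: cgenideal_def)
  have "w \<otimes> g \<noteq> \<one>" if "w \<in> carrier R" for w
    using ideal.one_imp_carrier[OF I(1)] I(2) ideal.I_l_closed[OF I(1) gI that] by auto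
  then have "g \<in> PIdl t" by (rule dvr_nonunit[OF d t g(1)])
  then obtain h where h: "h \<in> carrier R" "g = h \<otimes> t" by (auto simp: cgenideal_def)
  have "h \<notin> I"
  proof
    assume "h \<in> I"
    then obtain w where w: "w \<in> carrier R" "h = w \<otimes> g" using g(2) by (auto simp: cgenideal_def)
    have "h \<otimes> (\<one> \<ominus> w \<otimes> t) = h \<ominus> w \<otimes> (h \<otimes> t)" using h(1) w(1) tc by algebra
    also have "w \<otimes> (h \<otimes> t) = h" using h(2) w(2) by metis
    also have "h \<ominus> h = \<zero>" using h(1) by algebra
    finally have "h = \<zero> \<or> \<one> \<ominus> w \<otimes> t = \<zero>" using integral[OF _ h(1)] w(1) tc by blast
    moreover have "h \<noteq> \<zero>" using g0 h(2) tc by auto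
    moreover have "\<one> = (\<one> \<ominus> w \<otimes> t) \<oplus> w \<otimes> t" using w(1) tc by algebra
    ultimately have "w \<otimes> t = \<one>" using w(1) tc by simp
    then show False by (rule uniformizer_not_unit[OF t w(1)])
  qed
  then show ?thesis using h gI by auto
qed

text \<open>The annihilator of a nonzero torsion element \<open>x\<close> is a proper nonzero ideal.
  Some \<open>h\<close> outside it has \<open>h t\<close> inside, so \<open>h x\<close> is nonzero
  and killed by \<open>t\<close>.\<close>

lemma torsion_free_of_uniformizer:
  assumes d: "discrete_valuation_ring R" and t: "uniformizer R t" and N: "module R N"
    and tf: "\<And>x. x \<in> carrier N \<Longrightarrow> t \<odot>\<^bsub>N\<^esub> x = \<zero>\<^bsub>N\<^esub> \<Longrightarrow> x = \<zero>\<^bsub>N\<^esub>"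
    and a: "a \<in> carrier R" "a \<noteq> \<zero>" and x: "x \<in> carrier N" "a \<odot>\<^bsub>N\<^esub> x = \<zero>\<^bsub>N\<^esub>"
  shows "x = \<zero>\<^bsub>N\<^esub>"
proof (rule ccontr)
  assume x0: "x \<noteq> \<zero>\<^bsub>N\<^esub>"
  interpret N: module R N by fact
  have tc: "t \<in> carrier R" using t by (auto simp: uniformizer_def)
  let ?I = "{a \<in> carrier R. a \<odot>\<^bsub>N\<^esub> x = \<zero>\<^bsub>N\<^esub>}"
  have I: "ideal ?I R"
    by (rule idealI_add_mult) (use x(1) in \<open>auto simp: N.smult_l_distr N.smult_assoc1\<close>)
  have "\<one> \<notin> ?I" using x(1) x0 by simp
  then have ne: "?I \<noteq> carrier R" by blast
  obtain h where h: "h \<in> carrier R" "h \<notin> ?I" "h \<otimes> t \<in> ?I"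
    using dvr_ideal_divide[OF d t I ne _ a(2)] a(1) x(2) by blast
  have "t \<odot>\<^bsub>N\<^esub> (h \<odot>\<^bsub>N\<^esub> x) = h \<otimes> t \<odot>\<^bsub>N\<^esub> x"
    using h tc x(1) by (simp add: N.smult_assoc1[symmetric] m_comm)
  also have "\<dots> = \<zero>\<^bsub>N\<^esub>" using h by simp
  finally have "h \<odot>\<^bsub>N\<^esub> x = \<zero>\<^bsub>N\<^esub>" using tf[of "h \<odot>\<^bsub>N\<^esub> x"] h x(1) by simp
  then show False using h by simp
qed

text \<open>\<open>c j\<close> is a coefficient of least valuation.\<close>

lemma dvr_common_divisor:
  assumes d: "discrete_valuation_ring R" and t: "uniformizer R t"
    and E: "finite E" "E \<noteq> {}" "\<And>e. e \<in> E \<Longrightarrow> c e \<in> carrier R"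
  shows "\<exists>j\<in>E. \<forall>i\<in>E. \<exists>q\<in>carrier R. c i = q \<otimes> c j"
  using E
proof (induction E rule: finite_ne_induct)
  case (singleton e)
  then have "c e = \<one> \<otimes> c e" by simp
  then show ?case by blast
next
  case (insert e E)
  then obtain j where j: "j \<in> E" "\<forall>i\<in>E. \<exists>q\<in>carrier R. c i = q \<otimes> c j" by blast
  have c: "c j \<in> carrier R" "c e \<in> carrier R" using j insert.prems by auto
  from dvr_divides_total[OF d t c] show ?case
  proof
    assume "\<exists>q\<in>carrier R. c j = q \<otimes> c e"
    then obtain q where q: "q \<in> carrier R" "c j = q \<otimes> c e" by blast
    have "\<exists>r\<in>carrier R. c i = r \<otimes> c e" if "i \<in> insert e E" for i
    proof (cases "i = e")
      case True
      then have "c i = \<one> \<otimes> c e" using c by simp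
      then show ?thesis by blast
    next
      case False
      then have "i \<in> E" using that by simp
      then obtain p where p: "p \<in> carrier R" "c i = p \<otimes> c j" using j(2) by blast
      have "c i = (p \<otimes> q) \<otimes> c e" unfolding p(2) q(2) using p(1) q(1) c(2) by (simp add: m_assoc)
      then show ?thesis using p q by blast
    qed
    then show ?thesis by blast
  next
    assume "\<exists>q\<in>carrier R. c e = q \<otimes> c j"
    then show ?thesis using j by blast
  qed
qed

end

subsection \<open>Finitely generated submodules\<close>

context module begin

text \<open>The elements of \<open>E\<close> index their own coefficients, so generating sets are
  sets instead of families.\<close>

definition comb :: "('c \<Rightarrow> 'a) \<Rightarrow> 'c set \<Rightarrow> 'c" where
  "comb c E = (\<Oplus>\<^bsub>M\<^esub>e\<in>E. c e \<odot>\<^bsub>M\<^esub> e)"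

definition lspan :: "'c set \<Rightarrow> 'c set" where
  "lspan E = {comb c E | c. c \<in> E \<rightarrow> carrier R}"

definition indep :: "'c set \<Rightarrow> bool" where
  "indep E \<longleftrightarrow> (\<forall>c\<in>E \<rightarrow> carrier R. comb c E = \<zero>\<^bsub>M\<^esub> \<longrightarrow> (\<forall>e\<in>E. c e = \<zero>))"

lemma comb_closed: "E \<subseteq> carrier M \<Longrightarrow> c \<in> E \<rightarrow> carrier R \<Longrightarrow> comb c E \<in> carrier M"
  unfolding comb_def by (rule M.finsum_closed) auto

lemma comb_add:
  "E \<subseteq> carrier M \<Longrightarrow> c \<in> E \<rightarrow> carrier R \<Longrightarrow> d \<in> E \<rightarrow> carrier R \<Longrightarrow>
   comb (\<lambda>e. c e \<oplus> d e) E = comb c E \<oplus>\<^bsub>M\<^esub> comb d E"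
proof -
  assume c: "E \<subseteq> carrier M" "c \<in> E \<rightarrow> carrier R" "d \<in> E \<rightarrow> carrier R"
  have "comb (\<lambda>e. c e \<oplus> d e) E = (\<Oplus>\<^bsub>M\<^esub>e\<in>E. c e \<odot>\<^bsub>M\<^esub> e \<oplus>\<^bsub>M\<^esub> d e \<odot>\<^bsub>M\<^esub> e)"
    unfolding comb_def using c by (intro M.finsum_cong') (auto simp: smult_l_distr Pi_def subset_iff)
  also have "\<dots> = comb c E \<oplus>\<^bsub>M\<^esub> comb d E"
    unfolding comb_def using c by (intro M.finsum_addf) (auto simp: Pi_def subset_iff)
  finally show ?thesis .
qed

lemma comb_smult:
  assumes "finite E" "E \<subseteq> carrier M" "c \<in> E \<rightarrow> carrier R" "a \<in> carrier R"
  shows "comb (\<lambda>e. a \<otimes> c e) E = a \<odot>\<^bsub>M\<^esub> comb c E"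
proof -
  have "a \<odot>\<^bsub>M\<^esub> comb c E = (\<Oplus>\<^bsub>M\<^esub>e\<in>E. a \<odot>\<^bsub>M\<^esub> (c e \<odot>\<^bsub>M\<^esub> e))"
    unfolding comb_def using assms by (intro finsum_smult_ldistr) auto
  also have "\<dots> = comb (\<lambda>e. a \<otimes> c e) E"
    unfolding comb_def using assms by (intro M.finsum_cong') (auto simp: smult_assoc1 Pi_def subset_iff)
  finally show ?thesis by simp
qed

lemma comb_insert:
  "finite E \<Longrightarrow> e \<notin> E \<Longrightarrow> insert e E \<subseteq> carrier M \<Longrightarrow> c \<in> insert e E \<rightarrow> carrier R \<Longrightarrow>
   comb c (insert e E) = c e \<odot>\<^bsub>M\<^esub> e \<oplus>\<^bsub>M\<^esub> comb c E"
  unfolding comb_def by (rule M.finsum_insert) (auto simp: Pi_def subset_iff)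

lemma comb_delta:
  assumes "finite E" "E \<subseteq> carrier M" "e \<in> E"
  shows "comb (\<lambda>x. if e = x then \<one> else \<zero>) E = e"
proof -
  have "comb (\<lambda>x. if e = x then \<one> else \<zero>) E = (\<Oplus>\<^bsub>M\<^esub>x\<in>E. if e = x then x else \<zero>\<^bsub>M\<^esub>)"
    unfolding comb_def using assms by (intro M.finsum_cong') (auto simp: subset_iff)
  also have "\<dots> = e" using assms by (intro M.finsum_singleton) auto
  finally show ?thesis .
qed

lemma lspan_mem: "finite E \<Longrightarrow> E \<subseteq> carrier M \<Longrightarrow> E \<subseteq> lspan E"
  unfolding lspan_def using comb_delta[symmetric] by fastforce

lemma lspan_carrier: "E \<subseteq> carrier M \<Longrightarrow> lspan E \<subseteq> carrier M"
  unfolding lspan_def using comb_closed by auto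

lemma lspan_add:
  assumes "E \<subseteq> carrier M" "x \<in> lspan E" "y \<in> lspan E" shows "x \<oplus>\<^bsub>M\<^esub> y \<in> lspan E"
proof -
  obtain c d where c: "c \<in> E \<rightarrow> carrier R" "x = comb c E" "d \<in> E \<rightarrow> carrier R" "y = comb d E"
    using assms unfolding lspan_def by blast
  then have "x \<oplus>\<^bsub>M\<^esub> y = comb (\<lambda>e. c e \<oplus> d e) E" using comb_add assms(1) by simp
  moreover have "(\<lambda>e. c e \<oplus> d e) \<in> E \<rightarrow> carrier R" using c by auto
  ultimately show ?thesis unfolding lspan_def by blast
qed

lemma lspan_smult:
  assumes "finite E" "E \<subseteq> carrier M" "x \<in> lspan E" "a \<in> carrier R" shows "a \<odot>\<^bsub>M\<^esub> x \<in> lspan E"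
proof -
  obtain c where c: "c \<in> E \<rightarrow> carrier R" "x = comb c E"
    using assms unfolding lspan_def by blast
  then have "a \<odot>\<^bsub>M\<^esub> x = comb (\<lambda>e. a \<otimes> c e) E" using comb_smult assms by simp
  moreover have "(\<lambda>e. a \<otimes> c e) \<in> E \<rightarrow> carrier R" using c assms(4) by auto
  ultimately show ?thesis unfolding lspan_def by blast
qed

lemma lspan_zero:
  assumes "E \<subseteq> carrier M" shows "\<zero>\<^bsub>M\<^esub> \<in> lspan E"
proof -
  have "comb (\<lambda>e. \<zero>) E = (\<Oplus>\<^bsub>M\<^esub>e\<in>E. \<zero>\<^bsub>M\<^esub>)"
    unfolding comb_def using assms by (intro M.finsum_cong') (auto simp: subset_iff)
  then show ?thesis unfolding lspan_def by (auto intro!: exI[of _ "\<lambda>e. \<zero>"])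
qed

lemma lspan_least:
  assumes K: "finite K" "K \<subseteq> carrier M" and E: "finite E" "E \<subseteq> lspan K"
  shows "lspan E \<subseteq> lspan K"
proof -
  have "comb c E \<in> lspan K" if "c \<in> E \<rightarrow> carrier R" for c
    using E that
  proof (induction E)
    case empty
    then show ?case using lspan_zero[OF K(2)] by (simp add: comb_def)
  next
    case (insert e E)
    have "insert e E \<subseteq> carrier M" using insert.prems(1) lspan_carrier[OF K(2)] by auto
    then have "comb c (insert e E) = c e \<odot>\<^bsub>M\<^esub> e \<oplus>\<^bsub>M\<^esub> comb c E"
      using insert by (intro comb_insert) auto
    moreover have "c e \<odot>\<^bsub>M\<^esub> e \<in> lspan K" using insert.prems by (intro lspan_smult K) auto
    moreover have "comb c E \<in> lspan K" using insert.prems by (intro insert.IH) auto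
    ultimately show ?case using lspan_add[OF K(2)] by simp
  qed
  then show ?thesis unfolding lspan_def by blast
qed

text \<open>A spanning set of least cardinality is independent: in a nontrivial relation the
  coefficient \<open>c j\<close> that divides all others is cancelled by torsion-freeness. The
  remaining relation has coefficient one at \<open>j\<close>, so \<open>j\<close> could be
  dropped.\<close>

lemma exists_basis:
  assumes d: "discrete_valuation_ring R" and t: "uniformizer R t"
    and tf: "\<And>a x. a \<in> carrier R \<Longrightarrow> a \<noteq> \<zero> \<Longrightarrow> x \<in> carrier M \<Longrightarrow> a \<odot>\<^bsub>M\<^esub> x = \<zero>\<^bsub>M\<^esub> \<Longrightarrow> x = \<zero>\<^bsub>M\<^esub>"
    and F: "finite F" "F \<subseteq> carrier M"
  shows "\<exists>E. finite E \<and> E \<subseteq> carrier M \<and> indep E \<and> F \<subseteq> lspan E"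
proof -
  interpret A: principal_domain R using d by (simp add: discrete_valuation_ring_def)
  let ?Z = "\<lambda>n. \<exists>E. finite E \<and> E \<subseteq> carrier M \<and> F \<subseteq> lspan E \<and> card E = n"
  have ex: "?Z (card F)" using F lspan_mem by blast
  define n where "n = (LEAST n. ?Z n)"
  have "?Z n" unfolding n_def using ex by (rule LeastI)
  then obtain E where E: "finite E" "E \<subseteq> carrier M" "F \<subseteq> lspan E" "card E = n" by blast
  have min: "n \<le> m" if "?Z m" for m unfolding n_def using that by (rule Least_le)
  have "indep E"
    unfolding indep_def
  proof (intro ballI impI, rule ccontr)
    fix c e0 assume c: "c \<in> E \<rightarrow> carrier R" "comb c E = \<zero>\<^bsub>M\<^esub>" and e0: "e0 \<in> E" "c e0 \<noteq> \<zero>"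
    have cc: "\<And>e. e \<in> E \<Longrightarrow> c e \<in> carrier R" using c by auto
    have "E \<noteq> {}" using e0(1) by auto
    from A.dvr_common_divisor[OF d t E(1) this, of c] cc
    obtain j where j: "j \<in> E" "\<forall>i\<in>E. \<exists>q\<in>carrier R. c i = q \<otimes> c j" by auto
    from bchoice[OF j(2)[unfolded Bex_def]]
    obtain q where q: "\<And>i. i \<in> E \<Longrightarrow> q i \<in> carrier R \<and> c i = q i \<otimes> c j" by auto
    have cj: "c j \<in> carrier R" "c j \<noteq> \<zero>" using q[OF e0(1)] e0(2) cc[OF j(1)] by auto
    let ?q = "q(j := \<one>)"
    have qE: "?q \<in> E \<rightarrow> carrier R" using q by auto
    have "c i = c j \<otimes> ?q i" if "i \<in> E" for i
    proof (cases "i = j")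
      case False
      have "c i = q i \<otimes> c j" using q[OF that] by simp
      also have "\<dots> = c j \<otimes> q i" using q[OF that] cj(1) by (intro R.m_comm) simp_all
      finally show ?thesis using False by simp
    qed (use cj in simp)
    then have "comb c E = comb (\<lambda>e. c j \<otimes> ?q e) E"
      unfolding comb_def using E(2) qE cj by (intro M.finsum_cong') (auto simp: Pi_def subset_iff split: if_splits)
    then have "c j \<odot>\<^bsub>M\<^esub> comb ?q E = \<zero>\<^bsub>M\<^esub>" using comb_smult[OF E(1,2) qE cj(1)] c(2) by simp
    then have z: "comb ?q E = \<zero>\<^bsub>M\<^esub>" by (rule tf[OF cj comb_closed[OF E(2) qE]])
    let ?E = "E - {j}"
    have E': "finite ?E" "?E \<subseteq> carrier M" "insert j ?E = E" "j \<notin> ?E" using E j(1) by auto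
    have jc: "j \<in> carrier M" using j E by auto
    have "?q \<in> ?E \<rightarrow> carrier R" using qE Pi_anti_mono[of ?E E] by blast
    then have s: "comb ?q ?E \<in> carrier M" "comb ?q ?E \<in> lspan ?E"
      using comb_closed[OF E'(2)] unfolding lspan_def by blast+
    have "comb ?q (insert j ?E) = ?q j \<odot>\<^bsub>M\<^esub> j \<oplus>\<^bsub>M\<^esub> comb ?q ?E"
      using E'(2) jc qE E'(3) by (intro comb_insert E'(1,4)) auto
    then have "j \<oplus>\<^bsub>M\<^esub> comb ?q ?E = \<zero>\<^bsub>M\<^esub>" using E'(3) z jc by simp
    then have "j = \<ominus>\<^bsub>M\<^esub> comb ?q ?E" using M.minus_equality[OF _ s(1) jc] by simp
    also have "\<dots> = (\<ominus> \<one>) \<odot>\<^bsub>M\<^esub> comb ?q ?E" using s(1) by (simp add: smult_l_minus)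
    also have "\<dots> \<in> lspan ?E" using lspan_smult[OF E'(1,2) s(2)] by simp
    finally have "E \<subseteq> lspan ?E" using lspan_mem[OF E'(1,2)] E'(3) by blast
    then have "F \<subseteq> lspan ?E" using lspan_least[OF E'(1,2) E(1)] E(3) by blast
    then have "n \<le> card ?E" using min E'(1,2) by blast
    then show False using E(1,4) j(1) by (metis card_Diff1_less not_le)
  qed
  then show ?thesis using E by blast
qed

text \<open>A choice of coefficients, determined on the span of an independent set and arbitrary
  elsewhere.\<close>

definition coord :: "'c set \<Rightarrow> 'c \<Rightarrow> 'c \<Rightarrow> 'a" where
  "coord E y = (SOME c. c \<in> E \<rightarrow> carrier R \<and> y = comb c E)"

lemma coord:
  assumes "y \<in> lspan E" shows "coord E y \<in> E \<rightarrow> carrier R" "y = comb (coord E y) E"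
proof -
  have "\<exists>c. c \<in> E \<rightarrow> carrier R \<and> y = comb c E" using assms unfolding lspan_def by blast
  from someI_ex[OF this] show "coord E y \<in> E \<rightarrow> carrier R" "y = comb (coord E y) E"
    unfolding coord_def by auto
qed

lemma comb_unique:
  assumes E: "finite E" "E \<subseteq> carrier M" "indep E" and c: "c \<in> E \<rightarrow> carrier R" "d \<in> E \<rightarrow> carrier R"
    and e: "comb c E = comb d E" "e \<in> E"
  shows "c e = d e"
proof -
  let ?d = "\<lambda>e. \<ominus> \<one> \<otimes> d e"
  have dd: "?d \<in> E \<rightarrow> carrier R" using c by auto
  have "comb (\<lambda>e. c e \<oplus> ?d e) E = comb c E \<oplus>\<^bsub>M\<^esub> (\<ominus> \<one>) \<odot>\<^bsub>M\<^esub> comb d E"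
    using comb_add[OF E(2) c(1) dd] comb_smult[OF E(1,2) c(2)] by simp
  also have "\<dots> = \<zero>\<^bsub>M\<^esub>" using e comb_closed[OF E(2) c(2)] by (simp add: smult_l_minus M.r_neg)
  finally have z: "comb (\<lambda>e. c e \<oplus> ?d e) E = \<zero>\<^bsub>M\<^esub>" .
  have "(\<lambda>e. c e \<oplus> ?d e) \<in> E \<rightarrow> carrier R" using c dd by auto
  with E(3) z have "\<forall>e\<in>E. c e \<oplus> ?d e = \<zero>" unfolding indep_def by blast
  then have "c e \<oplus> ?d e = \<zero>" using e(2) by blast
  moreover have "c e \<in> carrier R" "d e \<in> carrier R" using c e(2) by auto
  moreover from this have "c e = (c e \<oplus> ?d e) \<oplus> d e" by algebra
  ultimately show ?thesis by simp
qed

lemma coord_add: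
  assumes E: "finite E" "E \<subseteq> carrier M" "indep E" and x: "x \<in> lspan E" "y \<in> lspan E" and e: "e \<in> E"
  shows "coord E (x \<oplus>\<^bsub>M\<^esub> y) e = coord E x e \<oplus> coord E y e"
proof -
  have s: "x \<oplus>\<^bsub>M\<^esub> y \<in> lspan E" using lspan_add E x by simp
  have "comb (coord E (x \<oplus>\<^bsub>M\<^esub> y)) E = comb (\<lambda>e. coord E x e \<oplus> coord E y e) E"
    using coord[OF x(1)] coord[OF x(2)] coord[OF s] comb_add[OF E(2) coord(1)[OF x(1)] coord(1)[OF x(2)]] by simp
  then show ?thesis
    using coord[OF x(1)] coord[OF x(2)] by (intro comb_unique[OF E coord(1)[OF s] _ _ e]) auto
qed

lemma coord_smult:
  assumes E: "finite E" "E \<subseteq> carrier M" "indep E" and x: "x \<in> lspan E" and a: "a \<in> carrier R" and e: "e \<in> E"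
  shows "coord E (a \<odot>\<^bsub>M\<^esub> x) e = a \<otimes> coord E x e"
proof -
  have s: "a \<odot>\<^bsub>M\<^esub> x \<in> lspan E" using lspan_smult E x a by simp
  have "comb (coord E (a \<odot>\<^bsub>M\<^esub> x)) E = comb (\<lambda>e. a \<otimes> coord E x e) E"
    using coord[OF x] coord[OF s] comb_smult[OF E(1,2) coord(1)[OF x] a] by simp
  then show ?thesis
    using coord[OF x] a by (intro comb_unique[OF E coord(1)[OF s] _ _ e]) auto
qed

end

subsection \<open>Torsion-free modules are flat\<close>

context two_modules begin

lemma K_sum: "finite E \<Longrightarrow> (\<And>e. e \<in> E \<Longrightarrow> g e \<in> K) \<Longrightarrow> sum g E \<in> K"
  by (induction E rule: finite_induct) (auto intro: K_zero K_add)

text \<open>The coordinate map that sends \<open>m \<otimes> y\<close> to the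
  \<open>e\<close>-coordinate of \<open>y\<close> times \<open>m\<close>, lifted to the free abelian
  group. It is prescribed only for \<open>y\<close> in the span of \<open>E\<close>, which need not
  be all of \<open>N\<close>, so it may fail to vanish on relations that leave the span.\<close>

definition coord_hom :: "'e set \<Rightarrow> 'e \<Rightarrow> (('c \<times> 'e \<Rightarrow>\<^sub>0 int) \<Rightarrow> 'c) \<Rightarrow> bool" where
  "coord_hom E e h \<longleftrightarrow> (\<forall>x. Poly_Mapping.keys x \<subseteq> S \<longrightarrow> h x \<in> carrier M) \<and>
    (\<forall>m\<in>carrier M. \<forall>y\<in>N.lspan E. h (frag_of (m, y)) = N.coord E y e \<odot>\<^bsub>M\<^esub> m) \<and>
    (\<forall>x y. Poly_Mapping.keys x \<subseteq> S \<longrightarrow> Poly_Mapping.keys y \<subseteq> S \<longrightarrow> h (x + y) = h x \<oplus>\<^bsub>M\<^esub> h y) \<and>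
    (\<forall>x. Poly_Mapping.keys x \<subseteq> S \<longrightarrow> h (- x) = \<ominus>\<^bsub>M\<^esub> h x) \<and> h 0 = \<zero>\<^bsub>M\<^esub> \<and>
    (\<forall>x y. Poly_Mapping.keys x \<subseteq> S \<longrightarrow> Poly_Mapping.keys y \<subseteq> S \<longrightarrow> h (x - y) = h x \<ominus>\<^bsub>M\<^esub> h y)"

lemma coord_homD:
  assumes "coord_hom E e h"
  shows "Poly_Mapping.keys x \<subseteq> S \<Longrightarrow> h x \<in> carrier M"
    "m \<in> carrier M \<Longrightarrow> y \<in> N.lspan E \<Longrightarrow> h (frag_of (m, y)) = N.coord E y e \<odot>\<^bsub>M\<^esub> m"
    "Poly_Mapping.keys x \<subseteq> S \<Longrightarrow> Poly_Mapping.keys x' \<subseteq> S \<Longrightarrow> h (x + x') = h x \<oplus>\<^bsub>M\<^esub> h x'"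
    "Poly_Mapping.keys x \<subseteq> S \<Longrightarrow> h (- x) = \<ominus>\<^bsub>M\<^esub> h x" "h 0 = \<zero>\<^bsub>M\<^esub>"
    "Poly_Mapping.keys x \<subseteq> S \<Longrightarrow> Poly_Mapping.keys x' \<subseteq> S \<Longrightarrow> h (x - x') = h x \<ominus>\<^bsub>M\<^esub> h x'"
  using assms unfolding coord_hom_def by simp_all

lemma exists_coord_hom:
  assumes "E \<subseteq> carrier N" "e \<in> E"
  shows "\<exists>h. coord_hom E e h"
proof -
  \<comment> \<open>Zero is a default value outside the span; on a free group any values on the
    generators define a homomorphism.\<close>
  let ?f = "\<lambda>(m, y). if y \<in> N.lspan E then N.coord E y e \<odot>\<^bsub>M\<^esub> m else \<zero>\<^bsub>M\<^esub>"
  have "N.coord E y e \<in> carrier A" if "y \<in> N.lspan E" for y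
    using N.coord(1)[OF that] assms(2) by auto
  then have c: "?f ` S \<subseteq> carrier M" by auto
  obtain h where h:
    "\<And>x. Poly_Mapping.keys x \<subseteq> S \<Longrightarrow> h x \<in> carrier M" "\<And>x. x \<in> S \<Longrightarrow> h (frag_of x) = ?f x"
    "\<And>x y. Poly_Mapping.keys x \<subseteq> S \<Longrightarrow> Poly_Mapping.keys y \<subseteq> S \<Longrightarrow> h (x + y) = h x \<oplus>\<^bsub>M\<^esub> h y"
    "\<And>x. Poly_Mapping.keys x \<subseteq> S \<Longrightarrow> h (- x) = \<ominus>\<^bsub>M\<^esub> h x" "h 0 = \<zero>\<^bsub>M\<^esub>"
    "\<And>x y. Poly_Mapping.keys x \<subseteq> S \<Longrightarrow> Poly_Mapping.keys y \<subseteq> S \<Longrightarrow> h (x - y) = h x \<ominus>\<^bsub>M\<^esub> h y"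
    by (rule frag_hom_exists[OF M.M.abelian_group_axioms c]) (rule that)
  have "h (frag_of (m, y)) = N.coord E y e \<odot>\<^bsub>M\<^esub> m" if "m \<in> carrier M" "y \<in> N.lspan E" for m y
    using h(2)[of "(m, y)"] that N.lspan_carrier[OF assms(1)] by auto
  with h show ?thesis unfolding coord_hom_def by (intro exI[of _ h]) simp
qed

text \<open>An element of the kernel is a combination of relations that involve only finitely many elements
  of \<open>N\<close>, so it vanishes in every coordinate with respect to a basis of a submodule containing these.\<close>

lemma kernel_coord_zero:
  assumes "w \<in> K"
  shows "\<exists>F. finite F \<and> F \<subseteq> carrier N \<and> (\<forall>E e h. finite E \<longrightarrow> E \<subseteq> carrier N \<longrightarrow> N.indep E \<longrightarrow>
    F \<subseteq> N.lspan E \<longrightarrow> e \<in> E \<longrightarrow> coord_hom E e h \<longrightarrow> h w = \<zero>\<^bsub>M\<^esub>)"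
    (is "\<exists>F. finite F \<and> F \<subseteq> carrier N \<and> ?Z F w")
  using assms
proof (induction rule: K_induct)
  case zero
  have "?Z {} 0" using coord_homD(5) by blast
  then show ?case by blast
next
  case (relation r)
  have e: "u \<ominus>\<^bsub>M\<^esub> v \<ominus>\<^bsub>M\<^esub> w = \<zero>\<^bsub>M\<^esub>"
    if "u = v \<oplus>\<^bsub>M\<^esub> w" "v \<in> carrier M" "w \<in> carrier M" for u v w
  proof -
    have "u \<ominus>\<^bsub>M\<^esub> v = w" using that by (metis M.M.a_comm M.M.add.inv_solve_right M.M.a_closed a_minus_def)
    then show ?thesis using that by (simp add: a_minus_def M.M.r_neg)
  qed
  from relation show ?case
  proof (cases rule: tensor_relationsE)
    case (left x x' y)
    have "?Z {y} r"
    proof (intro allI impI)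
      fix E e h assume E: "finite E" "E \<subseteq> carrier N" "N.indep E" "{y} \<subseteq> N.lspan E" "e \<in> E" and h: "coord_hom E e h"
      have y: "y \<in> N.lspan E" using E by simp
      then have c: "N.coord E y e \<in> carrier A" using N.coord(1) E(5) by blast
      have "h r = h (frag_of (x \<oplus>\<^bsub>M\<^esub> x', y)) \<ominus>\<^bsub>M\<^esub> h (frag_of (x, y)) \<ominus>\<^bsub>M\<^esub> h (frag_of (x', y))"
        using left by (simp add: coord_homD(6)[OF h] keys_frag_of keys_diff_subset)
      also have "\<dots> = \<zero>\<^bsub>M\<^esub>"
        using left y c by (intro e) (simp_all add: coord_homD(2)[OF h] M.smult_r_distr)
      finally show "h r = \<zero>\<^bsub>M\<^esub>" .
    qed
    moreover have "finite {y}" "{y} \<subseteq> carrier N" using left by auto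
    ultimately show ?thesis by (intro exI[of _ "{y}"] conjI)
  next
    case (right x y y')
    have "?Z {y, y'} r"
    proof (intro allI impI)
      fix E e h assume E: "finite E" "E \<subseteq> carrier N" "N.indep E" "{y, y'} \<subseteq> N.lspan E" "e \<in> E" and h: "coord_hom E e h"
      have y: "y \<in> N.lspan E" "y' \<in> N.lspan E" using E by simp_all
      then have yy: "y \<oplus>\<^bsub>N\<^esub> y' \<in> N.lspan E" using N.lspan_add[OF E(2)] by simp
      have c: "N.coord E y e \<in> carrier A" "N.coord E y' e \<in> carrier A" using N.coord(1) y E(5) by blast+
      have "h r = h (frag_of (x, y \<oplus>\<^bsub>N\<^esub> y')) \<ominus>\<^bsub>M\<^esub> h (frag_of (x, y)) \<ominus>\<^bsub>M\<^esub> h (frag_of (x, y'))"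
        using right by (simp add: coord_homD(6)[OF h] keys_frag_of keys_diff_subset)
      also have "\<dots> = \<zero>\<^bsub>M\<^esub>"
        using right y yy c
        by (intro e) (simp_all add: coord_homD(2)[OF h] M.smult_l_distr N.coord_add[OF E(1-3) y E(5)])
      finally show "h r = \<zero>\<^bsub>M\<^esub>" .
    qed
    moreover have "finite {y, y'}" "{y, y'} \<subseteq> carrier N" using right by auto
    ultimately show ?thesis by (intro exI[of _ "{y, y'}"] conjI)
  next
    case (smult a x y)
    have "?Z {y} r"
    proof (intro allI impI)
      fix E e h assume E: "finite E" "E \<subseteq> carrier N" "N.indep E" "{y} \<subseteq> N.lspan E" "e \<in> E" and h: "coord_hom E e h"
      have y: "y \<in> N.lspan E" using E by simp
      then have ay: "a \<odot>\<^bsub>N\<^esub> y \<in> N.lspan E" using N.lspan_smult[OF E(1,2)] smult by simp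
      have c: "N.coord E y e \<in> carrier A" using N.coord(1)[OF y] E(5) by blast
      have "h r = h (frag_of (a \<odot>\<^bsub>M\<^esub> x, y)) \<ominus>\<^bsub>M\<^esub> h (frag_of (x, a \<odot>\<^bsub>N\<^esub> y))"
        using smult by (simp add: coord_homD(6)[OF h] keys_frag_of)
      also have "h (frag_of (a \<odot>\<^bsub>M\<^esub> x, y)) = h (frag_of (x, a \<odot>\<^bsub>N\<^esub> y))"
        using smult y ay c M.smult_assoc1[of "N.coord E y e" a x] M.R.m_comm[of a "N.coord E y e"]
        by (simp add: coord_homD(2)[OF h] N.coord_smult[OF E(1-3) y _ E(5)])
      also have "h (frag_of (x, a \<odot>\<^bsub>N\<^esub> y)) \<ominus>\<^bsub>M\<^esub> h (frag_of (x, a \<odot>\<^bsub>N\<^esub> y)) = \<zero>\<^bsub>M\<^esub>"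
        using coord_homD(1)[OF h, of "frag_of (x, a \<odot>\<^bsub>N\<^esub> y)"] smult by (simp add: keys_frag_of a_minus_def M.M.r_neg)
      finally show "h r = \<zero>\<^bsub>M\<^esub>" .
    qed
    moreover have "finite {y}" "{y} \<subseteq> carrier N" using smult by auto
    ultimately show ?thesis by (intro exI[of _ "{y}"] conjI)
  qed
next
  case (minus x)
  then obtain F where F: "finite F" "F \<subseteq> carrier N" "?Z F x" by blast
  have "?Z F (- x)"
  proof (intro allI impI)
    fix E e h assume E: "finite E" "E \<subseteq> carrier N" "N.indep E" "F \<subseteq> N.lspan E" "e \<in> E" and h: "coord_hom E e h"
    have "h x = \<zero>\<^bsub>M\<^esub>" using F(3)[rule_format, OF E h] .
    then show "h (- x) = \<zero>\<^bsub>M\<^esub>" using coord_homD(4)[OF h K_keys[OF minus(1)]] by simp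
  qed
  then show ?case using F(1,2) by (intro exI[of _ F] conjI)
next
  case (add x y)
  from add(3) obtain F where F: "finite F" "F \<subseteq> carrier N" "?Z F x" by (elim exE conjE)
  from add(4) obtain F' where F': "finite F'" "F' \<subseteq> carrier N" "?Z F' y" by (elim exE conjE)
  have "?Z (F \<union> F') (x + y)"
  proof (intro allI impI)
    fix E e h assume E: "finite E" "E \<subseteq> carrier N" "N.indep E" "F \<union> F' \<subseteq> N.lspan E" "e \<in> E" and h: "coord_hom E e h"
    have s: "F \<subseteq> N.lspan E" "F' \<subseteq> N.lspan E" using E(4) by auto
    have "h x = \<zero>\<^bsub>M\<^esub>" "h y = \<zero>\<^bsub>M\<^esub>"
      using F(3)[rule_format, OF E(1-3) s(1) E(5) h] F'(3)[rule_format, OF E(1-3) s(2) E(5) h] by auto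
    then show "h (x + y) = \<zero>\<^bsub>M\<^esub>" using coord_homD(3)[OF h K_keys[OF add(1)] K_keys[OF add(2)]] by simp
  qed
  moreover have "finite (F \<union> F')" "F \<union> F' \<subseteq> carrier N" using F(1,2) F'(1,2) by auto
  ultimately show ?case by (intro exI[of _ "F \<union> F'"] conjI)
qed

lemma frag_of_comb:
  assumes "finite E" "E \<subseteq> carrier N" "c \<in> E \<rightarrow> carrier A" "m \<in> carrier M"
  shows "frag_of (m, N.comb c E) - (\<Sum>e\<in>E. frag_of (c e \<odot>\<^bsub>M\<^esub> m, e)) \<in> K"
  using assms(1-3)
proof (induction E)
  case empty
  then show ?case using zero_right[OF assms(4)] by (simp add: N.comb_def)
next
  case (insert e E)
  have c: "e \<in> carrier N" "E \<subseteq> carrier N" "c e \<in> carrier A" "c \<in> E \<rightarrow> carrier A" using insert.prems by auto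
  have e: "N.comb c (insert e E) = c e \<odot>\<^bsub>N\<^esub> e \<oplus>\<^bsub>N\<^esub> N.comb c E"
    by (rule N.comb_insert[OF insert.hyps insert.prems])
  have 1: "frag_of (m, N.comb c (insert e E)) - frag_of (m, c e \<odot>\<^bsub>N\<^esub> e) - frag_of (m, N.comb c E) \<in> K"
    unfolding e using c by (intro rel_right assms(4) N.comb_closed) auto
  have 2: "frag_of (c e \<odot>\<^bsub>M\<^esub> m, e) - frag_of (m, c e \<odot>\<^bsub>N\<^esub> e) \<in> K"
    by (rule rel_smult[OF c(3) assms(4) c(1)])
  have 3: "frag_of (m, N.comb c E) - (\<Sum>e\<in>E. frag_of (c e \<odot>\<^bsub>M\<^esub> m, e)) \<in> K"
    using insert.IH c by simp
  show ?case using K_add[OF K_diff[OF 1 2] 3] insert.hyps by (simp add: algebra_simps)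
qed

text \<open>In the tensor product \<open>w\<close> is the sum of its coordinates tensored with the
  elements of \<open>E\<close>. By additivity this reduces to a single \<open>m \<otimes> y\<close>,
  where \<open>y\<close> is written as a combination of \<open>E\<close>.\<close>

lemma coord_expansion:
  assumes E: "finite E" "E \<subseteq> carrier N" and h: "\<And>e. e \<in> E \<Longrightarrow> coord_hom E e (h e)"
    and w: "Poly_Mapping.keys w \<subseteq> carrier M \<times> N.lspan E"
  shows "w - (\<Sum>e\<in>E. frag_of (h e w, e)) \<in> K"
  using w
proof (induction w rule: free_Abelian_group_induct[consumes 1])
  case 1
  have "(\<Sum>e\<in>E. frag_of (h e 0, e)) \<in> K"
  proof (rule K_sum[OF E(1)])
    fix e assume e: "e \<in> E"
    then have "e \<in> carrier N" using E(2) by auto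
    then show "frag_of (h e 0, e) \<in> K" using coord_homD(5)[OF h[OF e]] zero_left by simp
  qed
  then show ?case using K_neg by fastforce
next
  case (2 x y)
  have sub: "carrier M \<times> N.lspan E \<subseteq> S" using N.lspan_carrier[OF E(2)] by auto
  have k: "Poly_Mapping.keys x \<subseteq> S" "Poly_Mapping.keys y \<subseteq> S" using 2(1,2) sub by blast+
  have "(\<Sum>e\<in>E. frag_of (h e x, e) - frag_of (h e y, e) - frag_of (h e (x - y), e)) \<in> K"
  proof (rule K_sum[OF E(1)])
    fix e assume e: "e \<in> E"
    then have "e \<in> carrier N" using E(2) by auto
    then show "frag_of (h e x, e) - frag_of (h e y, e) - frag_of (h e (x - y), e) \<in> K"
      unfolding coord_homD(6)[OF h[OF e] k]
      by (intro diff_left coord_homD(1)[OF h[OF e]] k)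
  qed
  from K_add[OF K_diff[OF 2(3,4)] this] show ?case unfolding sum_subtractf by simp
next
  case (3 a)
  obtain m y where a: "a = (m, y)" "m \<in> carrier M" "y \<in> N.lspan E" using 3 by auto
  have "frag_of (m, N.comb (N.coord E y) E) - (\<Sum>e\<in>E. frag_of (N.coord E y e \<odot>\<^bsub>M\<^esub> m, e)) \<in> K"
    by (rule frag_of_comb[OF E N.coord(1)[OF a(3)] a(2)])
  moreover have "(\<Sum>e\<in>E. frag_of (N.coord E y e \<odot>\<^bsub>M\<^esub> m, e)) = (\<Sum>e\<in>E. frag_of (h e (frag_of (m, y)), e))"
    using coord_homD(2)[OF h a(2,3)] by (intro sum.cong) auto
  ultimately show ?case using N.coord(2)[OF a(3)] a(1) by simp
qed

end

text \<open>If \<open>f \<otimes> id\<close> kills \<open>w\<close>, all coordinates of the image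
  vanish. Coordinates commute with \<open>f\<close>, so \<open>f\<close> kills the coordinates of
  \<open>w\<close>; these vanish by injectivity, and with them \<open>w\<close>.\<close>

theorem torsion_free_flat_module:
  assumes d: "discrete_valuation_ring A" and t: "uniformizer A t" and N: "module A N"
    and tf: "\<And>x. x \<in> carrier N \<Longrightarrow> t \<odot>\<^bsub>N\<^esub> x = \<zero>\<^bsub>N\<^esub> \<Longrightarrow> x = \<zero>\<^bsub>N\<^esub>"
  shows "flat_module TYPE('u) A N"
  unfolding flat_module_def
proof (intro conjI allI impI N)
  fix M M' :: "('a, 'a + 'u) module" and f
  assume a: "module A M \<and> module A M' \<and> f \<in> module_hom A M M' \<and> inj_on f (carrier M)"
  then have M: "module A M" "module A M'" and f: "f \<in> module_hom A M M'" and inj: "inj_on f (carrier M)" by auto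
  interpret A: principal_domain A using d by (simp add: discrete_valuation_ring_def)
  interpret T: two_modules A M N using M N by (simp add: two_modules_def)
  interpret T': two_modules A M' N using M N by (simp add: two_modules_def)
  note fD = module_homD[OF f]
  have f0: "f \<zero>\<^bsub>M\<^esub> = \<zero>\<^bsub>M'\<^esub>"
    using fD(3)[of "\<zero>\<^bsub>A\<^esub>" "\<zero>\<^bsub>M\<^esub>"] fD(1)[of "\<zero>\<^bsub>M\<^esub>"] by simp
  have fd: "f (x \<ominus>\<^bsub>M\<^esub> y) = f x \<ominus>\<^bsub>M'\<^esub> f y" if "x \<in> carrier M" "y \<in> carrier M" for x y
  proof -
    have "\<ominus>\<^bsub>M\<^esub> y = (\<ominus>\<^bsub>A\<^esub> \<one>\<^bsub>A\<^esub>) \<odot>\<^bsub>M\<^esub> y" using that by (simp add: T.M.smult_l_minus)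
    then have "f (x \<ominus>\<^bsub>M\<^esub> y) = f x \<oplus>\<^bsub>M'\<^esub> (\<ominus>\<^bsub>A\<^esub> \<one>\<^bsub>A\<^esub>) \<odot>\<^bsub>M'\<^esub> f y"
      using that fD(2)[of x "(\<ominus>\<^bsub>A\<^esub> \<one>\<^bsub>A\<^esub>) \<odot>\<^bsub>M\<^esub> y"] fD(3)[of "\<ominus>\<^bsub>A\<^esub> \<one>\<^bsub>A\<^esub>" y] by (simp add: a_minus_def)
    then show ?thesis using fD(1)[OF that(2)] by (simp add: T'.M.smult_l_minus a_minus_def)
  qed
  show "inj_on (tensor_map A M N f M') (carrier (tensor_product A M N))"
    unfolding inj_tensor_map_iff[OF M N f]
  proof (intro allI impI)
    fix w assume w: "Poly_Mapping.keys w \<subseteq> T.S" "frag_map f w \<in> T'.K"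
    obtain F where F: "finite F" "F \<subseteq> carrier N"
      and z: "\<And>E e h. finite E \<Longrightarrow> E \<subseteq> carrier N \<Longrightarrow> T.N.indep E \<Longrightarrow> F \<subseteq> T.N.lspan E \<Longrightarrow> e \<in> E \<Longrightarrow>
        T'.coord_hom E e h \<Longrightarrow> h (frag_map f w) = \<zero>\<^bsub>M'\<^esub>"
      using T'.kernel_coord_zero[OF w(2)] by (elim exE conjE) (simp only:)
    \<comment> \<open>The span must contain the elements of \<open>N\<close> behind the relations in
      \<open>M' \<otimes> N\<close>, and also the second components of \<open>w\<close>, so that
      \<open>w\<close> itself can be expanded.\<close>
    let ?F = "F \<union> snd ` Poly_Mapping.keys w"
    have FF: "finite ?F" "?F \<subseteq> carrier N" using F w(1) by auto
    have "\<exists>E. finite E \<and> E \<subseteq> carrier N \<and> T.N.indep E \<and> ?F \<subseteq> T.N.lspan E"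
    proof (rule T.N.exists_basis[OF d t _ FF])
      show "x = \<zero>\<^bsub>N\<^esub>" if "a \<in> carrier A" "a \<noteq> \<zero>\<^bsub>A\<^esub>" "x \<in> carrier N" "a \<odot>\<^bsub>N\<^esub> x = \<zero>\<^bsub>N\<^esub>" for a x
        by (rule A.torsion_free_of_uniformizer[OF d t N tf that])
    qed
    then obtain E where E: "finite E" "E \<subseteq> carrier N" "T.N.indep E" "?F \<subseteq> T.N.lspan E" by (elim exE conjE)
    have kw: "Poly_Mapping.keys w \<subseteq> carrier M \<times> T.N.lspan E" using E(4) w(1) by force
    have "\<forall>e\<in>E. \<exists>h. T.coord_hom E e h" using T.exists_coord_hom[OF E(2)] by simp
    from bchoice[OF this] obtain h where h: "\<And>e. e \<in> E \<Longrightarrow> T.coord_hom E e (h e)" by auto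
    have h0: "h e w = \<zero>\<^bsub>M\<^esub>" if e: "e \<in> E" for e
    proof -
      obtain h' where h': "T'.coord_hom E e h'" using T'.exists_coord_hom[OF E(2) e] by blast
      note hD = T.coord_homD[OF h[OF e]] and hD' = T'.coord_homD[OF h']
      have sub: "carrier M \<times> T.N.lspan E \<subseteq> T.S" using T.N.lspan_carrier[OF E(2)] by auto
      have fk: "Poly_Mapping.keys (frag_map f u) \<subseteq> T'.S" if "Poly_Mapping.keys u \<subseteq> T.S" for u
      proof
        fix v assume "v \<in> Poly_Mapping.keys (frag_map f u)"
        then have "v \<in> (\<Union>p\<in>Poly_Mapping.keys u. Poly_Mapping.keys (case p of (x, y) \<Rightarrow> frag_of (f x, y)))"
          unfolding frag_map_def by (rule subsetD[OF keys_frag_extend])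
        then obtain p where p: "p \<in> Poly_Mapping.keys u" "v \<in> Poly_Mapping.keys (case p of (x, y) \<Rightarrow> frag_of (f x, y))"
          by (rule UN_E)
        obtain x y where xy: "p = (x, y)" by (cases p)
        have "x \<in> carrier M" "y \<in> carrier N" using that p(1) xy by auto
        then show "v \<in> T'.S" using p(2) xy fD(1) by (simp add: keys_frag_of)
      qed
      have "h' (frag_map f w) = f (h e w)"
        using kw
      proof (induction w rule: free_Abelian_group_induct[consumes 1])
        case 1
        then show ?case using hD(5) hD'(5) f0 by simp
      next
        case (2 x y)
        then have k: "Poly_Mapping.keys x \<subseteq> T.S" "Poly_Mapping.keys y \<subseteq> T.S" using sub by blast+
        have "h' (frag_map f (x - y)) = h' (frag_map f x) \<ominus>\<^bsub>M'\<^esub> h' (frag_map f y)"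
          using hD'(6)[OF fk[OF k(1)] fk[OF k(2)]] by simp
        also have "\<dots> = f (h e x \<ominus>\<^bsub>M\<^esub> h e y)" using 2(3,4) fd hD(1) k by simp
        also have "h e x \<ominus>\<^bsub>M\<^esub> h e y = h e (x - y)" using hD(6)[OF k] by simp
        finally show ?case .
      next
        case (3 a)
        then obtain m y where a: "a = (m, y)" "m \<in> carrier M" "y \<in> T.N.lspan E" by auto
        have "T.N.coord E y e \<in> carrier A" using T.N.coord(1)[OF a(3)] e by blast
        then show ?case using a hD(2)[OF a(2,3)] hD'(2)[OF fD(1)[OF a(2)] a(3)] fD(3) by simp
      qed
      moreover have "h' (frag_map f w) = \<zero>\<^bsub>M'\<^esub>" using z[OF E(1-3) _ e h'] E(4) by simp
      ultimately have "f (h e w) = f \<zero>\<^bsub>M\<^esub>" using f0 by simp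
      then show ?thesis using inj_onD[OF inj] hD(1)[OF w(1)] by simp
    qed
    have "(\<Sum>e\<in>E. frag_of (h e w, e)) \<in> T.K"
    proof (rule T.K_sum[OF E(1)])
      fix e assume "e \<in> E"
      then show "frag_of (h e w, e) \<in> T.K" using h0 T.zero_left E(2) by auto
    qed
    moreover have "w - (\<Sum>e\<in>E. frag_of (h e w, e)) \<in> T.K" using T.coord_expansion[OF E(1,2) h kw] .
    ultimately show "w \<in> T.K" using T.K_add by fastforce
  qed
qed

section \<open>Quotient rings\<close>

context cring begin

lemma quot_facts:
  assumes I: "ideal I R"
  shows "cring (R Quot I)" "\<zero>\<^bsub>R Quot I\<^esub> = I" "carrier (R Quot I) = (\<lambda>x. I +> x) ` carrier R"
    "\<And>x. x \<in> carrier R \<Longrightarrow> I +> x \<in> carrier (R Quot I)"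
    "\<And>x y. x \<in> carrier R \<Longrightarrow> y \<in> carrier R \<Longrightarrow> (I +> x) \<otimes>\<^bsub>R Quot I\<^esub> (I +> y) = I +> x \<otimes> y"
    "\<And>x y. x \<in> carrier R \<Longrightarrow> y \<in> carrier R \<Longrightarrow> (I +> x) \<oplus>\<^bsub>R Quot I\<^esub> (I +> y) = I +> (x \<oplus> y)"
    "\<one>\<^bsub>R Quot I\<^esub> = I +> \<one>"
    "\<And>x. x \<in> carrier R \<Longrightarrow> I +> x = I \<longleftrightarrow> x \<in> I"
proof -
  interpret I: ideal I R by fact
  show "cring (R Quot I)" using I.quotient_is_cring[OF is_cring] .
  show z: "\<zero>\<^bsub>R Quot I\<^esub> = I" by (simp add: FactRing_def)
  show "carrier (R Quot I) = (\<lambda>x. I +> x) ` carrier R" by (auto simp: FactRing_def A_RCOSETS_def')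
  have h: "(+>) I \<in> ring_hom R (R Quot I)" by (rule I.rcos_ring_hom)
  show "\<And>x. x \<in> carrier R \<Longrightarrow> I +> x \<in> carrier (R Quot I)" by (rule ring_hom_closed[OF h])
  show "\<And>x y. x \<in> carrier R \<Longrightarrow> y \<in> carrier R \<Longrightarrow> (I +> x) \<otimes>\<^bsub>R Quot I\<^esub> (I +> y) = I +> x \<otimes> y"
    using ring_hom_mult[OF h] by simp
  show "\<And>x y. x \<in> carrier R \<Longrightarrow> y \<in> carrier R \<Longrightarrow> (I +> x) \<oplus>\<^bsub>R Quot I\<^esub> (I +> y) = I +> (x \<oplus> y)"
    using ring_hom_add[OF h] by simp
  show "\<one>\<^bsub>R Quot I\<^esub> = I +> \<one>" using ring_hom_one[OF h] by simp
  show "I +> x = I \<longleftrightarrow> x \<in> I" if x: "x \<in> carrier R" for x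
    using I.rcos_const_imp_mem[OF x] I.a_rcos_const[of x] by blast
qed

lemma prime_preimage_quot:
  assumes I: "ideal I R" and Q: "primeideal Q (R Quot I)"
  shows "primeideal {x \<in> carrier R. I +> x \<in> Q} R" "I \<subseteq> {x \<in> carrier R. I +> x \<in> Q}"
proof -
  note q = quot_facts[OF I]
  interpret B: cring "R Quot I" by (rule q(1))
  have iQ: "ideal Q (R Quot I)" using Q primeideal.axioms(1) by auto
  show "primeideal {x \<in> carrier R. I +> x \<in> Q} R"
  proof (rule primeidealI)
    show "ideal {x \<in> carrier R. I +> x \<in> Q} R"
    proof (rule idealI_add_mult)
      show "\<zero> \<in> {x \<in> carrier R. I +> x \<in> Q}"
        using B.ideal_zero[OF iQ] q(2) q(8)[OF zero_closed] ideal_zero[OF I] by simp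
    next
      fix x y assume "x \<in> {x \<in> carrier R. I +> x \<in> Q}" "y \<in> {x \<in> carrier R. I +> x \<in> Q}"
      then show "x \<oplus> y \<in> {x \<in> carrier R. I +> x \<in> Q}"
        using B.ideal_add[OF iQ, of "I +> x" "I +> y"] q(6)[of x y] by simp
    next
      fix r x assume "r \<in> carrier R" "x \<in> {x \<in> carrier R. I +> x \<in> Q}"
      then show "r \<otimes> x \<in> {x \<in> carrier R. I +> x \<in> Q}"
        using ideal.I_l_closed[OF iQ, of "I +> x" "I +> r"] q(4)[of r] q(5)[of r x] by simp
    qed auto
    show "cring R" by (rule is_cring)
    show "carrier R \<noteq> {x \<in> carrier R. I +> x \<in> Q}"
      using primeideal_one[OF Q] q(7) one_closed by auto
    fix x y assume "x \<in> carrier R" "y \<in> carrier R" "x \<otimes> y \<in> {x \<in> carrier R. I +> x \<in> Q}"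
    then show "x \<in> {x \<in> carrier R. I +> x \<in> Q} \<or> y \<in> {x \<in> carrier R. I +> x \<in> Q}"
      using primeideal_mult[OF Q, of "I +> x" "I +> y"] q(4)[of x] q(4)[of y] q(5)[of x y] by simp
  qed
  show "I \<subseteq> {x \<in> carrier R. I +> x \<in> Q}"
  proof
    fix x assume "x \<in> I"
    then show "x \<in> {x \<in> carrier R. I +> x \<in> Q}"
      using ideal_carr[OF I] q(8)[of x] B.ideal_zero[OF iQ] q(2) by simp
  qed
qed

text \<open>An ideal containing \<open>I\<close> is a union of cosets of \<open>I\<close>, so no
  information is lost in its image.\<close>

lemma coset_mem_image_iff:
  assumes I: "ideal I R" and Q: "ideal Q R" "I \<subseteq> Q" and x: "x \<in> carrier R"
  shows "I +> x \<in> (\<lambda>x. I +> x) ` Q \<longleftrightarrow> x \<in> Q"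
proof
  assume "I +> x \<in> (\<lambda>x. I +> x) ` Q"
  then obtain y where y: "y \<in> Q" "I +> x = I +> y" by blast
  have yc: "y \<in> carrier R" using ideal_carr[OF Q(1) y(1)] .
  have "x \<ominus> y \<in> I" using quotient_eq_iff_same_a_r_cos[OF I x yc] y(2) by simp
  then show "x \<in> Q" using ideal_swap_diff[OF Q(1) _ x yc] Q(2) y(1) by auto
qed simp

lemma prime_image_quot:
  assumes I: "ideal I R" and Q: "primeideal Q R" "I \<subseteq> Q"
  shows "primeideal ((\<lambda>x. I +> x) ` Q) (R Quot I)"
proof -
  note q = quot_facts[OF I]
  interpret B: cring "R Quot I" by (rule q(1))
  have iQ: "ideal Q R" using Q primeideal.axioms(1) by auto
  note iff = coset_mem_image_iff[OF I iQ Q(2)]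
  note c = ideal_carr[OF iQ]
  show ?thesis
  proof (rule primeidealI)
    show "ideal ((\<lambda>x. I +> x) ` Q) (R Quot I)"
    proof (rule B.idealI_add_mult)
      show "(\<lambda>x. I +> x) ` Q \<subseteq> carrier (R Quot I)" using c q(4) by auto
      show "\<zero>\<^bsub>R Quot I\<^esub> \<in> (\<lambda>x. I +> x) ` Q"
        using q(2) q(8)[OF zero_closed] ideal_zero[OF I] iff[OF zero_closed] ideal_zero[OF iQ] by simp
    next
      fix u v assume "u \<in> (\<lambda>x. I +> x) ` Q" "v \<in> (\<lambda>x. I +> x) ` Q"
      then obtain x y where xy: "x \<in> Q" "u = I +> x" "y \<in> Q" "v = I +> y" by blast
      then have "u \<oplus>\<^bsub>R Quot I\<^esub> v = I +> (x \<oplus> y)" "x \<oplus> y \<in> Q" using q(6)[of x y] c ideal_add[OF iQ] by auto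
      then show "u \<oplus>\<^bsub>R Quot I\<^esub> v \<in> (\<lambda>x. I +> x) ` Q" by blast
    next
      fix r u assume "r \<in> carrier (R Quot I)" "u \<in> (\<lambda>x. I +> x) ` Q"
      then obtain x y where xy: "x \<in> carrier R" "r = I +> x" "y \<in> Q" "u = I +> y" unfolding q(3) by blast
      then have "r \<otimes>\<^bsub>R Quot I\<^esub> u = I +> (x \<otimes> y)" "x \<otimes> y \<in> Q" using q(5)[of x y] c ideal.I_l_closed[OF iQ] by auto
      then show "r \<otimes>\<^bsub>R Quot I\<^esub> u \<in> (\<lambda>x. I +> x) ` Q" by blast
    qed
    show "cring (R Quot I)" by (rule q(1))
    show "carrier (R Quot I) \<noteq> (\<lambda>x. I +> x) ` Q"
      using iff[OF one_closed] primeideal_one[OF Q(1)] q(4)[OF one_closed] by blast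
    fix u v assume "u \<in> carrier (R Quot I)" "v \<in> carrier (R Quot I)" "u \<otimes>\<^bsub>R Quot I\<^esub> v \<in> (\<lambda>x. I +> x) ` Q"
    then obtain x y where xy: "x \<in> carrier R" "u = I +> x" "y \<in> carrier R" "v = I +> y"
      and "I +> (x \<otimes> y) \<in> (\<lambda>x. I +> x) ` Q" unfolding q(3) using q(5) by (elim imageE) auto
    then have "x \<otimes> y \<in> Q" using iff[of "x \<otimes> y"] by simp
    then show "u \<in> (\<lambda>x. I +> x) ` Q \<or> v \<in> (\<lambda>x. I +> x) ` Q"
      using primeideal_mult[OF Q(1) xy(1,3)] xy by auto
  qed
qed

text \<open>Annihilators in \<open>R/I\<close> pull back to ideals \<open>annih R I b\<close>, and
  primes over \<open>I\<close> correspond to primes of \<open>R/I\<close> with inclusions preserved,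
  so minimality can be tested on either side.\<close>

lemma exists_embedded_prime_quot:
  assumes I: "ideal I R" and t: "t \<in> carrier R"
  shows "(\<exists>Q. embedded_prime (R Quot I) Q \<and> I +> t \<in> Q) \<longleftrightarrow>
    (\<exists>P. primeideal P R \<and> (\<exists>b\<in>carrier R. P = annih R I b) \<and> P \<notin> minimal_primes R I \<and> t \<in> P)"
proof -
  let ?B = "R Quot I"
  note q = quot_facts[OF I]
  interpret B: cring ?B by (rule q(1))
  have an: "I +> x \<in> {r \<in> carrier ?B. r \<otimes>\<^bsub>?B\<^esub> (I +> b) = \<zero>\<^bsub>?B\<^esub>} \<longleftrightarrow> x \<in> annih R I b"
    if "x \<in> carrier R" "b \<in> carrier R" for x b
    using that q(4)[of x] q(5)[of x b] q(8)[of "x \<otimes> b"] by (simp add: q(2) annih_def)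
  show ?thesis
  proof
    assume "\<exists>Q. embedded_prime ?B Q \<and> I +> t \<in> Q"
    then obtain Q \<beta> where Q: "primeideal Q ?B" "\<beta> \<in> carrier ?B" "Q = {r \<in> carrier ?B. r \<otimes>\<^bsub>?B\<^esub> \<beta> = \<zero>\<^bsub>?B\<^esub>}"
      "Q \<notin> minimal_primes ?B {\<zero>\<^bsub>?B\<^esub>}" "I +> t \<in> Q"
      unfolding embedded_prime_def associated_prime_def by blast
    obtain b where b: "b \<in> carrier R" "\<beta> = I +> b" using Q(2) unfolding q(3) by blast
    let ?P = "{x \<in> carrier R. I +> x \<in> Q}"
    have P: "primeideal ?P R" "I \<subseteq> ?P" using prime_preimage_quot[OF I Q(1)] by auto
    have "?P = annih R I b"
      using an[OF _ b(1)] Q(3) b(2) by (auto simp: annih_def)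
    moreover have "?P \<notin> minimal_primes R I"
    proof
      assume m: "?P \<in> minimal_primes R I"
      have "Q \<in> minimal_primes ?B {\<zero>\<^bsub>?B\<^esub>}"
        unfolding minimal_primes_def
      proof (intro CollectI conjI allI impI Q(1))
        show "{\<zero>\<^bsub>?B\<^esub>} \<subseteq> Q" using B.ideal_zero[OF primeideal.axioms(1)[OF Q(1)]] by simp
        fix Q' assume Q': "primeideal Q' ?B \<and> {\<zero>\<^bsub>?B\<^esub>} \<subseteq> Q' \<and> Q' \<subseteq> Q"
        let ?P' = "{x \<in> carrier R. I +> x \<in> Q'}"
        have "primeideal ?P' R" "I \<subseteq> ?P'" using prime_preimage_quot[OF I] Q' by blast+
        moreover have "?P' \<subseteq> ?P" using Q' by blast
        ultimately have e: "?P' = ?P" using m unfolding minimal_primes_def by blast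
        have "Q \<subseteq> Q'"
        proof
          fix u assume u: "u \<in> Q"
          then obtain x where x: "x \<in> carrier R" "u = I +> x" using Q(3) q(3) by blast
          then have "x \<in> ?P'" unfolding e using u by simp
          then show "u \<in> Q'" using x by simp
        qed
        then show "Q' = Q" using Q' by blast
      qed
      then show False using Q(4) by simp
    qed
    ultimately show "\<exists>P. primeideal P R \<and> (\<exists>b\<in>carrier R. P = annih R I b) \<and> P \<notin> minimal_primes R I \<and> t \<in> P"
      using P(1) b(1) t Q(5) by (intro exI[of _ ?P] conjI bexI[of _ b]) auto
  next
    assume "\<exists>P. primeideal P R \<and> (\<exists>b\<in>carrier R. P = annih R I b) \<and> P \<notin> minimal_primes R I \<and> t \<in> P"
    then obtain P b where P: "primeideal P R" "b \<in> carrier R" "P = annih R I b" "P \<notin> minimal_primes R I" "t \<in> P"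
      by blast
    have IP: "I \<subseteq> P" using P(2,3) ideal_carr[OF I] ideal.I_r_closed[OF I] by (auto simp: annih_def)
    have iP: "ideal P R" using P(1) primeideal.axioms(1) by auto
    let ?Q = "(\<lambda>x. I +> x) ` P"
    have Q: "primeideal ?Q ?B" by (rule prime_image_quot[OF I P(1) IP])
    have "?Q = {r \<in> carrier ?B. r \<otimes>\<^bsub>?B\<^esub> (I +> b) = \<zero>\<^bsub>?B\<^esub>}"
    proof (intro equalityI subsetI)
      fix u assume "u \<in> ?Q"
      then obtain x where x: "x \<in> P" "u = I +> x" by blast
      then show "u \<in> {r \<in> carrier ?B. r \<otimes>\<^bsub>?B\<^esub> (I +> b) = \<zero>\<^bsub>?B\<^esub>}"
        using an[OF ideal_carr[OF iP x(1)] P(2)] P(3) by simp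
    next
      fix u assume u: "u \<in> {r \<in> carrier ?B. r \<otimes>\<^bsub>?B\<^esub> (I +> b) = \<zero>\<^bsub>?B\<^esub>}"
      then obtain x where x: "x \<in> carrier R" "u = I +> x" using q(3) by blast
      then show "u \<in> ?Q" using an[OF x(1) P(2)] u P(3) by blast
    qed
    then have "associated_prime ?B ?Q" unfolding associated_prime_def using Q q(4)[OF P(2)] by blast
    moreover have "?Q \<notin> minimal_primes ?B {\<zero>\<^bsub>?B\<^esub>}"
    proof
      assume m: "?Q \<in> minimal_primes ?B {\<zero>\<^bsub>?B\<^esub>}"
      have "P \<in> minimal_primes R I"
        unfolding minimal_primes_def
      proof (intro CollectI conjI allI impI P(1) IP)
        fix P' assume P': "primeideal P' R \<and> I \<subseteq> P' \<and> P' \<subseteq> P"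
        let ?Q' = "(\<lambda>x. I +> x) ` P'"
        have Q': "primeideal ?Q' ?B" using prime_image_quot[OF I] P' by blast
        have min: "Z = ?Q" if "primeideal Z ?B" "{\<zero>\<^bsub>?B\<^esub>} \<subseteq> Z" "Z \<subseteq> ?Q" for Z
          using m that unfolding minimal_primes_def by simp
        have e: "?Q' = ?Q"
        proof (rule min[OF Q'])
          show "{\<zero>\<^bsub>?B\<^esub>} \<subseteq> ?Q'" using B.ideal_zero[OF primeideal.axioms(1)[OF Q']] by simp
          show "?Q' \<subseteq> ?Q" using P' by (intro image_mono) simp
        qed
        have iP': "ideal P' R" using P' primeideal.axioms(1) by auto
        have "P \<subseteq> P'"
        proof
          fix x assume x: "x \<in> P"
          then have "I +> x \<in> ?Q'" unfolding e by blast
          then show "x \<in> P'" using coset_mem_image_iff[OF I iP' _ ideal_carr[OF iP x]] P' by blast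
        qed
        then show "P' = P" using P' by blast
      qed
      then show False using P(4) by simp
    qed
    ultimately show "\<exists>Q. embedded_prime ?B Q \<and> I +> t \<in> Q"
      unfolding embedded_prime_def using P(5) by blast
  qed
qed

lemma quot_map_ring_hom:
  assumes I: "ideal I (mpoly_ring R n)"
  shows "quot_map R n I \<in> ring_hom R (mpoly_ring R n Quot I)"
proof -
  interpret E: cring "mpoly_ring R n" by (rule cring_mpoly_ring)
  note q = E.quot_facts[OF I]
  have o: "\<one>\<^bsub>mpoly_ring R n\<^esub> = indexed_const \<one>" by (simp add: mpoly_simps indexed_const_mono)
  show ?thesis
    unfolding quot_map_def
    by (rule ring_hom_memI)
      (simp_all add: indexed_const_carrier q(4-7) indexed_const_mult indexed_const_add o)
qed

lemma module_restrict_scalars: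
  assumes B: "cring B" and h: "h \<in> ring_hom R B"
  shows "module R (restrict_scalars B h)"
proof -
  interpret B: cring B by (rule B)
  note hD = ring_hom_closed[OF h] ring_hom_mult[OF h] ring_hom_add[OF h] ring_hom_one[OF h]
  show ?thesis
  proof (rule moduleI[OF is_cring])
    show "abelian_group (restrict_scalars B h)"
    proof (rule abelian_groupI)
      fix x assume "x \<in> carrier (restrict_scalars B h)"
      then show "\<exists>y\<in>carrier (restrict_scalars B h). y \<oplus>\<^bsub>restrict_scalars B h\<^esub> x = \<zero>\<^bsub>restrict_scalars B h\<^esub>"
        by (intro bexI[of _ "\<ominus>\<^bsub>B\<^esub> x"]) (auto simp: restrict_scalars_def B.l_neg)
    qed (auto simp: restrict_scalars_def B.a_ac)
  qed (auto simp: restrict_scalars_def hD B.l_distr B.r_distr B.m_assoc)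
qed

end

section \<open>Flatness of the quotient and contraction of its primes, both decided by the
  uniformizer\<close>

lemma (in principal_domain) flat_hom_quot_iff:
  assumes d: "discrete_valuation_ring R" and t: "uniformizer R t" and I: "ideal I (mpoly_ring R n)"
  shows "flat_hom TYPE('u) R (mpoly_ring R n Quot I) (quot_map R n I) \<longleftrightarrow>
    ideal_quotient (mpoly_ring R n) I (PIdl\<^bsub>mpoly_ring R n\<^esub> (indexed_const t)) \<subseteq> I"
proof -
  let ?E = "mpoly_ring R n"
  let ?B = "?E Quot I"
  let ?h = "quot_map R n I"
  let ?N = "restrict_scalars ?B ?h"
  interpret E: cring ?E by (rule cring_mpoly_ring)
  note q = E.quot_facts[OF I]
  have tc: "t \<in> carrier R" using t by (simp add: uniformizer_def)
  have h: "?h \<in> ring_hom R ?B" by (rule quot_map_ring_hom[OF I])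
  have N: "module R ?N" by (rule module_restrict_scalars[OF q(1) h])
  have t': "indexed_const t \<in> carrier ?E" by (rule indexed_const_carrier[OF tc])
  have sm: "t \<odot>\<^bsub>?N\<^esub> (I +>\<^bsub>?E\<^esub> b) = \<zero>\<^bsub>?N\<^esub> \<longleftrightarrow> indexed_const t \<otimes>\<^bsub>?E\<^esub> b \<in> I" if "b \<in> carrier ?E" for b
    using that q(5)[OF t' that] q(8)[of "indexed_const t \<otimes>\<^bsub>?E\<^esub> b"] t' q(2) by (simp add: restrict_scalars_def quot_map_def)
  have zero: "I +>\<^bsub>?E\<^esub> b = \<zero>\<^bsub>?N\<^esub> \<longleftrightarrow> b \<in> I" if "b \<in> carrier ?E" for b
    using q(8)[OF that] q(2) by (simp add: restrict_scalars_def)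
  have carr: "carrier ?N = (\<lambda>x. I +>\<^bsub>?E\<^esub> x) ` carrier ?E" using q(3) by (simp add: restrict_scalars_def)
  have "flat_hom TYPE('u) R ?B ?h \<longleftrightarrow> flat_module TYPE('u) R ?N" using h by (simp add: flat_hom_def)
  also have "\<dots> \<longleftrightarrow> (\<forall>x\<in>carrier ?N. t \<odot>\<^bsub>?N\<^esub> x = \<zero>\<^bsub>?N\<^esub> \<longrightarrow> x = \<zero>\<^bsub>?N\<^esub>)"
  proof
    assume f: "flat_module TYPE('u) R ?N"
    show "\<forall>x\<in>carrier ?N. t \<odot>\<^bsub>?N\<^esub> x = \<zero>\<^bsub>?N\<^esub> \<longrightarrow> x = \<zero>\<^bsub>?N\<^esub>"
      using flat_module_torsion_free[OF domain_axioms f tc uniformizer_nonzero[OF d t]] by blast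
  next
    assume *: "\<forall>x\<in>carrier ?N. t \<odot>\<^bsub>?N\<^esub> x = \<zero>\<^bsub>?N\<^esub> \<longrightarrow> x = \<zero>\<^bsub>?N\<^esub>"
    show "flat_module TYPE('u) R ?N"
      by (rule torsion_free_flat_module[OF d t N]) (use * in simp)
  qed
  also have "\<dots> \<longleftrightarrow> (\<forall>b\<in>carrier ?E. indexed_const t \<otimes>\<^bsub>?E\<^esub> b \<in> I \<longrightarrow> b \<in> I)"
    unfolding carr ball_simps using sm zero by simp
  also have "\<dots> \<longleftrightarrow> ideal_quotient ?E I (PIdl\<^bsub>?E\<^esub> (indexed_const t)) \<subseteq> I"
  proof -
    have "b \<in> ideal_quotient ?E I (PIdl\<^bsub>?E\<^esub> (indexed_const t)) \<longleftrightarrow> b \<in> carrier ?E \<and> indexed_const t \<otimes>\<^bsub>?E\<^esub> b \<in> I" for b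
    proof
      assume "b \<in> ideal_quotient ?E I (PIdl\<^bsub>?E\<^esub> (indexed_const t))"
      then have b: "b \<in> carrier ?E" "\<And>x. x \<in> PIdl\<^bsub>?E\<^esub> (indexed_const t) \<Longrightarrow> b \<otimes>\<^bsub>?E\<^esub> x \<in> I"
        by (auto simp: ideal_quotient_def)
      have "b \<otimes>\<^bsub>?E\<^esub> indexed_const t \<in> I" by (rule b(2)[OF E.cgenideal_self[OF t']])
      then show "b \<in> carrier ?E \<and> indexed_const t \<otimes>\<^bsub>?E\<^esub> b \<in> I" using b(1) E.m_comm[OF b(1) t'] by simp
    next
      assume b: "b \<in> carrier ?E \<and> indexed_const t \<otimes>\<^bsub>?E\<^esub> b \<in> I"
      have "b \<otimes>\<^bsub>?E\<^esub> (x \<otimes>\<^bsub>?E\<^esub> indexed_const t) \<in> I" if x: "x \<in> carrier ?E" for x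
      proof -
        have "x \<otimes>\<^bsub>?E\<^esub> (indexed_const t \<otimes>\<^bsub>?E\<^esub> b) \<in> I" using ideal.I_l_closed[OF I _ x] b by blast
        moreover have "x \<otimes>\<^bsub>?E\<^esub> (indexed_const t \<otimes>\<^bsub>?E\<^esub> b) = b \<otimes>\<^bsub>?E\<^esub> (x \<otimes>\<^bsub>?E\<^esub> indexed_const t)"
          using x t' b by (simp add: E.m_ac)
        ultimately show ?thesis by simp
      qed
      then show "b \<in> ideal_quotient ?E I (PIdl\<^bsub>?E\<^esub> (indexed_const t))"
        using b by (auto simp: ideal_quotient_def cgenideal_def)
    qed
    then show ?thesis by blast
  qed
  finally show ?thesis .
qed

text \<open>The contraction is a proper ideal. If it is nonzero, some \<open>b\<close> outside it
  has \<open>b t\<close> inside, and primality of \<open>P\<close> puts the image of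
  \<open>t\<close> into \<open>P\<close>.\<close>

lemma (in principal_domain) contraction_zero_iff:
  assumes d: "discrete_valuation_ring R" and t: "uniformizer R t" and B: "cring B"
    and h: "h \<in> ring_hom R B" and P: "primeideal P B"
  shows "{a \<in> carrier R. h a \<in> P} = {\<zero>} \<longleftrightarrow> h t \<notin> P"
proof -
  interpret B: cring B by (rule B)
  interpret h: ring_hom_ring R B h
    by (rule ring_hom_ringI2[OF ring_axioms B.ring_axioms h])
  have tc: "t \<in> carrier R" using t by (simp add: uniformizer_def)
  let ?q = "{a \<in> carrier R. h a \<in> P}"
  have iP: "ideal P B" using P primeideal.axioms(1) by auto
  have q: "ideal ?q R"
  proof (rule idealI_add_mult)
    show "\<zero> \<in> ?q" using B.ideal_zero[OF iP] by simp
  qed (use B.ideal_add[OF iP] ideal.I_l_closed[OF iP] in auto)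
  have "\<one> \<notin> ?q" using primeideal_one[OF P] by simp
  then have ne: "?q \<noteq> carrier R" by blast
  show ?thesis
  proof
    assume "?q = {\<zero>}"
    then show "h t \<notin> P" using uniformizer_nonzero[OF d t] tc by blast
  next
    assume n: "h t \<notin> P"
    have "a = \<zero>" if a: "a \<in> ?q" for a
    proof (rule ccontr)
      assume "a \<noteq> \<zero>"
      then obtain b where b: "b \<in> carrier R" "b \<notin> ?q" "b \<otimes> t \<in> ?q" using dvr_ideal_divide[OF d t q ne a] by blast
      then have "h b \<otimes>\<^bsub>B\<^esub> h t \<in> P" using tc by simp
      then show False using primeideal_mult[OF P, of "h b" "h t"] b tc n by simp
    qed
    then show "?q = {\<zero>}" using ideal_zero[OF q] by blast
  qed
qed

theorem proposition3p1:
  fixes K :: "'k ring" and A :: "'a ring" and \<phi> :: "'k \<Rightarrow> 'a" and \<tau> :: 'a and n :: nat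
    and R :: "(nat multiset \<Rightarrow> 'a) ring" and I J :: "(nat multiset \<Rightarrow> 'a) set"
    and B :: "(nat multiset \<Rightarrow> 'a) set ring" and h :: "'a \<Rightarrow> (nat multiset \<Rightarrow> 'a) set"
    and fs :: "(nat multiset \<Rightarrow> 'a) list"
  assumes "field K" and "char_zero K" and "\<phi> \<in> ring_hom K A"
    and "discrete_valuation_ring A" and "uniformizer A \<tau>"
    and "R = mpoly_ring A n" and "ideal I R"
    and "B = R Quot I" and "h = quot_map A n I"
    and "equidimensional_quotient R I"
    and "regular_sequence R fs" and "J = Idl\<^bsub>R\<^esub> (set fs)" and "J \<subseteq> I"
    and "enat (length fs) = ideal_height R I"
  shows "((\<nexists>P. embedded_prime B P) \<longleftrightarrow> ideal_quotient R J (ideal_quotient R J I) \<subseteq> I) \<and>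
         (flat_hom TYPE('u) A B h \<longleftrightarrow>
            ideal_quotient R I (PIdl\<^bsub>R\<^esub> (ring.indexed_const A \<tau>)) \<subseteq> I) \<and>
         (internally_flat A B h \<longleftrightarrow>
            ideal_quotient R I (PIdl\<^bsub>R\<^esub> (ring.indexed_const A \<tau>)) \<inter>
              ideal_quotient R J (ideal_quotient R J I) \<subseteq> I)"
proof -
  interpret A: principal_domain A using assms(4) by (simp add: discrete_valuation_ring_def)
  interpret R: cring R unfolding assms(6) by (rule A.cring_mpoly_ring)
  interpret R: noetherian_cring R
    using A.mpoly_ring_noetherian_regular[of n] R.is_cring unfolding assms(6) by (intro noetherian_cring.intro) auto
  have reg: "noetherian_cring_prime.regular_prime R P" if "primeideal P R" for P
    using A.mpoly_ring_noetherian_regular[of n] that unfolding assms(6) by blast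
  have I: "ideal I R" by fact
  have \<tau>: "\<tau> \<in> carrier A" using assms(5) by (simp add: uniformizer_def)
  let ?\<tau> = "A.indexed_const \<tau>"
  have \<tau>': "?\<tau> \<in> carrier R" unfolding assms(6) by (rule A.indexed_const_carrier[OF \<tau>])
  have hR: "h \<in> ring_hom A B" unfolding assms(8,9) using A.quot_map_ring_hom I unfolding assms(6) by blast
  have B: "cring B" unfolding assms(8) by (rule R.quot_facts(1)[OF I])
  have wr: "weakly_regular R fs" using assms(11) unfolding regular_sequence_def weakly_regular_def by blast
  have U: "ideal_quotient R J (ideal_quotient R J I) = unmixed_part R I"
    by (rule R.double_ideal_quotient_unmixed_part[OF reg I assms(10) wr assms(12-14)])
  have emb: "(\<exists>Q. embedded_prime B Q \<and> I +>\<^bsub>R\<^esub> t \<in> Q) \<longleftrightarrow>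
      \<not> ideal_quotient R I (PIdl\<^bsub>R\<^esub> t) \<inter> unmixed_part R I \<subseteq> I" if "t \<in> carrier R" for t
    unfolding assms(8) R.exists_embedded_prime_quot[OF I that] by (rule R.exists_embedded_containing[OF I that])
  have 1: "(\<nexists>P. embedded_prime B P) \<longleftrightarrow> unmixed_part R I \<subseteq> I"
  proof -
    interpret B: cring B by (rule B)
    have "I +>\<^bsub>R\<^esub> \<zero>\<^bsub>R\<^esub> \<in> Q" if "embedded_prime B Q" for Q
    proof -
      have "ideal Q B" using that primeideal.axioms(1) unfolding embedded_prime_def associated_prime_def by blast
      then have "\<zero>\<^bsub>B\<^esub> \<in> Q" by (rule B.ideal_zero)
      then show ?thesis
        using R.quot_facts(2)[OF I] R.quot_facts(8)[OF I R.zero_closed] R.ideal_zero[OF I] by (simp add: assms(8))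
    qed
    \<comment> \<open>As \<open>I : 0\<close> is the whole ring, the case \<open>t = \<zero>\<close>
      of \<open>emb\<close> retains only the unmixed part.\<close>
    moreover have "ideal_quotient R I (PIdl\<^bsub>R\<^esub> \<zero>\<^bsub>R\<^esub>) = carrier R"
      using R.ideal_zero[OF I] by (auto simp: ideal_quotient_def cgenideal_def)
    moreover have "unmixed_part R I \<subseteq> carrier R" by (auto simp: unmixed_part_def)
    ultimately show ?thesis using emb[OF R.zero_closed] by (metis Int_absorb1)
  qed
  have 2: "flat_hom TYPE('u) A B h \<longleftrightarrow> ideal_quotient R I (PIdl\<^bsub>R\<^esub> ?\<tau>) \<subseteq> I"
    using A.flat_hom_quot_iff[OF assms(4,5) I[unfolded assms(6)]] unfolding assms(6,8,9) .
  have "h \<tau> = I +>\<^bsub>R\<^esub> ?\<tau>" unfolding assms(6,9) by (simp add: quot_map_def)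
  moreover have "{a \<in> carrier A. h a \<in> Q} = {\<zero>\<^bsub>A\<^esub>} \<longleftrightarrow> h \<tau> \<notin> Q" if "embedded_prime B Q" for Q
    using that A.contraction_zero_iff[OF assms(4,5) B hR]
    unfolding embedded_prime_def associated_prime_def by simp
  ultimately have "internally_flat A B h \<longleftrightarrow> \<not> (\<exists>Q. embedded_prime B Q \<and> I +>\<^bsub>R\<^esub> ?\<tau> \<in> Q)"
    unfolding internally_flat_def using hR by simp
  then have 3: "internally_flat A B h \<longleftrightarrow>
      ideal_quotient R I (PIdl\<^bsub>R\<^esub> ?\<tau>) \<inter> unmixed_part R I \<subseteq> I"
    using emb[OF \<tau>'] by simp
  show ?thesis unfolding U using 1 2 3 by blast
qed

end
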